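(* Let $f, g_1,\ldots,g_m$ be convex polynomials on $\mathbb{R}^n$ with $K := \{x\in\mathbb{R}^n \mid g_1(x)\le 0,\ldots,g_m(x)\le 0\}\neq\emptyset$, and consider the problem $f^* := \min_{x\in K} f(x)$. Let $L:\mathbb{R}^n\times\mathbb{R}^m_+\to\mathbb{R}$ be the Lagrangian function defined by $L(x,\lambda)=f(x)+\sum_{i=1}^m\lambda_i g_i(x)$. Assume that $L$ has a saddle-point $(x^*,\lambda^* )\in K\times\mathbb{R}^m_+$ with $\nabla^2_{xx}L(x^*,\lambda^* )\succ 0$. Let $c\in\mathbb{R}$ be such that $c>f(x^0)$ for some $x^0\in K$, and for each integer $k$ let $f_k^* := \sup\{\mu\in\mathbb{R} \mid f-\mu\in\mathbf{M}_k\}$, where $\mathbf{M}_k$ is the truncated quadratic module generated by $c-f,-g_1,\ldots,-g_m$. Then there exists an integer $k$ such that $f_k^*=f^*$ and the supremum defining $f_k^*$ is attained.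
   Context: $\mathbb{R}[\underline{x}]$ is the ring of real polynomials in $x=(x_1,\ldots,x_n)$, and $\mathbb{R}^m_+$ is the non-negative orthant. $\Sigma^2\subset\mathbb{R}[\underline{x}]$ is the set of sum-of-squares polynomials (finite sums of squares of polynomials in $\mathbb{R}[\underline{x}]$). For each integer $k$, $$\mathbf{M}_k := \Big\{\sigma_0-\sum_{i=1}^m\sigma_i g_i+\sigma(c-f) \ \Big|\ \sigma,\sigma_0,\sigma_1,\ldots,\sigma_m\in\Sigma^2,\ \deg\sigma_0\le 2k,\ \deg(\sigma_i g_i)\le 2k\ (i=1,\ldots,m),\ \deg(\sigma(c-f))\le 2k\Big\}.$$ The supremum of the empty set is $-\infty$, and the zero polynomial satisfies every degree bound. A pair $(x^*,\lambda^* )$ with $\lambda^*\in\mathbb{R}^m_+$ is a saddle-point of $L$ if $L(x,\lambda^* )\ge L(x^*,\lambda^* )\ge L(x^*,\lambda)$ for all $x\in\mathbb{R}^n$ and all $\lambda\in\mathbb{R}^m_+$. $\nabla^2_{xx}L$ is the Hessian of $L$ with respect to $x$, and $\succ 0$ means positive definite. *)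

theory Defs
  imports "HOL-Analysis.Analysis" "HOL-Library.Poly_Mapping"
begin

text \<open>
  A real polynomial in variables indexed by \<open>'n\<close> is a finitely supported map from exponent
  vectors to coefficients; \<open>*\<close> on this type is convolution, i.e. polynomial multiplication.
\<close>

type_synonym 'n rpoly = "('n \<Rightarrow>\<^sub>0 nat) \<Rightarrow>\<^sub>0 real"

definition const_poly :: "real \<Rightarrow> 'n rpoly" where
  "const_poly a = Poly_Mapping.single 0 a"

definition eval_poly :: "'n::finite rpoly \<Rightarrow> real ^ 'n \<Rightarrow> real" where
  "eval_poly p x =
     (\<Sum>e\<in>Poly_Mapping.keys p.
        Poly_Mapping.lookup p e * (\<Prod>i\<in>UNIV. (x $ i) ^ Poly_Mapping.lookup e i))"

text \<open>
  Total degree at most \<open>d\<close>. The zero polynomial satisfies this for every integer \<open>d\<close>,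
  negative ones included.
\<close>

definition deg_le :: "'n::finite rpoly \<Rightarrow> int \<Rightarrow> bool" where
  "deg_le p d \<longleftrightarrow>
     (\<forall>e\<in>Poly_Mapping.keys p. int (\<Sum>i\<in>UNIV. Poly_Mapping.lookup e i) \<le> d)"

definition sos_polys :: "'n rpoly set" where
  "sos_polys = {p. \<exists>qs :: 'n rpoly list. p = (\<Sum>q\<leftarrow>qs. q ^ 2)}"

definition trunc_qmodule ::
  "'n::finite rpoly \<Rightarrow> ('m::finite \<Rightarrow> 'n rpoly) \<Rightarrow> real \<Rightarrow> int \<Rightarrow> 'n rpoly set" where
  "trunc_qmodule f g c k =
     {\<sigma>0 - (\<Sum>i\<in>UNIV. \<sigma>s i * g i) + \<sigma> * (const_poly c - f) | \<sigma> \<sigma>0 \<sigma>s.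
        \<sigma> \<in> sos_polys \<and> \<sigma>0 \<in> sos_polys \<and> (\<forall>i. \<sigma>s i \<in> sos_polys) \<and>
        deg_le \<sigma>0 (2 * k) \<and> (\<forall>i. deg_le (\<sigma>s i * g i) (2 * k)) \<and>
        deg_le (\<sigma> * (const_poly c - f)) (2 * k)}"

definition feasible_set :: "('m::finite \<Rightarrow> 'n::finite rpoly) \<Rightarrow> (real ^ 'n) set" where
  "feasible_set g = {x. \<forall>i. eval_poly (g i) x \<le> 0}"

text \<open>
  Optimal values are extended reals, so that the supremum of the empty set is \<open>-\<infinity>\<close>.
\<close>

definition opt_value :: "'n::finite rpoly \<Rightarrow> ('m::finite \<Rightarrow> 'n rpoly) \<Rightarrow> ereal" where
  "opt_value f g = (INF x\<in>feasible_set g. ereal (eval_poly f x))"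

definition relax_feasible ::
  "'n::finite rpoly \<Rightarrow> ('m::finite \<Rightarrow> 'n rpoly) \<Rightarrow> real \<Rightarrow> int \<Rightarrow> real set" where
  "relax_feasible f g c k = {\<mu>. f - const_poly \<mu> \<in> trunc_qmodule f g c k}"

definition relax_value ::
  "'n::finite rpoly \<Rightarrow> ('m::finite \<Rightarrow> 'n rpoly) \<Rightarrow> real \<Rightarrow> int \<Rightarrow> ereal" where
  "relax_value f g c k = (SUP \<mu>\<in>relax_feasible f g c k. ereal \<mu>)"

definition lagrangian ::
  "'n::finite rpoly \<Rightarrow> ('m::finite \<Rightarrow> 'n rpoly) \<Rightarrow> real ^ 'n \<Rightarrow> real ^ 'm \<Rightarrow> real" where
  "lagrangian f g x l = eval_poly f x + (\<Sum>i\<in>UNIV. l $ i * eval_poly (g i) x)"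

definition nonneg_orthant :: "(real ^ 'm::finite) set" where
  "nonneg_orthant = {l. \<forall>i. 0 \<le> l $ i}"

definition saddle_point ::
  "(real ^ 'n::finite \<Rightarrow> real ^ 'm::finite \<Rightarrow> real) \<Rightarrow> real ^ 'n \<Rightarrow> real ^ 'm \<Rightarrow> bool" where
  "saddle_point L xs ls \<longleftrightarrow>
     ls \<in> nonneg_orthant \<and>
     (\<forall>x. \<forall>l\<in>nonneg_orthant. L x ls \<ge> L xs ls \<and> L xs ls \<ge> L xs l)"

definition partial_deriv ::
  "'n::finite \<Rightarrow> (real ^ 'n \<Rightarrow> real) \<Rightarrow> real ^ 'n \<Rightarrow> real" where
  "partial_deriv i h x = deriv (\<lambda>t. h (x + t *\<^sub>R axis i 1)) 0"

definition hessian :: "(real ^ 'n::finite \<Rightarrow> real) \<Rightarrow> real ^ 'n \<Rightarrow> real ^ 'n ^ 'n" where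
  "hessian h x = (\<chi> i j. partial_deriv i (partial_deriv j h) x)"

definition pos_definite :: "real ^ 'n ^ 'n::finite \<Rightarrow> bool" where
  "pos_definite A \<longleftrightarrow> transpose A = A \<and> (\<forall>v. v \<noteq> 0 \<longrightarrow> 0 < v \<bullet> (A *v v))"

end

theory Submission
  imports Defs
begin

text \<open>
  Let \<open>h = L(\<cdot>, \<lambda>*) - f*\<close>, a convex polynomial with a zero at its minimizer \<open>x*\<close> and a positive
  definite Hessian there, and \<open>r = c - f*\<close>. Since \<open>r - h = (c - f) + \<Sum> \<lambda>*\<^sub>i (- g\<^sub>i)\<close>, it is enough to
  write \<open>h = \<sigma>\<^sub>0 + \<sigma> (r - h)\<close> with sums of squares \<open>\<sigma>\<^sub>0\<close>, \<open>\<sigma>\<close>. As there is a single generator, the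
  quadratic module \<open>T\<close> of \<open>r - h\<close> is closed under multiplication.

  \<open>T\<close> is Archimedean: otherwise \<open>T\<close> extends to a total preordering of the polynomial ring in which
  \<open>|x|\<^sup>2\<close> is infinitely large. In suitable linear coordinates, a convex polynomial that is positive away
  from its zero has a positive definite weighted-homogeneous leading form, so comparing the weights
  with the largest coordinate shows that \<open>h\<close> is infinitely large too, against \<open>h \<le> r\<close>.

  By Taylor's formula \<open>h(x) = y\<^sup>T F(x) y\<close> with \<open>y = x - x*\<close> and a polynomial matrix \<open>F\<close> that is positive
  definite everywhere. Bernstein expansion on a large box writes \<open>F\<close> as a combination of constant
  positive definite matrices, whose coefficients are products of \<open>R + y\<^sub>i\<close> and \<open>R - y\<^sub>i\<close>. These lie
  in \<open>T\<close>, so \<open>h\<close> does.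
\<close>

section \<open>Polynomials and their values\<close>

text \<open>Three obstacles shape the argument. As \<open>h\<close> has a zero, representations of
  strictly positive polynomials would only give values below f* and no attainment; the zero is
  therefore absorbed into a quadratic form, and strict positivity is asked of its matrix. Next, an
  inequality known at real points cannot simply be transferred to a total preordering of the
  polynomial ring. Only standard parts, which are real numbers, are ever substituted into such
  inequalities. Finally, the top-degree form of a convex polynomial can be degenerate, as for x^2 +
  y^4, so it does not control growth; directions are instead sorted by the degree of
  \<open>h\<close> along them, and each coordinate receives its own weight.

  The constraints themselves need not bound the feasible set. Compactness enters through c - f:
  combined with the constraints by the multipliers it gives r - h, which is non-negative exactly on
  a compact sublevel set of \<open>h\<close>. The order k is fixed last, from the degrees of the
  multipliers found.\<close>

definition monomial_value :: "('n::finite \<Rightarrow>\<^sub>0 nat) \<Rightarrow> real ^ 'n \<Rightarrow> real" where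
  "monomial_value e x = (\<Prod>i\<in>UNIV. (x $ i) ^ Poly_Mapping.lookup e i)"

lemma monomial_value_add: "monomial_value (e + e') x = monomial_value e x * monomial_value e' x"
  by (simp add: monomial_value_def lookup_add power_add prod.distrib)

lemma eval_poly_superset:
  assumes "finite S" "Poly_Mapping.keys p \<subseteq> S"
  shows "eval_poly p x = (\<Sum>e\<in>S. Poly_Mapping.lookup p e * monomial_value e x)"
  unfolding eval_poly_def monomial_value_def
  by (rule sum.mono_neutral_left) (use assms in \<open>auto simp: in_keys_iff\<close>)

lemma eval_poly_add [simp]: "eval_poly (p + q) x = eval_poly p x + eval_poly q x"
proof -
  let ?S = "Poly_Mapping.keys p \<union> Poly_Mapping.keys q"
  have "Poly_Mapping.keys (p + q) \<subseteq> ?S" by (rule keys_add)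
  then show ?thesis
    by (subst (1 2 3) eval_poly_superset[of ?S])
       (auto simp: lookup_add sum.distrib algebra_simps)
qed

lemma eval_poly_single [simp]: "eval_poly (Poly_Mapping.single e a) x = a * monomial_value e x"
  by (subst eval_poly_superset[of "{e}"]) auto

lemma eval_poly_0 [simp]: "eval_poly 0 x = 0"
  by (simp add: eval_poly_def)

lemma eval_poly_const [simp]: "eval_poly (const_poly a) x = a"
  by (simp add: const_poly_def monomial_value_def)

lemma eval_poly_uminus [simp]: "eval_poly (- p) x = - eval_poly p x"
  using eval_poly_add[of p "- p" x] by simp

lemma eval_poly_diff [simp]: "eval_poly (p - q) x = eval_poly p x - eval_poly q x"
  using eval_poly_add[of p "- q" x] by simp

lemma rpoly_induct [case_names zero add]:
  assumes "P 0" "\<And>e a p. P p \<Longrightarrow> P (Poly_Mapping.single e a + p)"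
  shows "P (p :: 'n rpoly)"
proof (induction p rule: update_induct)
  case const then show ?case by (rule assms)
next
  case (update f a b)
  have "Poly_Mapping.update a b f = Poly_Mapping.single a b + f"
    using update.hyps by (intro poly_mapping_eqI) (auto simp: lookup_update lookup_add lookup_single when_def in_keys_iff)
  then show ?case using assms(2) update.IH by simp
qed

lemma eval_poly_mult [simp]: "eval_poly (p * q) x = eval_poly p x * eval_poly q x"
proof (induction p rule: rpoly_induct)
  case (add e a p)
  have "eval_poly (Poly_Mapping.single e a * q) x = a * monomial_value e x * eval_poly q x"
    by (induction q rule: rpoly_induct) (auto simp: distrib_left mult_single monomial_value_add algebra_simps)
  with add show ?case by (simp add: algebra_simps)
qed simp

lemma const_poly_1: "const_poly 1 = 1"
  by (simp add: const_poly_def)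

lemma eval_poly_1 [simp]: "eval_poly 1 x = 1"
  by (metis const_poly_1 eval_poly_const)

lemma eval_poly_power [simp]: "eval_poly (p ^ k) x = eval_poly p x ^ k"
  by (induction k) auto

lemma eval_poly_sum [simp]: "eval_poly (\<Sum>i\<in>S. p i) x = (\<Sum>i\<in>S. eval_poly (p i) x)"
  by (induction S rule: infinite_finite_induct) auto

lemma eval_poly_prod [simp]: "eval_poly (\<Prod>i\<in>S. p i) x = (\<Prod>i\<in>S. eval_poly (p i) x)"
  by (induction S rule: infinite_finite_induct) auto

text \<open>Induction on the set of variables: in the new variable the sum is a univariate
  polynomial in \<open>t\<close> that vanishes identically, so each coefficient vanishes, and such a
  coefficient is a sum of the same kind in the remaining variables. Exponents are functions on all
  of \<open>'n\<close>; injectivity of restriction to \<open>S\<close> says that distinct exponents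
  give distinct monomials in the variables of \<open>S\<close>.\<close>

lemma monomials_independent:
  fixes c :: "('n::finite \<Rightarrow> nat) \<Rightarrow> real"
  assumes "finite S" "finite A" "inj_on (\<lambda>\<alpha>. restrict \<alpha> S) A"
    and "\<And>x::'n \<Rightarrow> real. (\<Sum>\<alpha>\<in>A. c \<alpha> * (\<Prod>i\<in>S. x i ^ \<alpha> i)) = 0" and "\<alpha> \<in> A"
  shows "c \<alpha> = 0"
  using assms
proof (induction S arbitrary: A \<alpha> rule: finite_induct)
  case empty
  have "A = {\<alpha>}" using empty.prems by (auto simp: inj_on_def)
  then show ?case using empty.prems(3)[of undefined] by simp
next
  case (insert k S)
  define m where "m = Max ((\<lambda>\<alpha>. \<alpha> k) ` A)"
  have m: "\<alpha> k \<le> m" if "\<alpha> \<in> A" for \<alpha> using that insert.prems(1) by (simp add: m_def)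
  define Ak where "Ak = {\<beta>\<in>A. \<beta> k = \<alpha> k}"
  show ?case
  proof (rule insert.IH[of Ak])
    show "finite Ak" using insert.prems(1) by (simp add: Ak_def)
    show "inj_on (\<lambda>\<alpha>. restrict \<alpha> S) Ak"
    proof (rule inj_onI)
      fix \<beta> \<gamma> assume *: "\<beta> \<in> Ak" "\<gamma> \<in> Ak" "restrict \<beta> S = restrict \<gamma> S"
      have "\<beta> i = \<gamma> i" if "i \<in> insert k S" for i
        using that * restrict_apply'[of i S] by (metis (mono_tags, lifting) Ak_def insertE mem_Collect_eq)
      then have "restrict \<beta> (insert k S) = restrict \<gamma> (insert k S)" by auto
      then show "\<beta> = \<gamma>" using inj_onD[OF insert.prems(2), of \<beta> \<gamma>] *(1,2) unfolding Ak_def by blast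
    qed
    show "\<alpha> \<in> Ak" using insert.prems by (simp add: Ak_def)
    fix x :: "'n \<Rightarrow> real"
    define a where "a j = (\<Sum>\<beta>\<in>{\<beta>\<in>A. \<beta> k = j}. c \<beta> * (\<Prod>i\<in>S. x i ^ \<beta> i))" for j
    have "(\<Sum>j\<le>m. a j * t ^ j) = 0" for t
    proof -
      have "(\<Sum>j\<le>m. a j * t ^ j) =
        (\<Sum>j\<le>m. \<Sum>\<beta>\<in>{\<beta>\<in>A. \<beta> k = j}. c \<beta> * (\<Prod>i\<in>S. x i ^ \<beta> i) * t ^ \<beta> k)"
        by (simp add: a_def sum_distrib_right)
      also have "\<dots> = (\<Sum>\<beta>\<in>A. c \<beta> * (\<Prod>i\<in>S. x i ^ \<beta> i) * t ^ \<beta> k)"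
        by (rule sum.group) (use insert.prems(1) m in auto)
      also have "\<dots> = (\<Sum>\<beta>\<in>A. c \<beta> * (\<Prod>i\<in>insert k S. (x(k := t)) i ^ \<beta> i))"
      proof (rule sum.cong)
        fix \<beta>
        have "(\<Prod>i\<in>S. (x(k := t)) i ^ \<beta> i) = (\<Prod>i\<in>S. x i ^ \<beta> i)"
          by (rule prod.cong) (use insert.hyps in auto)
        then show "c \<beta> * (\<Prod>i\<in>S. x i ^ \<beta> i) * t ^ \<beta> k = c \<beta> * (\<Prod>i\<in>insert k S. (x(k := t)) i ^ \<beta> i)"
          using insert.hyps by simp
      qed simp
      finally show ?thesis using insert.prems(3) by simp
    qed
    then have "a (\<alpha> k) = 0"
      using Transcendental.polyfun_eq_0[of a m] m[OF insert.prems(4)] by blast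
    then show "(\<Sum>\<beta>\<in>Ak. c \<beta> * (\<Prod>i\<in>S. x i ^ \<beta> i)) = 0" by (simp add: a_def Ak_def)
  qed
qed

lemma eval_poly_eq_0: 
  assumes "\<And>x. eval_poly p x = 0" shows "p = 0"
proof (rule poly_mapping_eqI)
  fix e
  show "Poly_Mapping.lookup p e = Poly_Mapping.lookup 0 e"
  proof (cases "e \<in> Poly_Mapping.keys p")
    case True
    let ?A = "Poly_Mapping.lookup ` Poly_Mapping.keys p"
    let ?c = "\<lambda>\<alpha>. Poly_Mapping.lookup p (Poly_Mapping.Abs_poly_mapping \<alpha>)"
    have inj: "inj_on Poly_Mapping.lookup (Poly_Mapping.keys p)" by (auto simp: inj_on_def)
    have "?c (Poly_Mapping.lookup e) = 0"
    proof (rule monomials_independent[of UNIV ?A])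
      fix x :: "'a \<Rightarrow> real"
      have "(\<Sum>\<alpha>\<in>?A. ?c \<alpha> * (\<Prod>i\<in>UNIV. x i ^ \<alpha> i)) = eval_poly p (\<chi> i. x i)"
        by (simp add: sum.reindex[OF inj] eval_poly_def)
      then show "(\<Sum>\<alpha>\<in>?A. ?c \<alpha> * (\<Prod>i\<in>UNIV. x i ^ \<alpha> i)) = 0" using assms by simp
    qed (use True in \<open>auto simp: inj_on_def restrict_UNIV\<close>)
    then show ?thesis by simp
  qed (auto simp: in_keys_iff)
qed

text \<open>Turns identities in the polynomial ring, scalar fractions included, into real arithmetic
  at a point.\<close>

lemma eval_poly_ext: "(\<And>x. eval_poly p x = eval_poly q x) \<Longrightarrow> p = q"
  using eval_poly_eq_0[of "p - q"] by simp

lemma const_poly_add: "const_poly (a + b) = const_poly a + const_poly b"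
  and const_poly_mult: "const_poly (a * b) = const_poly a * const_poly b"
  by (simp_all add: const_poly_def single_add mult_single)

definition lin_poly :: "real ^ 'n::finite \<Rightarrow> 'n rpoly" where
  "lin_poly a = (\<Sum>i\<in>UNIV. Poly_Mapping.single (Poly_Mapping.single i 1) (a $ i))"

lemma eval_lin_poly [simp]: "eval_poly (lin_poly a) x = a \<bullet> x"
proof -
  have "monomial_value (Poly_Mapping.single i 1) x = x $ i" for i
  proof -
    have "monomial_value (Poly_Mapping.single i 1) x = (\<Prod>j\<in>UNIV. if i = j then x $ i else 1)"
      unfolding monomial_value_def by (rule prod.cong) (auto simp: lookup_single when_def)
    then show ?thesis by simp
  qed
  then show ?thesis by (simp add: lin_poly_def inner_vec_def)
qed

lemma rpf_eval_poly: "real_polynomial_function (eval_poly p)"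
proof -
  have "real_polynomial_function (\<lambda>x. x $ i)" for i :: 'a
    by (intro real_polynomial_function.intros(1) bounded_linear_vec_nth)
  then have "real_polynomial_function
     (\<lambda>x. \<Sum>e\<in>Poly_Mapping.keys p. Poly_Mapping.lookup p e * (\<Prod>i\<in>UNIV. (x $ i) ^ Poly_Mapping.lookup e i))"
    by (intro real_polynomial_function_sum real_polynomial_function_prod
        real_polynomial_function_power real_polynomial_function.intros(2,4)) auto
  then show ?thesis by (simp add: eval_poly_def[abs_def])
qed

text \<open>Substitutions need no operation on coefficients: translating a polynomial or rescaling a
  box is done on polynomial functions, which are closed under composition, and carried back by this
  lemma.\<close>

lemma rpf_imp_eval_poly:
  assumes "real_polynomial_function (q :: real ^ 'n::finite \<Rightarrow> real)"
  shows "\<exists>p. eval_poly p = q"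
  using assms
proof (induction rule: real_polynomial_function.induct)
  case (linear f)
  then interpret bounded_linear f .
  have "f = eval_poly (lin_poly (adjoint f 1))"
    using adjoint_clauses(1)[OF linear_axioms, of _ 1] by (auto simp: fun_eq_iff inner_commute)
  then show ?case by metis
next
  case (const c) then show ?case by (intro exI[of _ "const_poly c"]) auto
next
  case (add f g)
  then obtain p q where "eval_poly p = f" "eval_poly q = g" by blast
  then show ?case by (intro exI[of _ "p + q"]) auto
next
  case (mult f g)
  then obtain p q where "eval_poly p = f" "eval_poly q = g" by blast
  then show ?case by (intro exI[of _ "p * q"]) auto
qed

section \<open>Preorderings\<close>

text \<open>Properness is deliberately absent: adjoining an element may bring in -1, and the
  Archimedean argument treats precisely that case. The scalars \<open>\<kappa> a\<close> make it
  possible to divide by positive reals although the ring is not a field.\<close>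

locale preordering =
  fixes \<kappa> :: "real \<Rightarrow> 'r::comm_ring_1" and T :: "'r set"
  assumes \<kappa>_add: "\<kappa> (a + b) = \<kappa> a + \<kappa> b"
    and \<kappa>_mult: "\<kappa> (a * b) = \<kappa> a * \<kappa> b"
    and \<kappa>_1: "\<kappa> 1 = 1"
    and T_add: "x \<in> T \<Longrightarrow> y \<in> T \<Longrightarrow> x + y \<in> T"
    and T_mult: "x \<in> T \<Longrightarrow> y \<in> T \<Longrightarrow> x * y \<in> T"
    and T_square: "x * x \<in> T"
begin

lemma \<kappa>_0 [simp]: "\<kappa> 0 = 0"
  using \<kappa>_add[of 0 0] by simp

lemma \<kappa>_uminus: "\<kappa> (- a) = - \<kappa> a"
  using \<kappa>_add[of "- a" a] by (simp add: eq_neg_iff_add_eq_0)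

lemma \<kappa>_diff: "\<kappa> (a - b) = \<kappa> a - \<kappa> b"
  using \<kappa>_add[of a "- b"] by (simp add: \<kappa>_uminus)

lemma \<kappa>_power: "\<kappa> (a ^ n) = \<kappa> a ^ n"
  by (induction n) (auto simp: \<kappa>_1 \<kappa>_mult)

lemma \<kappa>_numeral: "\<kappa> (numeral n) = numeral n"
proof -
  have "\<kappa> (of_nat k) = of_nat k" for k by (induction k) (auto simp: \<kappa>_1 \<kappa>_add)
  from this[of "numeral n"] show ?thesis by simp
qed

lemmas \<kappa>_simps = \<kappa>_add \<kappa>_diff \<kappa>_uminus \<kappa>_mult \<kappa>_power \<kappa>_1 \<kappa>_numeral

lemma T_const: "0 \<le> a \<Longrightarrow> \<kappa> a \<in> T"
  using T_square[of "\<kappa> (sqrt a)"] by (simp flip: \<kappa>_mult)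

lemma T_0: "0 \<in> T" and T_1: "1 \<in> T"
  using T_const[of 0] T_const[of 1] by (auto simp: \<kappa>_1)

lemma T_sum: "(\<And>i. i \<in> I \<Longrightarrow> f i \<in> T) \<Longrightarrow> sum f I \<in> T"
  by (induction I rule: infinite_finite_induct) (auto intro: T_0 T_add)

lemma T_prod: "(\<And>i. i \<in> I \<Longrightarrow> f i \<in> T) \<Longrightarrow> prod f I \<in> T"
  by (induction I rule: infinite_finite_induct) (auto intro: T_1 T_mult)

lemma T_power: "x \<in> T \<Longrightarrow> x ^ n \<in> T"
  by (induction n) (auto intro: T_1 T_mult)

lemma T_scale: "0 \<le> a \<Longrightarrow> x \<in> T \<Longrightarrow> \<kappa> a * x \<in> T"
  by (intro T_mult T_const)

lemma T_unscale:
  assumes "0 < a" "\<kappa> a * x \<in> T" shows "x \<in> T"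
proof -
  have "\<kappa> (1 / a) * (\<kappa> a * x) = x"
    using assms(1) by (simp add: mult.assoc[symmetric] \<kappa>_1 flip: \<kappa>_mult)
  then show ?thesis using T_scale[OF _ assms(2), of "1 / a"] assms(1) by simp
qed

definition adjoin :: "'r \<Rightarrow> 'r set" where
  "adjoin q = {a + q * b | a b. a \<in> T \<and> b \<in> T}"

lemma subset_adjoin: "T \<subseteq> adjoin q"
  unfolding adjoin_def using T_0 by (metis (mono_tags, lifting) add.right_neutral mem_Collect_eq mult_zero_right subsetI)

lemma self_in_adjoin: "q \<in> adjoin q"
  unfolding adjoin_def using T_0 T_1 by force

text \<open>A product of two elements creates a term in \<open>q * q\<close>, which is a square and
  falls back into \<open>T\<close>; so expressions linear in \<open>q\<close> suffice.\<close>

lemma preordering_adjoin: "preordering \<kappa> (adjoin q)"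
proof
  fix x y assume "x \<in> adjoin q" "y \<in> adjoin q"
  then obtain a b c d where *: "x = a + q * b" "y = c + q * d" "a \<in> T" "b \<in> T" "c \<in> T" "d \<in> T"
    unfolding adjoin_def by blast
  have "x + y = (a + c) + q * (b + d)" "x * y = (a * c + q * q * (b * d)) + q * (a * d + b * c)"
    unfolding * by (simp_all add: algebra_simps)
  then show "x + y \<in> adjoin q" "x * y \<in> adjoin q"
    unfolding adjoin_def using *(3-) by (blast intro: T_add T_mult T_square)+
next
  show "x * x \<in> adjoin q" for x using T_square subset_adjoin by blast
qed (rule \<kappa>_add \<kappa>_mult \<kappa>_1)+

section \<open>Bounded elements and Woermann's trick\<close>

definition bounded_elem :: "'r \<Rightarrow> bool" where
  "bounded_elem x \<longleftrightarrow> (\<exists>N. \<kappa> N - x \<in> T \<and> \<kappa> N + x \<in> T)"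

lemma T_raise: "\<kappa> M - x \<in> T \<Longrightarrow> M \<le> N \<Longrightarrow> \<kappa> N - x \<in> T"
  using T_add[OF T_const[of "N - M"], of "\<kappa> M - x"] by (simp add: \<kappa>_diff)

text \<open>The rule that |a| \<le> A and |b| \<le> B imply |ab| \<le> AB, without case distinctions
  on signs: twice each difference is a sum of products of the given elements, and the 2 can be
  divided out.\<close>

lemma T_abs_mult:
  assumes "A - a \<in> T" "A + a \<in> T" "B - b \<in> T" "B + b \<in> T"
  shows "A * B - a * b \<in> T" "A * B + a * b \<in> T"
proof -
  have "\<kappa> 2 * (A * B - a * b) = (A - a) * (B + b) + (A + a) * (B - b)"
    "\<kappa> 2 * (A * B + a * b) = (A - a) * (B - b) + (A + a) * (B + b)"
    by (simp_all add: \<kappa>_simps algebra_simps)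
  then show "A * B - a * b \<in> T" "A * B + a * b \<in> T"
    by (metis T_unscale T_add T_mult assms zero_less_numeral)+
qed

lemma bounded_elem_mult:
  assumes "bounded_elem x" "bounded_elem y" shows "bounded_elem (x * y)"
  using assms T_abs_mult unfolding bounded_elem_def by (metis \<kappa>_mult)

lemma bounded_elem_add:
  assumes "bounded_elem x" "bounded_elem y" shows "bounded_elem (x + y)"
proof -
  obtain M N where *: "\<kappa> M - x \<in> T" "\<kappa> M + x \<in> T" "\<kappa> N - y \<in> T" "\<kappa> N + y \<in> T"
    using assms unfolding bounded_elem_def by blast
  have "\<kappa> (M + N) - (x + y) = (\<kappa> M - x) + (\<kappa> N - y)" "\<kappa> (M + N) + (x + y) = (\<kappa> M + x) + (\<kappa> N + y)"
    by (simp_all add: \<kappa>_simps)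
  then show ?thesis unfolding bounded_elem_def using * by (metis T_add)
qed

lemma bounded_elem_const: "bounded_elem (\<kappa> a)"
  unfolding bounded_elem_def
  using T_const[of "\<bar>a\<bar> - a"] T_const[of "\<bar>a\<bar> + a"] by (intro exI[of _ "\<bar>a\<bar>"]) (simp add: \<kappa>_simps)

lemma bounded_elem_sum: "(\<And>i. i \<in> I \<Longrightarrow> bounded_elem (f i)) \<Longrightarrow> bounded_elem (sum f I)"
  using bounded_elem_const[of 0]
  by (induction I rule: infinite_finite_induct) (auto intro: bounded_elem_add)

lemma bounded_elem_prod: "(\<And>i. i \<in> I \<Longrightarrow> bounded_elem (f i)) \<Longrightarrow> bounded_elem (prod f I)"
  using bounded_elem_const[of 1]
  by (induction I rule: infinite_finite_induct) (auto intro: bounded_elem_mult simp: \<kappa>_1)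

lemma bounded_elem_power: "bounded_elem x \<Longrightarrow> bounded_elem (x ^ k)"
  using bounded_elem_const[of 1] by (induction k) (auto intro: bounded_elem_mult simp: \<kappa>_1)

text \<open>The squares of 1 - X_i and 1 + X_i give 2|X_i| \<le> X_i^2 + 1, and X_i^2 \<le> N
  because the other squares are non-negative.\<close>

lemma coordinates_bounded:
  assumes "finite I" "i \<in> I" "\<kappa> N - (\<Sum>i\<in>I. X i * X i) \<in> T"
  shows "\<kappa> ((N + 1) / 2) - X i \<in> T" "\<kappa> ((N + 1) / 2) + X i \<in> T"
proof -
  let ?S = "\<Sum>j\<in>I - {i}. X j * X j"
  have S: "(\<Sum>i\<in>I. X i * X i) = X i * X i + ?S" using assms by (meson sum.remove)
  have e: "\<kappa> 2 * \<kappa> ((N + 1) / 2) = \<kappa> N + 1" 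
  proof -
    have "2 * ((N + 1) / 2) = N + 1" by simp
    then show ?thesis by (metis \<kappa>_1 \<kappa>_add \<kappa>_mult)
  qed
  have "\<kappa> 2 * (\<kappa> ((N + 1) / 2) - X i) = (\<kappa> N - (\<Sum>i\<in>I. X i * X i)) + ?S + (1 - X i) * (1 - X i)"
    "\<kappa> 2 * (\<kappa> ((N + 1) / 2) + X i) = (\<kappa> N - (\<Sum>i\<in>I. X i * X i)) + ?S + (1 + X i) * (1 + X i)"
    unfolding S distrib_left right_diff_distrib e by (simp_all add: \<kappa>_numeral algebra_simps)
  moreover have "?S \<in> T" by (intro T_sum T_square)
  ultimately show "\<kappa> ((N + 1) / 2) - X i \<in> T" "\<kappa> ((N + 1) / 2) + X i \<in> T"
    by (metis T_unscale T_add T_square assms(3) zero_less_numeral)+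
qed

text \<open>
  Woermann's trick: if \<open>-1 = a - b q\<close> with \<open>q = N - \<Sum> X\<^sub>i\<^sup>2\<close>, then \<open>(1 + a) q = b q\<^sup>2\<close> lies in
  \<open>T\<close>, and \<open>a\<close> is bounded with respect to \<open>T + q T\<close>; multiplying that bound by \<open>1 + a\<close>
  brings it back into \<open>T\<close>.
\<close>

lemma bounded_of_negative_one:
  assumes gen: "\<And>S x. preordering \<kappa> S \<Longrightarrow> \<kappa> N - (\<Sum>i\<in>I. X i * X i) \<in> S \<Longrightarrow> preordering.bounded_elem \<kappa> S x"
    and "- 1 \<in> adjoin ((\<Sum>i\<in>I. X i * X i) - \<kappa> N)" and "0 \<le> N"
  shows "\<exists>N. \<kappa> N - (\<Sum>i\<in>I. X i * X i) \<in> T"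
proof -
  define s where "s = (\<Sum>i\<in>I. X i * X i)"
  have s: "s \<in> T" unfolding s_def by (intro T_sum T_square)
  define q where "q = \<kappa> N - s"
  obtain t p where tp: "t \<in> T" "p \<in> T" "- 1 = t + (s - \<kappa> N) * p"
    using assms(2) unfolding adjoin_def s_def by blast
  have pq: "p * q = 1 + t" using tp(3) unfolding q_def by (simp add: algebra_simps)
  have q1: "(1 + t) * q \<in> T"
  proof -
    have "(1 + t) * q = p * (q * q)" unfolding pq[symmetric] by (simp add: algebra_simps)
    then show ?thesis using T_mult[OF tp(2) T_square] by simp
  qed
  interpret Q: preordering \<kappa> "adjoin q" by (rule preordering_adjoin)
  have "Q.bounded_elem t"
    by (rule gen[OF preordering_adjoin]) (use self_in_adjoin[of q] in \<open>simp add: q_def s_def\<close>)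
  then obtain M0 where "\<kappa> M0 - t \<in> adjoin q" unfolding Q.bounded_elem_def by blast
  then obtain M where M: "\<kappa> M - t \<in> adjoin q" by blast
  then obtain a b where ab: "a \<in> T" "b \<in> T" "\<kappa> M - t = a + q * b" unfolding adjoin_def by blast
  have "(1 + t) * (\<kappa> M - t) = (1 + t) * a + ((1 + t) * q) * b"
    unfolding ab(3) by (simp add: algebra_simps)
  then have M1: "(1 + t) * (\<kappa> M - t) \<in> T" using q1 tp ab by (metis T_1 T_add T_mult)
  \<comment> \<open>Completing the square: \<open>L - t\<close> exceeds (1 + t)(M - t) by exactly (t
    - M/2)^2.\<close>
  define L where "L = M + M * M / 4"
  have "\<kappa> L - t = (1 + t) * (\<kappa> M - t) + (t - \<kappa> (M / 2)) * (t - \<kappa> (M / 2))"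
  proof -
    have "M = 2 * (M/2)" by simp
    then have "\<kappa> M = 2 * \<kappa> (M / 2)" by (metis \<kappa>_mult \<kappa>_numeral)
    moreover have "L = 2 * (M/2) + (M/2) * (M/2)" by (simp add: L_def)
    then have "\<kappa> L = 2 * \<kappa> (M/2) + \<kappa> (M/2) * \<kappa> (M/2)" by (metis \<kappa>_mult \<kappa>_numeral \<kappa>_add)
    ultimately show ?thesis by (simp add: algebra_simps)
  qed
  then have L: "\<kappa> L - t \<in> T" using M1 T_add T_square by metis
  \<comment> \<open>Expanding (1 + t) q leaves the unwanted terms - t s and t N. The first is
    cancelled by adding \<open>t * s\<close>, a product of elements of \<open>T\<close>, the second
    by the bound on \<open>t\<close>.\<close>
  have "\<kappa> (N + N * L) - s = (1 + t) * q + t * s + \<kappa> N * (\<kappa> L - t)"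
    by (simp add: q_def \<kappa>_simps algebra_simps)
  then have "\<kappa> (N + N * L) - s \<in> T"
    using q1 s tp(1) L assms(3) by (metis T_add T_mult T_scale)
  then show ?thesis unfolding s_def by blast
qed

text \<open>Zorn's lemma gives a maximal proper extension. If neither x nor -x belonged to it,
  maximality would give -1 = a + x b and -1 = c - x d; multiplying x b = -1 - a by x d = 1 + c
  yields -1 = a + c + a c + x^2 b d, which lies in the preordering.\<close>

lemma maximal_proper:
  assumes "- 1 \<notin> T"
  obtains P where "T \<subseteq> P" "preordering \<kappa> P" "- 1 \<notin> P" "\<And>x. x \<in> P \<or> - x \<in> P"
proof -
  define \<A> where "\<A> = {P. T \<subseteq> P \<and> preordering \<kappa> P \<and> - 1 \<notin> P}"
  have "T \<in> \<A>" using assms preordering_axioms by (simp add: \<A>_def)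
  have "\<exists>M\<in>\<A>. \<forall>X\<in>\<A>. M \<subseteq> X \<longrightarrow> X = M"
  proof (rule subset_Zorn_nonempty)
    show "\<A> \<noteq> {}" using \<open>T \<in> \<A>\<close> by blast
    fix \<C> assume C: "\<C> \<noteq> {}" "subset.chain \<A> \<C>"
    have sub: "\<C> \<subseteq> \<A>" using C(2) by (simp add: subset.chain_def)
    have dir: "\<exists>P\<in>\<C>. x \<in> P \<and> y \<in> P" if "x \<in> \<Union>\<C>" "y \<in> \<Union>\<C>" for x y
      using that C(2) unfolding subset_chain_def by (metis UnionE subsetD)
    have pre: "preordering \<kappa> P" if "P \<in> \<C>" for P using that sub by (auto simp: \<A>_def)
    have "preordering \<kappa> (\<Union>\<C>)"
    proof
      fix x y assume "x \<in> \<Union>\<C>" "y \<in> \<Union>\<C>"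
      from dir[OF this] pre show "x + y \<in> \<Union>\<C>" "x * y \<in> \<Union>\<C>"
        by (meson UnionI preordering.T_add preordering.T_mult)+
    next
      show "x * x \<in> \<Union>\<C>" for x using C(1) pre by (meson UnionI ex_in_conv preordering.T_square)
    qed (rule \<kappa>_add \<kappa>_mult \<kappa>_1)+
    moreover have "T \<subseteq> \<Union>\<C>" using C(1) sub by (auto simp: \<A>_def)
    moreover have "- 1 \<notin> \<Union>\<C>" using sub by (auto simp: \<A>_def)
    ultimately show "\<Union>\<C> \<in> \<A>" by (simp add: \<A>_def)
  qed
  then obtain P where P: "P \<in> \<A>" "\<And>X. X \<in> \<A> \<Longrightarrow> P \<subseteq> X \<Longrightarrow> X = P" by blast
  interpret P: preordering \<kappa> P using P(1) by (simp add: \<A>_def)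
  have m1: "- 1 \<notin> P" and TP: "T \<subseteq> P" using P(1) by (auto simp: \<A>_def)
  have ext: "- 1 \<in> P.adjoin x" if "x \<notin> P" for x
  proof (rule ccontr)
    assume "- 1 \<notin> P.adjoin x"
    then have "P.adjoin x \<in> \<A>"
      using P.preordering_adjoin P.subset_adjoin TP by (auto simp: \<A>_def)
    then show False using P(2) P.subset_adjoin P.self_in_adjoin that by blast
  qed
  have "x \<in> P \<or> - x \<in> P" for x
  proof (rule ccontr)
    assume "\<not> (x \<in> P \<or> - x \<in> P)"
    then have "- 1 \<in> P.adjoin x" "- 1 \<in> P.adjoin (- x)" using ext by auto
    then obtain a b c d where *: "a \<in> P" "b \<in> P" "c \<in> P" "d \<in> P" "- 1 = a + x * b" "- 1 = c + (- x) * d"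
      unfolding P.adjoin_def by blast
    have e1: "x * b = - 1 - a" using *(5) by (simp add: algebra_simps)
    have e2: "x * d = 1 + c" using *(6) by (simp add: algebra_simps)
    have "(x * b) * (x * d) = (- 1 - a) * (1 + c)" unfolding e1 e2 ..
    then have "- 1 = a + c + a * c + (x * x) * (b * d)" by (simp add: algebra_simps)
    then show False using m1 * by (metis P.T_add P.T_mult P.T_square)
  qed
  then show ?thesis using that TP P.preordering_axioms m1 by blast
qed

end

section \<open>Total preorderings and standard parts\<close>

locale total_preordering = preordering +
  assumes total: "x \<in> T \<or> - x \<in> T" and proper: "- 1 \<notin> T"
begin

lemma const_neg_notin: "a < 0 \<Longrightarrow> \<kappa> a \<notin> T"
  using proper T_unscale[of "- a" "- 1"] by (auto simp: \<kappa>_simps)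

lemma total_diff: "x - y \<in> T \<or> y - x \<in> T"
  using total[of "x - y"] by simp

lemma T_trans: "y - x \<in> T \<Longrightarrow> z - y \<in> T \<Longrightarrow> z - x \<in> T"
  using T_add[of "y - x" "z - y"] by simp

lemma T_power_mono:
  assumes "a \<in> T" "b - a \<in> T" shows "b ^ k - a ^ k \<in> T"
proof (induction k)
  case (Suc k)
  have "b \<in> T" using T_add[OF assms] by simp
  have "b ^ Suc k - a ^ Suc k = b * (b ^ k - a ^ k) + (b - a) * a ^ k"
    by (simp add: algebra_simps)
  then show ?case using Suc \<open>b \<in> T\<close> assms by (metis T_add T_mult T_power)
qed (simp add: T_0)

lemma exists_max:
  assumes "finite I" "I \<noteq> {}"
  shows "\<exists>i\<in>I. \<forall>j\<in>I. e i - e j \<in> T"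
  using assms
proof (induction I rule: finite_ne_induct)
  case (singleton x) then show ?case by (simp add: T_0)
next
  case (insert x I)
  then obtain i where i: "i \<in> I" "\<And>j. j \<in> I \<Longrightarrow> e i - e j \<in> T" by blast
  from total_diff[of "e i" "e x"] show ?case
  proof
    assume "e i - e x \<in> T" then show ?thesis using i by (intro bexI[of _ i]) auto
  next
    assume "e x - e i \<in> T" then show ?thesis using i T_trans by (intro bexI[of _ x]) (auto simp: T_0)
  qed
qed

text \<open>Reads |d| \<le> \<epsilon> E. It is stated without a quotient because \<open>E\<close>
  need not be invertible in the ring.\<close>

definition near :: "real \<Rightarrow> 'a \<Rightarrow> 'a \<Rightarrow> bool" where
  "near \<epsilon> E d \<longleftrightarrow> \<kappa> \<epsilon> * E - d \<in> T \<and> \<kappa> \<epsilon> * E + d \<in> T"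

text \<open>\<open>approx E a s\<close> says that \<open>a / E\<close> has standard part \<open>s\<close> (for positive \<open>E\<close>).\<close>

definition approx :: "'a \<Rightarrow> 'a \<Rightarrow> real \<Rightarrow> bool" where
  "approx E a s \<longleftrightarrow> (\<forall>\<epsilon>>0. near \<epsilon> E (a - \<kappa> s * E))"

lemma near_add:
  assumes "near \<epsilon> E d" "near \<epsilon>' E d'" shows "near (\<epsilon> + \<epsilon>') E (d + d')"
proof -
  have "\<kappa> (\<epsilon> + \<epsilon>') * E - (d + d') = (\<kappa> \<epsilon> * E - d) + (\<kappa> \<epsilon>' * E - d')"
    "\<kappa> (\<epsilon> + \<epsilon>') * E + (d + d') = (\<kappa> \<epsilon> * E + d) + (\<kappa> \<epsilon>' * E + d')"
    by (simp_all add: \<kappa>_simps algebra_simps)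
  then show ?thesis using assms unfolding near_def by (metis T_add)
qed

lemma near_mult:
  assumes "near \<epsilon> E d" "near \<epsilon>' E' d'" shows "near (\<epsilon> * \<epsilon>') (E * E') (d * d')"
proof -
  have "\<kappa> (\<epsilon> * \<epsilon>') * (E * E') = (\<kappa> \<epsilon> * E) * (\<kappa> \<epsilon>' * E')" by (simp add: \<kappa>_simps algebra_simps)
  then show ?thesis using assms T_abs_mult unfolding near_def by metis
qed

lemma near_mono:
  assumes "near \<epsilon> E d" "\<epsilon> \<le> \<epsilon>'" "E \<in> T" shows "near \<epsilon>' E d"
proof -
  have "\<kappa> \<epsilon>' * E - d = \<kappa> (\<epsilon>' - \<epsilon>) * E + (\<kappa> \<epsilon> * E - d)"
    "\<kappa> \<epsilon>' * E + d = \<kappa> (\<epsilon>' - \<epsilon>) * E + (\<kappa> \<epsilon> * E + d)"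
    by (simp_all add: \<kappa>_simps algebra_simps)
  then show ?thesis using assms T_scale[of "\<epsilon>' - \<epsilon>" E] unfolding near_def by (metis T_add diff_ge_0_iff_ge)
qed

lemma near_self: "E \<in> T \<Longrightarrow> near \<bar>s\<bar> E (\<kappa> s * E)"
  unfolding near_def using T_scale[of "\<bar>s\<bar> - s" E] T_scale[of "\<bar>s\<bar> + s" E]
  by (simp add: \<kappa>_simps algebra_simps)

lemma approx_mult:
  assumes "approx E a s" "approx E' a' s'" "E \<in> T" "E' \<in> T"
  shows "approx (E * E') (a * a') (s * s')"
  unfolding approx_def
proof (intro allI impI)
  fix \<eta> :: real assume "\<eta> > 0"
  \<comment> \<open>The error of the product is \<epsilon>^2 + |s| \<epsilon> + \<epsilon> |s'|. The
    cap at 1 gives \<epsilon>^2 \<le> \<epsilon>, and the quotient brings the total below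
    \<eta>.\<close>
  define \<epsilon> where "\<epsilon> = min 1 (\<eta> / (1 + \<bar>s\<bar> + \<bar>s'\<bar>))"
  have pos: "1 + \<bar>s\<bar> + \<bar>s'\<bar> > 0" by simp
  have \<epsilon>: "\<epsilon> > 0" "\<epsilon> \<le> 1" using \<open>\<eta> > 0\<close> pos by (auto simp: \<epsilon>_def)
  have "\<epsilon> \<le> \<eta> / (1 + \<bar>s\<bar> + \<bar>s'\<bar>)" by (simp add: \<epsilon>_def)
  then have \<epsilon>3: "\<epsilon> * (1 + \<bar>s\<bar> + \<bar>s'\<bar>) \<le> \<eta>" using pos by (simp only: pos_le_divide_eq)
  let ?d = "a - \<kappa> s * E" and ?d' = "a' - \<kappa> s' * E'"
  have n: "near \<epsilon> E ?d" "near \<epsilon> E' ?d'" using assms(1,2) \<epsilon>(1) by (auto simp: approx_def)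
  have "near (\<epsilon> * \<epsilon> + \<bar>s\<bar> * \<epsilon> + \<epsilon> * \<bar>s'\<bar>) (E * E') (?d * ?d' + (\<kappa> s * E) * ?d' + ?d * (\<kappa> s' * E'))"
    using n assms(3,4) by (intro near_add near_mult near_self)
  moreover have "?d * ?d' + (\<kappa> s * E) * ?d' + ?d * (\<kappa> s' * E') = a * a' - \<kappa> (s * s') * (E * E')"
    by (simp add: \<kappa>_simps algebra_simps)
  moreover have "\<epsilon> * \<epsilon> + \<bar>s\<bar> * \<epsilon> + \<epsilon> * \<bar>s'\<bar> \<le> \<eta>"
  proof -
    have "\<epsilon> * \<epsilon> \<le> \<epsilon> * 1" using \<epsilon> by (intro mult_left_mono) auto
    then show ?thesis using \<epsilon>3 by (simp add: algebra_simps)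
  qed
  ultimately show "near \<eta> (E * E') (a * a' - \<kappa> (s * s') * (E * E'))"
    using near_mono T_mult[OF assms(3,4)] by metis
qed

lemma approx_one: "approx 1 1 1"
  unfolding approx_def near_def using T_const by (auto simp: \<kappa>_1)

lemma approx_power: "approx E a s \<Longrightarrow> E \<in> T \<Longrightarrow> approx (E ^ k) (a ^ k) (s ^ k)"
  by (induction k) (auto intro: approx_one approx_mult T_power)

lemma approx_prod:
  "(\<And>i. i \<in> I \<Longrightarrow> approx (E i) (a i) (s i)) \<Longrightarrow> (\<And>i. i \<in> I \<Longrightarrow> E i \<in> T) \<Longrightarrow>
    approx (prod E I) (prod a I) (prod s I)"
  by (induction I rule: infinite_finite_induct) (auto intro: approx_one approx_mult T_prod)

lemma approx_scale:
  assumes "approx E a s" "E \<in> T" shows "approx E (\<kappa> c * a) (c * s)"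
proof -
  have "approx 1 (\<kappa> c) c" unfolding approx_def near_def using T_const by auto
  from approx_mult[OF this assms(1) T_1 assms(2)] show ?thesis by simp
qed

lemma approx_add:
  assumes "approx E a s" "approx E b t" shows "approx E (a + b) (s + t)"
  unfolding approx_def
proof (intro allI impI)
  fix \<eta> :: real assume "\<eta> > 0"
  then have "near (\<eta>/2) E (a - \<kappa> s * E)" "near (\<eta>/2) E (b - \<kappa> t * E)"
    using assms by (auto simp: approx_def)
  from near_add[OF this] show "near \<eta> E (a + b - \<kappa> (s + t) * E)"
    by (simp add: \<kappa>_simps algebra_simps)
qed

lemma approx_sum:
  "E \<in> T \<Longrightarrow> (\<And>i. i \<in> I \<Longrightarrow> approx E (a i) (s i)) \<Longrightarrow> approx E (sum a I) (sum s I)"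
proof (induction I rule: infinite_finite_induct)
  case empty then show ?case by (auto simp: approx_def near_def intro: T_scale)
next
  case (infinite) then show ?case by (auto simp: approx_def near_def intro: T_scale)
qed (auto intro: approx_add)

text \<open>From E \<ge> 1 and a < 0 follows a E \<le> a, and negative constants are excluded by
  properness. Mere membership of \<open>E\<close> in \<open>T\<close> would not do, since
  -\<open>E\<close> could be in \<open>T\<close> as well.\<close>

lemma scale_neg_notin:
  assumes "E - 1 \<in> T" "a < 0" shows "\<kappa> a * E \<notin> T"
proof
  assume "\<kappa> a * E \<in> T"
  moreover have "\<kappa> (- a) * (E - 1) \<in> T" using assms by (intro T_scale) auto
  ultimately have "\<kappa> a * E + \<kappa> (- a) * (E - 1) \<in> T" by (rule T_add)
  then show False using const_neg_notin[OF assms(2)] by (simp add: \<kappa>_simps algebra_simps)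
qed

lemma power_ge_one: "E - 1 \<in> T \<Longrightarrow> E ^ k - 1 \<in> T"
  using T_power_mono[of 1 E k] T_1 by simp

text \<open>Needed because a monomial in the weighted coordinates has the size of a fractional power
  of \<open>E\<close>: only its \<open>K\<close>-th power can be compared with an integral power. If
  the estimate for \<open>a\<close> failed, monotonicity of powers would separate
  \<open>a ^ K\<close> from \<open>s ^ K * E ^ K\<close> by a positive multiple of
  \<open>E ^ K\<close>.\<close>

lemma approx_root:
  assumes "approx (E ^ K) (a ^ K) (s ^ K)" "0 < K" "a \<in> T" "0 \<le> s" "E - 1 \<in> T"
  shows "approx E a s"
  unfolding approx_def near_def
proof (intro allI impI conjI)
  fix \<epsilon> :: real assume "\<epsilon> > 0"
  have E: "E \<in> T" using T_add[OF assms(5) T_1] by simp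
  show "\<kappa> \<epsilon> * E - (a - \<kappa> s * E) \<in> T"
  proof (rule ccontr)
    assume c: "\<kappa> \<epsilon> * E - (a - \<kappa> s * E) \<notin> T"
    have eq: "\<kappa> \<epsilon> * E - (a - \<kappa> s * E) = \<kappa> (s + \<epsilon>) * E - a" by (simp add: \<kappa>_simps algebra_simps)
    with c have "a - \<kappa> (s + \<epsilon>) * E \<in> T" using total_diff by metis
    then have 1: "a ^ K - (\<kappa> (s + \<epsilon>) * E) ^ K \<in> T"
      using \<open>\<epsilon> > 0\<close> assms(4) E by (intro T_power_mono T_scale) auto
    \<comment> \<open>Half the gap between the two powers, so that adding the memberships leaves
      \<open>\<kappa> (- \<delta>) * E ^ K\<close>, which is not in \<open>T\<close>.\<close>
    define \<delta> where "\<delta> = ((s + \<epsilon>) ^ K - s ^ K) / 2"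
    have "\<delta> > 0" unfolding \<delta>_def using power_strict_mono[of s "s + \<epsilon>" K] assms \<open>\<epsilon> > 0\<close> by simp
    then have 2: "\<kappa> \<delta> * E ^ K - (a ^ K - \<kappa> (s ^ K) * E ^ K) \<in> T"
      using assms(1) by (simp add: approx_def near_def)
    have "- \<delta> = \<delta> + s ^ K - (s + \<epsilon>) ^ K" by (simp add: \<delta>_def field_simps)
    then have "\<kappa> (- \<delta>) * E ^ K = (a ^ K - (\<kappa> (s + \<epsilon>) * E) ^ K) + (\<kappa> \<delta> * E ^ K - (a ^ K - \<kappa> (s ^ K) * E ^ K))"
      by (simp only: \<kappa>_add \<kappa>_diff \<kappa>_power power_mult_distrib) (simp add: algebra_simps)
    then show False using T_add[OF 1 2] scale_neg_notin[OF power_ge_one[OF assms(5)], of "- \<delta>" K] \<open>\<delta> > 0\<close> by simp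
  qed
  have eq: "\<kappa> \<epsilon> * E + (a - \<kappa> s * E) = a - \<kappa> (s - \<epsilon>) * E" by (simp add: \<kappa>_simps algebra_simps)
  \<comment> \<open>For s \<le> \<epsilon> this is immediate from \<open>a \<in> T\<close>.
    Otherwise s - \<epsilon> is positive, so that its \<open>K\<close>-th power lies strictly below
    that of \<open>s\<close>, and the argument for the upper bound can be mirrored.\<close>
  show "\<kappa> \<epsilon> * E + (a - \<kappa> s * E) \<in> T"
  proof (cases "s \<le> \<epsilon>")
    case True
    have e: "a - \<kappa> (s - \<epsilon>) * E = a + \<kappa> (\<epsilon> - s) * E" by (simp add: \<kappa>_simps algebra_simps)
    show ?thesis unfolding eq e using T_add[OF assms(3) T_scale[OF _ E, of "\<epsilon> - s"]] True by simp
  next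
    case False
    show ?thesis
    proof (rule ccontr)
      assume c: "\<kappa> \<epsilon> * E + (a - \<kappa> s * E) \<notin> T"
      with eq have "\<kappa> (s - \<epsilon>) * E - a \<in> T" using total_diff by metis
      then have 1: "(\<kappa> (s - \<epsilon>) * E) ^ K - a ^ K \<in> T"
        using assms(3) by (intro T_power_mono) auto
      define \<delta> where "\<delta> = (s ^ K - (s - \<epsilon>) ^ K) / 2"
      have "\<delta> > 0" unfolding \<delta>_def using power_strict_mono[of "s - \<epsilon>" s K] assms \<open>\<epsilon> > 0\<close> False by simp
      then have 2: "\<kappa> \<delta> * E ^ K + (a ^ K - \<kappa> (s ^ K) * E ^ K) \<in> T"
        using assms(1) by (simp add: approx_def near_def)
      have "- \<delta> = \<delta> - s ^ K + (s - \<epsilon>) ^ K" by (simp add: \<delta>_def field_simps)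
      then have "\<kappa> (- \<delta>) * E ^ K = ((\<kappa> (s - \<epsilon>) * E) ^ K - a ^ K) + (\<kappa> \<delta> * E ^ K + (a ^ K - \<kappa> (s ^ K) * E ^ K))"
        by (simp only: \<kappa>_add \<kappa>_diff \<kappa>_power power_mult_distrib) (simp add: algebra_simps)
      then show False using T_add[OF 1 2] scale_neg_notin[OF power_ge_one[OF assms(5)], of "- \<delta>" K] \<open>\<delta> > 0\<close> by simp
    qed
  qed
qed

text \<open>A Dedekind cut: \<open>s\<close> is the supremum of the reals \<open>q\<close> with q E
  \<le> a, which a \<le> E bounds by 1. Totality turns the failure of q E \<le> a into the opposite
  inequality.\<close>

lemma standard_part:
  assumes "a \<in> T" "E - a \<in> T" "E - 1 \<in> T"
  shows "\<exists>s\<ge>0. approx E a s"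
proof -
  define S where "S = {q. 0 \<le> q \<and> a - \<kappa> q * E \<in> T}"
  have 0: "0 \<in> S" using assms(1) by (simp add: S_def)
  have bd: "q \<le> 1" if "q \<in> S" for q
  proof (rule ccontr)
    assume "\<not> q \<le> 1"
    have "(a - \<kappa> q * E) + (E - a) \<in> T" using that assms(2) by (intro T_add) (auto simp: S_def)
    moreover have "(a - \<kappa> q * E) + (E - a) = \<kappa> (1 - q) * E" by (simp add: \<kappa>_simps algebra_simps)
    ultimately show False using scale_neg_notin[OF assms(3), of "1 - q"] \<open>\<not> q \<le> 1\<close> by simp
  qed
  then have bdd: "bdd_above S" by (intro bdd_aboveI)
  have E: "E \<in> T" using T_add[OF assms(3) T_1] by simp
  define s where "s = Sup S"
  have s0: "s \<ge> 0" unfolding s_def using cSup_upper[OF 0 bdd] .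
  have "approx E a s"
    unfolding approx_def near_def
  proof (intro allI impI conjI)
    fix \<epsilon> :: real assume "\<epsilon> > 0"
    have "s + \<epsilon> \<notin> S" using cSup_upper[OF _ bdd, of "s + \<epsilon>"] \<open>\<epsilon> > 0\<close> unfolding s_def by auto
    then have "a - \<kappa> (s + \<epsilon>) * E \<notin> T" using s0 \<open>\<epsilon> > 0\<close> by (simp add: S_def)
    then have "\<kappa> (s + \<epsilon>) * E - a \<in> T" using total_diff by metis
    then show "\<kappa> \<epsilon> * E - (a - \<kappa> s * E) \<in> T" by (simp add: \<kappa>_simps algebra_simps)
    have "s - \<epsilon> < Sup S" using \<open>\<epsilon> > 0\<close> by (simp add: s_def)
    then obtain q where q: "q \<in> S" "s - \<epsilon> < q" using less_cSup_iff[OF _ bdd] 0 by blast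
    have e: "\<kappa> \<epsilon> * E + (a - \<kappa> s * E) = (a - \<kappa> q * E) + \<kappa> (q - (s - \<epsilon>)) * E"
      by (simp add: \<kappa>_simps algebra_simps)
    show "\<kappa> \<epsilon> * E + (a - \<kappa> s * E) \<in> T"
      unfolding e using q T_add[OF _ T_scale[OF _ E, of "q - (s - \<epsilon>)"], of "a - \<kappa> q * E"] by (simp add: S_def)
  qed
  then show ?thesis using s0 by blast
qed

text \<open>Since \<open>E\<close> exceeds every real number, E^w is infinitesimal relative to E^K
  for w < K, and so is everything of order E^w.\<close>

lemma approx_lower:
  assumes "approx (E ^ w) a s" "w < K" "\<And>N. E - \<kappa> N \<in> T"
  shows "approx (E ^ K) a 0"
proof -
  have E1: "E - 1 \<in> T" using assms(3)[of 1] by (simp add: \<kappa>_1)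
  have E: "E \<in> T" using T_add[OF E1 T_1] by simp
  have Ek: "E ^ k \<in> T" for k using T_power[OF E] .
  have "near 1 (E ^ w) (a - \<kappa> s * E ^ w)" using assms(1) by (simp add: approx_def)
  from near_add[OF this near_self[of "E ^ w" s]] Ek have n: "near (1 + \<bar>s\<bar>) (E ^ w) a" by simp
  obtain j where j: "K = w + Suc j" using assms(2) less_imp_Suc_add by auto
  show ?thesis
    unfolding approx_def
  proof (intro allI impI)
    fix \<epsilon> :: real assume "\<epsilon> > 0"
    \<comment> \<open>Once E \<ge> M, \<epsilon> E is at least the constant 1 + |s| that bounds
      \<open>a\<close> relative to E^w. One factor of \<open>E\<close> is spent on this; the other
      \<open>j\<close> are only used through E \<ge> 1.\<close>
    define M where "M = (1 + \<bar>s\<bar>) / \<epsilon>"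
    have M: "\<epsilon> * M = 1 + \<bar>s\<bar>" using \<open>\<epsilon> > 0\<close> by (simp add: M_def)
    have "E * (E ^ j - 1) + (E - \<kappa> M) \<in> T" by (intro T_add T_mult E power_ge_one[OF E1] assms(3))
    then have "\<kappa> \<epsilon> * (E ^ w * (E * (E ^ j - 1) + (E - \<kappa> M))) \<in> T"
      using \<open>\<epsilon> > 0\<close> by (intro T_scale T_mult Ek) auto
    also have "\<kappa> \<epsilon> * (E ^ w * (E * (E ^ j - 1) + (E - \<kappa> M))) = \<kappa> \<epsilon> * E ^ K - \<kappa> (1 + \<bar>s\<bar>) * E ^ w"
      unfolding M[symmetric] j by (simp add: \<kappa>_simps power_add algebra_simps)
    finally have "\<kappa> \<epsilon> * E ^ K - \<kappa> (1 + \<bar>s\<bar>) * E ^ w \<in> T" .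
    note 1 = T_add[OF this]
    have "near \<epsilon> (E ^ K) a"
      using n 1[of "\<kappa> (1 + \<bar>s\<bar>) * E ^ w - a"] 1[of "\<kappa> (1 + \<bar>s\<bar>) * E ^ w + a"]
      unfolding near_def by simp
    then show "near \<epsilon> (E ^ K) (a - \<kappa> 0 * E ^ K)" by simp
  qed
qed

end

section \<open>Growth of convex polynomials\<close>

lemma rpf_if:
  "real_polynomial_function f \<Longrightarrow> real_polynomial_function g \<Longrightarrow>
    real_polynomial_function (\<lambda>x. if P then f x else g x)"
  by (cases P) simp_all

text \<open>Follows the inductive generation of polynomial functions, so no coordinates are chosen.
  The vanishing of \<open>c k\<close> beyond \<open>m\<close> allows expansions of different lengths
  to be padded for sums and multiplied by the Cauchy formula.\<close>

lemma rpf_homogeneous_components: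
  assumes "real_polynomial_function (q :: 'a::real_normed_vector \<Rightarrow> real)"
  shows "\<exists>m c. (\<forall>k. real_polynomial_function (c k)) \<and> (\<forall>k>m. \<forall>x. c k x = 0) \<and>
    (\<forall>t x. q (t *\<^sub>R x) = (\<Sum>k\<le>m. c k x * t ^ k))"
  using assms
proof (induction rule: real_polynomial_function.induct)
  case (linear f)
  then interpret bounded_linear f .
  show ?case
    by (intro exI[of _ 1] exI[of _ "\<lambda>k x. if k = 1 then f x else 0"])
      (auto simp: scaleR intro!: rpf_if real_polynomial_function.intros(1)[OF bounded_linear_axioms] real_polynomial_function.intros(2))
next
  case (const c)
  show ?case
    by (intro exI[of _ 0] exI[of _ "\<lambda>k x. if k = 0 then c else 0"])
      (auto intro!: rpf_if real_polynomial_function.intros(2))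
next
  case (add f g)
  obtain m c where c: "\<forall>k. real_polynomial_function (c k)" "\<forall>k>m. \<forall>x. c k x = 0"
    "\<forall>t x. f (t *\<^sub>R x) = (\<Sum>k\<le>m. c k x * t ^ k)" using add.IH(1) by blast
  obtain n d where d: "\<forall>k. real_polynomial_function (d k)" "\<forall>k>n. \<forall>x. d k x = 0"
    "\<forall>t x. g (t *\<^sub>R x) = (\<Sum>k\<le>n. d k x * t ^ k)" using add.IH(2) by blast
  note * = c[rule_format] d[rule_format]
  have "f (t *\<^sub>R x) = (\<Sum>k\<le>max m n. c k x * t ^ k)" "g (t *\<^sub>R x) = (\<Sum>k\<le>max m n. d k x * t ^ k)" for t x
    unfolding *(3,6) by (rule sum.mono_neutral_left; use *(2,5) in auto)+
  then show ?case
    using * by (intro exI[of _ "max m n"] exI[of _ "\<lambda>k x. c k x + d k x"])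
      (auto intro: real_polynomial_function.intros simp: sum.distrib algebra_simps)
next
  case (mult f g)
  obtain m c where c: "\<forall>k. real_polynomial_function (c k)" "\<forall>k>m. \<forall>x. c k x = 0"
    "\<forall>t x. f (t *\<^sub>R x) = (\<Sum>k\<le>m. c k x * t ^ k)" using mult.IH(1) by blast
  obtain n d where d: "\<forall>k. real_polynomial_function (d k)" "\<forall>k>n. \<forall>x. d k x = 0"
    "\<forall>t x. g (t *\<^sub>R x) = (\<Sum>k\<le>n. d k x * t ^ k)" using mult.IH(2) by blast
  note * = c[rule_format] d[rule_format]
  have "(\<Sum>i\<le>k. c i x * d (k - i) x) = 0" if "k > m + n" for k x
  proof (intro sum.neutral ballI)
    fix i
    show "c i x * d (k - i) x = 0" using *(2)[of i x] *(5)[of "k - i" x] that by (cases "i > m") auto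
  qed
  moreover have "f (t *\<^sub>R x) * g (t *\<^sub>R x) = (\<Sum>k\<le>m + n. (\<Sum>i\<le>k. c i x * d (k - i) x) * t ^ k)" for t x
    unfolding *(3,6) by (rule polynomial_product) (use *(2,5) in auto)
  ultimately show ?case
    using *(1,4) by (intro exI[of _ "m + n"] exI[of _ "\<lambda>k x. \<Sum>i\<le>k. c i x * d (k - i) x"])
      (auto intro!: real_polynomial_function.intros(4) real_polynomial_function_sum)
qed

text \<open>Induction on the degree: \<open>p(t) - 2\<^bsup>m+1\<^esup> p(t/2)\<close> has no term of degree \<open>m+1\<close>.\<close>

lemma coeffs_bounded_by_sup:
  "\<exists>C\<ge>0. \<forall>a::nat \<Rightarrow> real. \<forall>M. (\<forall>t\<in>{0..1}. \<bar>\<Sum>k\<le>m. a k * t ^ k\<bar> \<le> M) \<longrightarrow> (\<forall>k\<le>m. \<bar>a k\<bar> \<le> C * M)"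
proof (induction m)
  case 0
  show ?case by (intro exI[of _ 1]) (auto dest: bspec[of _ _ 0])
next
  case (Suc m)
  then obtain C where C: "C \<ge> 0"
    "\<forall>a::nat \<Rightarrow> real. \<forall>M. (\<forall>t\<in>{0..1}. \<bar>\<Sum>k\<le>m. a k * t ^ k\<bar> \<le> M) \<longrightarrow> (\<forall>k\<le>m. \<bar>a k\<bar> \<le> C * M)" by blast
  define L where "L = 1 + (2::real) ^ Suc m"
  have L: "L \<ge> 0" by (simp add: L_def)
  let ?C' = "1 + (real m + 1) * (C * L) + C * L"
  have "\<bar>a k\<bar> \<le> ?C' * M"
    if *: "\<forall>t\<in>{0..1}. \<bar>\<Sum>k\<le>Suc m. a k * t ^ k\<bar> \<le> M" and k: "k \<le> Suc m" for a M k
  proof -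
    let ?p = "\<lambda>t. \<Sum>k\<le>Suc m. a k * t ^ k"
    have M: "M \<ge> 0" using *[rule_format, of 0] by auto
    define b where "b k = a k * (1 - 2 ^ (Suc m - k))" for k
    have low: "\<bar>a k\<bar> \<le> C * L * M" if "k \<le> m" for k
    proof -
      have "\<bar>b k\<bar> \<le> C * (L * M)"
      proof (rule C(2)[rule_format, OF _ that])
        fix t :: real assume t: "t \<in> {0..1}"
        have "?p t - 2 ^ Suc m * ?p (t / 2) = (\<Sum>k\<le>Suc m. b k * t ^ k)"
          unfolding sum_distrib_left sum_subtractf[symmetric] b_def
        proof (rule sum.cong)
          fix k assume "k \<in> {..Suc m}"
          then have "(2::real) ^ Suc m = 2 ^ (Suc m - k) * 2 ^ k" by (simp flip: power_add)
          then show "a k * t ^ k - 2 ^ Suc m * (a k * (t / 2) ^ k) = a k * (1 - 2 ^ (Suc m - k)) * t ^ k"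
            by (simp add: power_divide algebra_simps)
        qed simp
        also have "\<dots> = (\<Sum>k\<le>m. b k * t ^ k)" by (simp add: b_def)
        finally have "\<bar>\<Sum>k\<le>m. b k * t ^ k\<bar> \<le> \<bar>?p t\<bar> + 2 ^ Suc m * \<bar>?p (t / 2)\<bar>"
          using abs_triangle_ineq4[of "?p t" "2 ^ Suc m * ?p (t / 2)"] by (simp add: abs_mult)
        also have "\<dots> \<le> M + 2 ^ Suc m * M"
          using *[rule_format, of t] *[rule_format, of "t / 2"] t by (intro add_mono mult_left_mono) auto
        finally show "\<bar>\<Sum>k\<le>m. b k * t ^ k\<bar> \<le> L * M" by (simp add: L_def algebra_simps)
      qed
      \<comment> \<open>Because \<open>k \<le> m\<close>, the factor that relates \<open>b k\<close>
        to \<open>a k\<close> has absolute value at least 1, so the bound on \<open>b k\<close>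
        passes to \<open>a k\<close>.\<close>
      moreover have "\<bar>a k\<bar> * 1 \<le> \<bar>a k\<bar> * \<bar>1 - 2 ^ (Suc m - k)\<bar>"
      proof (rule mult_left_mono)
        have "(2::real) ^ 1 \<le> 2 ^ (Suc m - k)" using that by (intro power_increasing) auto
        then show "1 \<le> \<bar>1 - (2::real) ^ (Suc m - k)\<bar>" by simp
      qed simp
      ultimately show ?thesis by (simp add: b_def abs_mult mult.assoc)
    qed
    have CLM: "C * L * M \<ge> 0" using C(1) L M by simp
    show ?thesis
    proof (cases "k \<le> m")
      case True
      have "\<bar>a k\<bar> \<le> C * L * M" by (rule low[OF True])
      also have "\<dots> \<le> ?C' * M"
        using CLM M mult_nonneg_nonneg[OF CLM, of "real m"] by (simp add: algebra_simps)
      finally show ?thesis .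
    next
      case False
      then have "k = Suc m" using k by simp
      then have "a k = ?p 1 - (\<Sum>k\<le>m. a k)" by simp
      then have "\<bar>a k\<bar> \<le> \<bar>?p 1\<bar> + \<bar>\<Sum>k\<le>m. a k\<bar>" by linarith
      also have "\<bar>\<Sum>k\<le>m. a k\<bar> \<le> (\<Sum>k\<le>m. C * L * M)"
        using low by (intro order_trans[OF sum_abs] sum_mono) auto
      also have "\<bar>?p 1\<bar> \<le> M" using *[rule_format, of 1] by simp
      finally have "\<bar>a k\<bar> \<le> M + (real m + 1) * (C * L * M)" by (simp add: add.commute)
      then show ?thesis using CLM by (simp add: algebra_simps)
    qed
  qed
  moreover have "?C' \<ge> 0" using C(1) L by simp
  ultimately show ?case by blast
qed

lemma bounded_scale_imp_0:
  fixes a C :: real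
  assumes "\<And>s. s \<ge> 1 \<Longrightarrow> \<bar>a\<bar> * s ^ k \<le> C * s ^ j" "j < k"
  shows "a = 0"
proof (rule ccontr)
  assume "a \<noteq> 0"
  define s where "s = 1 + \<bar>C\<bar> / \<bar>a\<bar>"
  have s: "s \<ge> 1" by (simp add: s_def)
  obtain i where i: "k = j + Suc i" using assms(2) less_imp_Suc_add by auto
  have "s ^ 1 \<le> s ^ Suc i" using s by (intro power_increasing) auto
  then have "\<bar>a\<bar> * s * s ^ j \<le> \<bar>a\<bar> * s ^ Suc i * s ^ j"
    using s by (intro mult_right_mono mult_left_mono) auto
  also have "\<dots> = \<bar>a\<bar> * s ^ k" by (simp add: i power_add mult_ac)
  also have "\<dots> \<le> C * s ^ j" by (rule assms(1)[OF s])
  finally have "\<bar>a\<bar> * s \<le> C" using s by (simp add: mult_le_cancel_right)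
  moreover have "\<bar>a\<bar> * s = \<bar>a\<bar> + \<bar>C\<bar>" using \<open>a \<noteq> 0\<close> by (simp add: s_def field_simps)
  ultimately show False using \<open>a \<noteq> 0\<close> by linarith
qed

text \<open>Rescale: for t in [0,1] the polynomial in s t has coefficients a_k s^k and is bounded by
  a multiple of s^j, hence so is each a_k s^k. Letting s grow kills every coefficient above degree
  j.\<close>

lemma coeff_eq_0_of_growth:
  fixes a :: "nat \<Rightarrow> real"
  assumes "\<And>t. t \<ge> 0 \<Longrightarrow> \<bar>\<Sum>k\<le>m. a k * t ^ k\<bar> \<le> C * (1 + t ^ j)" and "j < k" "k \<le> m"
  shows "a k = 0"
proof -
  obtain K where K: "K \<ge> 0"
    "\<forall>a::nat \<Rightarrow> real. \<forall>M. (\<forall>t\<in>{0..1}. \<bar>\<Sum>k\<le>m. a k * t ^ k\<bar> \<le> M) \<longrightarrow> (\<forall>k\<le>m. \<bar>a k\<bar> \<le> K * M)"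
    using coeffs_bounded_by_sup[of m] by blast
  have C: "C \<ge> 0" 
  proof -
    have "0 \<le> C * (1 + 1 ^ j)" using order_trans[OF abs_ge_zero assms(1)[of 1]] by simp
    then show ?thesis by simp
  qed
  show ?thesis
  proof (rule bounded_scale_imp_0[OF _ assms(2)])
    fix s :: real assume s: "s \<ge> 1"
    have sj: "1 \<le> s ^ j" using s by simp
    have "\<bar>a k * s ^ k\<bar> \<le> K * (C * (2 * s ^ j))"
    proof (rule K(2)[rule_format, OF _ assms(3)])
      fix t :: real assume t: "t \<in> {0..1}"
      have "(s * t) ^ j \<le> (s * 1) ^ j" using s t by (intro power_mono mult_left_mono) auto
      then have "1 + (s * t) ^ j \<le> 2 * s ^ j" using sj by simp
      have "\<bar>\<Sum>k\<le>m. a k * s ^ k * t ^ k\<bar> = \<bar>\<Sum>k\<le>m. a k * (s * t) ^ k\<bar>"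
        by (simp add: power_mult_distrib mult_ac)
      also have "\<dots> \<le> C * (1 + (s * t) ^ j)" using s t by (intro assms(1)) auto
      also have "\<dots> \<le> C * (2 * s ^ j)" using C \<open>1 + (s * t) ^ j \<le> _\<close> by (intro mult_left_mono)
      finally show "\<bar>\<Sum>k\<le>m. a k * s ^ k * t ^ k\<bar> \<le> C * (2 * s ^ j)" .
    qed
    then show "\<bar>a k\<bar> * s ^ k \<le> (K * C * 2) * s ^ j" using s by (simp add: abs_mult mult_ac)
  qed
qed

lemma lead_coeff_nonneg:
  fixes a :: "nat \<Rightarrow> real"
  assumes "\<And>t. t \<ge> 0 \<Longrightarrow> (\<Sum>k\<le>j. a k * t ^ k) \<ge> 0"
  shows "a j \<ge> 0"
proof (cases j)
  case 0 then show ?thesis using assms[of 0] by simp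
next
  case (Suc i)
  define S where "S = (\<Sum>k\<le>i. \<bar>a k\<bar>)"
  have S: "S \<ge> 0" by (simp add: S_def sum_nonneg)
  have "- S \<le> a j * t" if t: "t \<ge> 1" for t
  proof -
    have "(\<Sum>k\<le>i. a k * t ^ k) \<le> (\<Sum>k\<le>i. \<bar>a k\<bar> * t ^ i)"
    proof (rule sum_mono)
      fix k assume "k \<in> {..i}"
      then have "t ^ k \<le> t ^ i" using t by (intro power_increasing) auto
      then show "a k * t ^ k \<le> \<bar>a k\<bar> * t ^ i" using t by (intro mult_mono) auto
    qed
    also have "\<dots> = S * t ^ i" by (simp add: S_def sum_distrib_right)
    finally have "0 \<le> (S + a j * t) * t ^ i" using assms[of t] t by (simp add: Suc algebra_simps)
    moreover have "t ^ i > 0" using t by simp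
    ultimately have "0 \<le> S + a j * t" by (simp add: zero_le_mult_iff)
    then show ?thesis by simp
  qed note * = this
  show ?thesis
  proof (rule ccontr)
    assume "\<not> a j \<ge> 0"
    then have n: "a j < 0" by simp
    \<comment> \<open>At this argument, which is at least 1, the left side of the bound just proved
      drops below \<open>- S\<close>.\<close>
    have "a j * (1 + S / (- a j)) = a j - S" using n by (simp add: field_simps)
    moreover have "1 \<le> 1 + S / (- a j)" using n S by (simp add: divide_nonneg_neg)
    ultimately show False using *[of "1 + S / (- a j)"] n by linarith
  qed
qed

section \<open>Convex polynomials with a strict minimum at 0, and their growth along lines\<close>

locale convex_polynomial =
  fixes h :: "'a::euclidean_space \<Rightarrow> real"
  assumes rpf: "real_polynomial_function h" and conv: "convex_on UNIV h"
    and h_0: "h 0 = 0" and h_pos: "x \<noteq> 0 \<Longrightarrow> h x > 0"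
begin

lemma h_nonneg: "h x \<ge> 0"
  using h_0 h_pos[of x] by (cases "x = 0") auto

definition comps where
  "comps = (SOME (n, d). (\<forall>k. real_polynomial_function (d k)) \<and> (\<forall>k>n. \<forall>x. d k x = 0) \<and>
    (\<forall>t x. h (t *\<^sub>R x) = (\<Sum>k\<le>n. d k x * t ^ k)))"

definition "hdeg = fst comps"
definition "hcomp = snd comps"

lemma
  shows hcomp_rpf: "real_polynomial_function (hcomp k)" and hcomp_0: "k > hdeg \<Longrightarrow> hcomp k x = 0"
    and h_expand: "h (t *\<^sub>R x) = (\<Sum>k\<le>hdeg. hcomp k x * t ^ k)"
proof -
  have "\<exists>mc. case mc of (n, d) \<Rightarrow> (\<forall>k. real_polynomial_function (d k)) \<and> (\<forall>k>n. \<forall>x. d k x = 0) \<and>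
    (\<forall>t x. h (t *\<^sub>R x) = (\<Sum>k\<le>n. d k x * t ^ k))"
    using rpf_homogeneous_components[OF rpf] by auto
  from someI_ex[OF this] show "real_polynomial_function (hcomp k)" "k > hdeg \<Longrightarrow> hcomp k x = 0"
    "h (t *\<^sub>R x) = (\<Sum>k\<le>hdeg. hcomp k x * t ^ k)"
    unfolding comps_def[symmetric] hdeg_def hcomp_def by (auto simp: case_prod_beta)
qed

lemma hcomp_scale: "hcomp k (s *\<^sub>R x) = s ^ k * hcomp k x"
proof (cases "k \<le> hdeg")
  case True
  have "(\<Sum>k\<le>hdeg. hcomp k (s *\<^sub>R x) * t ^ k) = (\<Sum>k\<le>hdeg. (s ^ k * hcomp k x) * t ^ k)" for t
    using h_expand[of t "s *\<^sub>R x"] h_expand[of "t * s" x] by (simp add: power_mult_distrib mult_ac)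
  then show ?thesis using polyfun_eq_coeffs[of "\<lambda>k. hcomp k (s *\<^sub>R x)" hdeg "\<lambda>k. s ^ k * hcomp k x"] True by blast
qed (simp add: hcomp_0)

lemma h_segment: "t \<in> {0..1} \<Longrightarrow> h (t *\<^sub>R x) \<le> h x"
  using convex_onD[OF conv, of t 0 x] h_0 h_nonneg[of x] mult_right_mono[of t 1 "h x"] by auto

text \<open>On the segment from 0 to x convexity keeps \<open>h\<close> between 0 and h x. A
  univariate polynomial bounded on [0,1] has bounded coefficients, so \<open>h\<close> itself
  dominates all its homogeneous components.\<close>

lemma hcomp_bound: "\<exists>C\<ge>0. \<forall>x k. \<bar>hcomp k x\<bar> \<le> C * h x"
proof -
  obtain C where C: "C \<ge> 0"
    "\<forall>a::nat \<Rightarrow> real. \<forall>M. (\<forall>t\<in>{0..1}. \<bar>\<Sum>k\<le>hdeg. a k * t ^ k\<bar> \<le> M) \<longrightarrow> (\<forall>k\<le>hdeg. \<bar>a k\<bar> \<le> C * M)"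
    using coeffs_bounded_by_sup[of hdeg] by blast
  have "\<bar>hcomp k x\<bar> \<le> C * h x" for k x
  proof (cases "k \<le> hdeg")
    case True
    show ?thesis
    proof (rule C(2)[rule_format, OF _ True])
      fix t :: real assume "t \<in> {0..1}"
      then show "\<bar>\<Sum>k\<le>hdeg. hcomp k x * t ^ k\<bar> \<le> h x"
        using h_segment h_nonneg[of "t *\<^sub>R x"] unfolding h_expand[symmetric] by simp
    qed
  qed (simp add: hcomp_0 C(1) h_nonneg)
  with C(1) show ?thesis by blast
qed

text \<open>With every component dominated by h x, the value at any t x with |t| \<le> 2 is at most
  a constant times h x; t = 2 and t = -1 are the cases used.\<close>

lemma doubling: "\<exists>C\<ge>1. \<forall>x. h (2 *\<^sub>R x) \<le> C * h x \<and> h (- x) \<le> C * h x"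
proof -
  obtain C where C: "C \<ge> 0" "\<And>x k. \<bar>hcomp k x\<bar> \<le> C * h x" using hcomp_bound by blast
  define K where "K = 1 + (\<Sum>k\<le>hdeg. C * 2 ^ k)"
  have bd: "h (t *\<^sub>R x) \<le> K * h x" if "\<bar>t\<bar> \<le> 2" for t x
  proof -
    have "h (t *\<^sub>R x) \<le> (\<Sum>k\<le>hdeg. \<bar>hcomp k x\<bar> * \<bar>t\<bar> ^ k)"
      unfolding h_expand by (rule sum_mono) (metis abs_ge_self abs_mult power_abs)
    also have "\<dots> \<le> (\<Sum>k\<le>hdeg. (C * h x) * 2 ^ k)"
      using C that by (intro sum_mono mult_mono power_mono) (auto simp: h_nonneg)
    also have "\<dots> \<le> K * h x"
      by (simp add: K_def algebra_simps sum_distrib_left sum_distrib_right h_nonneg)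
    finally show ?thesis .
  qed
  have "K \<ge> 1" using C(1) by (simp add: K_def sum_nonneg)
  then show ?thesis using bd[of 2] bd[of "- 1"] by (intro exI[of _ K]) auto
qed

definition "dbl = (SOME C. C \<ge> 1 \<and> (\<forall>x. h (2 *\<^sub>R x) \<le> C * h x \<and> h (- x) \<le> C * h x))"

lemma dbl: "dbl \<ge> 1" "h (2 *\<^sub>R x) \<le> dbl * h x" "h (- x) \<le> dbl * h x"
  using someI_ex[OF doubling[unfolded Bex_def]] unfolding dbl_def by auto

text \<open>Convexity at the midpoint of 2x and 2y, followed by doubling. This quasi-triangle
  inequality makes it possible to estimate \<open>h\<close> one coordinate at a time.\<close>

lemma h_add: "h (x + y) \<le> dbl * (h x + h y)"
proof -
  have "h (x + y) \<le> (h (2 *\<^sub>R x) + h (2 *\<^sub>R y)) / 2"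
    using convex_onD[OF conv, of "1/2" "2 *\<^sub>R x" "2 *\<^sub>R y"] by simp
  also have "\<dots> \<le> (dbl * h x + dbl * h y) / 2" using dbl by (intro divide_right_mono add_mono) auto
  also have "\<dots> \<le> dbl * (h x + h y)" using dbl(1) h_nonneg[of x] h_nonneg[of y] by (simp add: algebra_simps)
  finally show ?thesis .
qed

text \<open>A flag of subspaces that sorts directions by growth. Growth is the defining condition
  because it passes to sums through \<open>h_add\<close>; the equivalent condition that the
  components above degree \<open>j\<close> vanish is not visibly closed under addition.\<close>

definition V :: "nat \<Rightarrow> 'a set" where
  "V j = {v. \<exists>C. \<forall>t\<ge>0. h (t *\<^sub>R v) \<le> C * (1 + t ^ j)}"

lemma V_I: "(\<And>t. t \<ge> 0 \<Longrightarrow> h (t *\<^sub>R v) \<le> C * (1 + t ^ j)) \<Longrightarrow> v \<in> V j"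
  unfolding V_def by blast

lemma V_bound:
  assumes "v \<in> V j"
  shows "\<exists>C\<ge>0. \<forall>t. h (t *\<^sub>R v) \<le> C * (1 + \<bar>t\<bar> ^ j)"
proof -
  obtain C where C: "\<And>t. t \<ge> 0 \<Longrightarrow> h (t *\<^sub>R v) \<le> C * (1 + t ^ j)" using assms unfolding V_def by blast
  have C0: "C \<ge> 0" using C[of 1] h_nonneg[of v] by simp
  have "h (t *\<^sub>R v) \<le> dbl * C * (1 + \<bar>t\<bar> ^ j)" for t
  proof (cases "t \<ge> 0")
    case True
    have "h (t *\<^sub>R v) \<le> 1 * (C * (1 + t ^ j))" using C[OF True] by simp
    also have "\<dots> \<le> dbl * (C * (1 + t ^ j))" using dbl(1) C0 True by (intro mult_right_mono) auto
    finally show ?thesis using True by (simp add: mult.assoc)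
  next
    case False
    have "h (t *\<^sub>R v) \<le> dbl * h ((- t) *\<^sub>R v)" using dbl(3)[of "(- t) *\<^sub>R v"] by simp
    also have "\<dots> \<le> dbl * (C * (1 + (- t) ^ j))" using dbl(1) False by (intro mult_left_mono C) auto
    finally show ?thesis using False by (simp add: mult.assoc)
  qed
  then show ?thesis using C0 dbl(1) by (intro exI[of _ "dbl * C"]) auto
qed

lemma V_mono: "i \<le> j \<Longrightarrow> V i \<subseteq> V j"
proof
  fix v assume "i \<le> j" "v \<in> V i"
  then obtain C where C: "C \<ge> 0" "\<And>t. h (t *\<^sub>R v) \<le> C * (1 + \<bar>t\<bar> ^ i)" using V_bound by blast
  show "v \<in> V j"
  proof (rule V_I)
    fix t :: real assume t: "t \<ge> 0"
    have "t ^ i \<le> 1 + t ^ j"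
    proof (cases "t \<le> 1")
      case True then show ?thesis using power_le_one[OF t True, of i] t by (smt (verit) zero_le_power)
    next
      case False then show ?thesis using power_increasing[OF \<open>i \<le> j\<close>, of t] by linarith
    qed
    moreover have "t ^ j \<ge> 0" using t by simp
    ultimately have "1 + t ^ i \<le> 2 * (1 + t ^ j)" by simp
    then have "C * (1 + t ^ i) \<le> C * (2 * (1 + t ^ j))" using C(1) by (intro mult_left_mono)
    then show "h (t *\<^sub>R v) \<le> (C * 2) * (1 + t ^ j)" using C(2)[of t] t by (simp add: mult.assoc)
  qed
qed

lemma V_c_0: "v \<in> V j \<Longrightarrow> j < k \<Longrightarrow> hcomp k v = 0"
proof (cases "k \<le> hdeg")
  case True
  assume *: "v \<in> V j" "j < k"
  then obtain C where C: "\<And>t. h (t *\<^sub>R v) \<le> C * (1 + \<bar>t\<bar> ^ j)" using V_bound by blast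
  show ?thesis
  proof (rule coeff_eq_0_of_growth[OF _ *(2) True])
    fix t :: real assume "t \<ge> 0"
    then show "\<bar>\<Sum>k\<le>hdeg. hcomp k v * t ^ k\<bar> \<le> C * (1 + t ^ j)"
      using C[of t] h_nonneg[of "t *\<^sub>R v"] by (simp add: h_expand)
  qed
qed (simp add: hcomp_0)

lemma V_expand:
  assumes "v \<in> V j" shows "h (t *\<^sub>R v) = (\<Sum>k\<le>j. hcomp k v * t ^ k)"
proof -
  have "(\<Sum>k\<le>hdeg. hcomp k v * t ^ k) = (\<Sum>k\<le>max hdeg j. hcomp k v * t ^ k)"
    by (rule sum.mono_neutral_left) (use hcomp_0 in auto)
  also have "\<dots> = (\<Sum>k\<le>j. hcomp k v * t ^ k)"
    by (rule sum.mono_neutral_right) (use V_c_0[OF assms] in auto)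
  finally show ?thesis by (simp add: h_expand)
qed

lemma V_I_c:
  assumes "\<And>k. k > j \<Longrightarrow> hcomp k v = 0" shows "v \<in> V j"
proof (rule V_I)
  fix t :: real assume t: "t \<ge> 0"
  have "h (t *\<^sub>R v) \<le> (\<Sum>k\<le>hdeg. \<bar>hcomp k v\<bar> * (1 + t ^ j))"
    unfolding h_expand
  proof (rule sum_mono)
    fix k
    show "hcomp k v * t ^ k \<le> \<bar>hcomp k v\<bar> * (1 + t ^ j)"
    proof (cases "k \<le> j")
      case True
      have "t ^ k \<le> 1 + t ^ j"
      proof (cases "t \<le> 1")
        case True then show ?thesis using power_le_one[OF t True, of k] t by (smt (verit) zero_le_power)
      next
        case False then show ?thesis using power_increasing[OF \<open>k \<le> j\<close>, of t] by linarith
      qed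
      then show ?thesis using t by (intro mult_mono) auto
    qed (use assms in simp)
  qed
  then show "h (t *\<^sub>R v) \<le> (\<Sum>k\<le>hdeg. \<bar>hcomp k v\<bar>) * (1 + t ^ j)" by (simp add: sum_distrib_right)
qed

lemma V_hdeg: "V hdeg = UNIV"
  using V_I_c hcomp_0 by blast

text \<open>Along such a direction \<open>h\<close> is linear, hence odd; being non-negative on both
  sides, it is zero, and the minimum is strict.\<close>

lemma V_1: "V 1 = {0}"
proof -
  have "v = 0" if "v \<in> V 1" for v
  proof -
    have "hcomp 0 v = 0" using V_expand[OF that, of 0] h_0 by simp
    then have "h v = hcomp 1 v" "h (- v) = - hcomp 1 v"
      using V_expand[OF that, of 1] V_expand[OF that, of "- 1"] by auto
    then have "h v = 0" using h_nonneg[of v] h_nonneg[of "- v"] by simp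
    then show ?thesis using h_pos[of v] by fastforce
  qed
  moreover have "0 \<in> V 1" using h_0 by (intro V_I[of _ 0]) auto
  ultimately show ?thesis by blast
qed

lemma V_subspace: "subspace (V j)"
  unfolding subspace_def
proof (intro conjI ballI allI)
  show "0 \<in> V j" using h_0 by (intro V_I[of _ 0]) auto
next
  fix x y assume "x \<in> V j" "y \<in> V j"
  then obtain C C' where C: "\<And>t. h (t *\<^sub>R x) \<le> C * (1 + \<bar>t\<bar> ^ j)" "\<And>t. h (t *\<^sub>R y) \<le> C' * (1 + \<bar>t\<bar> ^ j)"
    using V_bound by metis
  show "x + y \<in> V j"
  proof (rule V_I)
    fix t :: real assume t: "t \<ge> 0"
    have "h (t *\<^sub>R (x + y)) \<le> dbl * (h (t *\<^sub>R x) + h (t *\<^sub>R y))" by (simp add: h_add scaleR_add_right)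
    also have "\<dots> \<le> dbl * (C * (1 + \<bar>t\<bar> ^ j) + C' * (1 + \<bar>t\<bar> ^ j))"
      using dbl(1) by (intro mult_left_mono add_mono C) auto
    finally show "h (t *\<^sub>R (x + y)) \<le> (dbl * (C + C')) * (1 + t ^ j)" using t by (simp add: algebra_simps)
  qed
next
  fix s :: real and x assume "x \<in> V j"
  then show "s *\<^sub>R x \<in> V j" using V_c_0 by (intro V_I_c) (simp add: hcomp_scale)
qed

lemma hcomp_lead_nonneg: "v \<in> V j \<Longrightarrow> hcomp j v \<ge> 0"
  by (rule lead_coeff_nonneg) (metis V_expand h_nonneg)

lemma hcomp_lead_pos: 
  assumes "v \<in> V (Suc j)" "v \<notin> V j" shows "hcomp (Suc j) v > 0"
proof (rule ccontr)
  assume "\<not> hcomp (Suc j) v > 0"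
  then have "hcomp (Suc j) v = 0" using hcomp_lead_nonneg[OF assms(1)] by simp
  then have "hcomp k v = 0" if "k > j" for k using V_c_0[OF assms(1), of k] that by (cases "k = Suc j") auto
  then show False using V_I_c assms(2) by blast
qed

text \<open>The point t v is the midpoint of 2t(v + u) and -2t u. Convexity gives a polynomial
  inequality in t, and \<open>u\<close> contributes nothing to its coefficient of degree j + 1. So
  adding a slower direction cannot cancel the leading growth of \<open>v\<close>.\<close>

lemma hcomp_lead_add:
  assumes "v \<in> V (Suc j)" "u \<in> V j"
  shows "2 * hcomp (Suc j) v \<le> 2 ^ Suc j * hcomp (Suc j) (v + u)"
proof -
  have vu: "v + u \<in> V (Suc j)" "u \<in> V (Suc j)" 
    using assms V_mono[of j "Suc j"] subspace_add[OF V_subspace] by auto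
  have "0 \<le> 2 ^ Suc j * hcomp (Suc j) (v + u) + (- 2) ^ Suc j * hcomp (Suc j) u - 2 * hcomp (Suc j) v"
  proof (rule lead_coeff_nonneg[of "\<lambda>k. 2 ^ k * hcomp k (v + u) + (- 2) ^ k * hcomp k u - 2 * hcomp k v"])
    fix t :: real assume "t \<ge> 0"
    have "t *\<^sub>R v = (1 - 1/2) *\<^sub>R ((2 * t) *\<^sub>R (v + u)) + (1/2) *\<^sub>R ((- 2 * t) *\<^sub>R u)"
      by (simp add: algebra_simps)
    then have "h (t *\<^sub>R v) \<le> (1 - 1/2) * h ((2 * t) *\<^sub>R (v + u)) + (1/2) * h ((- 2 * t) *\<^sub>R u)"
      using convex_onD[OF conv, of "1/2" "(2 * t) *\<^sub>R (v + u)" "(- 2 * t) *\<^sub>R u"] by (metis UNIV_I atLeastAtMost_iff divide_le_eq_1_pos half_bounded_equal less_eq_real_def zero_less_divide_1_iff zero_less_numeral one_le_numeral)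
    then have "0 \<le> h ((2 * t) *\<^sub>R (v + u)) + h ((- 2 * t) *\<^sub>R u) - 2 * h (t *\<^sub>R v)" by simp
    also have "\<dots> = (\<Sum>k\<le>Suc j. (2 ^ k * hcomp k (v + u) + (- 2) ^ k * hcomp k u - 2 * hcomp k v) * t ^ k)"
      unfolding V_expand[OF assms(1)] V_expand[OF vu(1)] V_expand[OF vu(2)]
      by (simp only: sum_distrib_left sum.distrib[symmetric] sum_subtractf[symmetric] power_mult_distrib)
         (rule sum.cong, simp_all add: algebra_simps)
    finally show "0 \<le> \<dots>" .
  qed
  then show ?thesis using V_c_0[OF assms(2), of "Suc j"] by simp
qed

end

text \<open>Repeated exponents are allowed: a plain list is closed under the operations that
  generate polynomial functions, and only the sums of its terms are used later.\<close>

lemma rpf_monomial_list: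
  assumes "real_polynomial_function (q :: 'a::real_normed_vector \<Rightarrow> real)" "finite B"
  shows "\<exists>xs. \<forall>y. q (\<Sum>b\<in>B. y b *\<^sub>R b) = (\<Sum>(r, \<alpha>)\<leftarrow>xs. r * (\<Prod>b\<in>B. y b ^ \<alpha> b))"
  using assms(1)
proof (induction rule: real_polynomial_function.induct)
  case (linear f)
  then interpret bounded_linear f .
  obtain bs where bs: "set bs = B" "distinct bs" using finite_distinct_list[OF assms(2)] by blast
  have "f (\<Sum>b\<in>B. y b *\<^sub>R b) =
      (\<Sum>(r, \<alpha>)\<leftarrow>map (\<lambda>b. (f b, \<lambda>b'. if b' = b then 1 else 0)) bs. r * (\<Prod>b\<in>B. y b ^ \<alpha> b))" for y
  proof -
    have "f b * (\<Prod>b'\<in>B. y b' ^ (if b' = b then 1 else 0)) = f (y b *\<^sub>R b)" if "b \<in> B" for b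
    proof -
      have "(\<Prod>b'\<in>B. y b' ^ (if b' = b then 1 else 0)) = (\<Prod>b'\<in>B. if b' = b then y b' else 1)"
        by (rule prod.cong) auto
      then show ?thesis using that assms(2) by (simp add: scaleR)
    qed note * = this
    have "(\<Sum>(r, \<alpha>)\<leftarrow>map (\<lambda>b. (f b, \<lambda>b'. if b' = b then 1 else 0)) bs. r * (\<Prod>b\<in>B. y b ^ \<alpha> b)) =
        (\<Sum>b\<leftarrow>bs. f b * (\<Prod>b'\<in>B. y b' ^ (if b' = b then 1 else 0)))"
      by (simp only: map_map comp_def prod.case)
    also have "\<dots> = (\<Sum>b\<in>B. f b * (\<Prod>b'\<in>B. y b' ^ (if b' = b then 1 else 0)))"
      using sum_list_distinct_conv_sum_set[OF bs(2)] bs(1) by simp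
    also have "\<dots> = (\<Sum>b\<in>B. f (y b *\<^sub>R b))" by (rule sum.cong[OF refl *])
    finally show ?thesis by (simp only: sum)
  qed
  then show ?case by blast
next
  case (const c)
  show ?case by (intro exI[of _ "[(c, \<lambda>_. 0)]"]) simp
next
  case (add f g)
  obtain xs where xs: "\<forall>y. f (\<Sum>b\<in>B. y b *\<^sub>R b) = (\<Sum>(r, \<alpha>)\<leftarrow>xs. r * (\<Prod>b\<in>B. y b ^ \<alpha> b))"
    using add.IH(1) by blast
  obtain ys where ys: "\<forall>y. g (\<Sum>b\<in>B. y b *\<^sub>R b) = (\<Sum>(r, \<alpha>)\<leftarrow>ys. r * (\<Prod>b\<in>B. y b ^ \<alpha> b))"
    using add.IH(2) by blast
  show ?case using xs ys by (intro exI[of _ "xs @ ys"]) simp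
next
  case (mult f g)
  obtain xs where xs: "\<forall>y. f (\<Sum>b\<in>B. y b *\<^sub>R b) = (\<Sum>(r, \<alpha>)\<leftarrow>xs. r * (\<Prod>b\<in>B. y b ^ \<alpha> b))"
    using mult.IH(1) by blast
  obtain ys where ys: "\<forall>y. g (\<Sum>b\<in>B. y b *\<^sub>R b) = (\<Sum>(r, \<alpha>)\<leftarrow>ys. r * (\<Prod>b\<in>B. y b ^ \<alpha> b))"
    using mult.IH(2) by blast
  let ?e = "\<lambda>y (r, \<alpha>). r * (\<Prod>b\<in>B. y b ^ \<alpha> b) :: real"
  let ?m = "\<lambda>(r, \<alpha>) (s, \<beta>). (r * s, \<lambda>b. \<alpha> b + \<beta> b)"
  have e: "?e y (?m u v) = ?e y u * ?e y v" for y u v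
    by (cases u; cases v) (simp add: power_add prod.distrib)
  have "(\<Sum>z\<leftarrow>concat (map (\<lambda>u. map (?m u) ys) xs). ?e y z) = (\<Sum>u\<leftarrow>xs. ?e y u) * (\<Sum>v\<leftarrow>ys. ?e y v)" for y
  proof (induction xs)
    case (Cons u xs)
    have "(\<Sum>z\<leftarrow>map (?m u) ys. ?e y z) = ?e y u * (\<Sum>v\<leftarrow>ys. ?e y v)"
      using e by (simp add: comp_def sum_list_const_mult)
    then show ?case using Cons by (simp add: distrib_right)
  qed simp
  then show ?case
    using xs ys by (intro exI[of _ "concat (map (\<lambda>u. map (?m u) ys) xs)"]) simp
qed

lemma rpf_monomials:
  assumes "real_polynomial_function (q :: 'a::real_normed_vector \<Rightarrow> real)" "finite B"
  obtains I :: nat and r \<alpha>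
  where "\<And>y. q (\<Sum>b\<in>B. y b *\<^sub>R b) = (\<Sum>k<I. r k * (\<Prod>b\<in>B. y b ^ \<alpha> k b))"
proof -
  obtain xs where xs: "\<And>y. q (\<Sum>b\<in>B. y b *\<^sub>R b) = (\<Sum>(r, \<alpha>)\<leftarrow>xs. r * (\<Prod>b\<in>B. y b ^ \<alpha> b))"
    using rpf_monomial_list[OF assms] by blast
  show ?thesis
    by (rule that[of "\<lambda>k. fst (xs ! k)" "\<lambda>k. snd (xs ! k)" "length xs"])
       (simp add: xs sum_list_sum_nth case_prod_beta atLeast0LessThan)
qed

section \<open>Adapted bases and the weighted leading form\<close>

context convex_polynomial
begin

definition deg_along :: "'a \<Rightarrow> nat" where
  "deg_along v = (LEAST j. v \<in> V j)"

lemma V_iff_deg: "v \<in> V j \<longleftrightarrow> deg_along v \<le> j"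
proof
  show "v \<in> V j \<Longrightarrow> deg_along v \<le> j" unfolding deg_along_def by (rule Least_le)
  have "v \<in> V (deg_along v)" unfolding deg_along_def by (rule LeastI[of _ hdeg]) (simp add: V_hdeg)
  then show "deg_along v \<le> j \<Longrightarrow> v \<in> V j" using V_mono by blast
qed

lemma deg_along_ge_2: "v \<noteq> 0 \<Longrightarrow> deg_along v \<ge> 2"
  using V_1 V_iff_deg[of v 1] by force

text \<open>The leading coefficient along \<open>v\<close> is positive, and the one along
  -\<open>v\<close>, which is (-1)^d times it, cannot be negative.\<close>

lemma deg_along_even:
  assumes "v \<noteq> 0" shows "even (deg_along v)"
proof -
  obtain j where j: "deg_along v = Suc j" using deg_along_ge_2[OF assms] by (cases "deg_along v") auto
  have v: "v \<in> V (Suc j)" "v \<notin> V j" by (auto simp: V_iff_deg j)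
  have "- v \<in> V (Suc j)" using v(1) subspace_neg[OF V_subspace] by blast
  then have "0 \<le> (- 1) ^ Suc j * hcomp (Suc j) v" using hcomp_lead_nonneg[of "- v" "Suc j"] hcomp_scale[of "Suc j" "- 1" v] by simp
  then show ?thesis using hcomp_lead_pos[OF v] unfolding j by (cases "even (Suc j)") auto
qed

text \<open>A basis of one member of the flag is extended to the next; vectors added later lie in
  the bigger space, so the bases of the earlier members survive inside the final one.\<close>

lemma adapted_basis: "\<exists>B. independent B \<and> B \<subseteq> V j \<and> (\<forall>i\<le>j. span (B \<inter> V i) = V i)"
proof (induction j)
  case 0
  have V0: "V 0 = {0}" using V_mono[of 0 1] V_1 subspace_0[OF V_subspace] by auto
  show ?case by (intro exI[of _ "{}"]) (auto simp: V0 independent_empty)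
next
  case (Suc j)
  then obtain B where B: "independent B" "B \<subseteq> V j" "\<And>i. i \<le> j \<Longrightarrow> span (B \<inter> V i) = V i" by blast
  then have "B \<subseteq> V (Suc j)" using V_mono[of j "Suc j"] by auto
  from maximal_independent_subset_extend[OF this B(1)]
  obtain B' where B': "B \<subseteq> B'" "B' \<subseteq> V (Suc j)" "independent B'" "V (Suc j) \<subseteq> span B'" by blast
  have "span (B' \<inter> V i) = V i" if "i \<le> Suc j" for i
  proof (rule subset_antisym)
    show "span (B' \<inter> V i) \<subseteq> V i" using span_minimal[OF _ V_subspace, of "B' \<inter> V i" i] by auto
    show "V i \<subseteq> span (B' \<inter> V i)"
    proof (cases "i \<le> j")
      case True
      have "V i = span (B \<inter> V i)" using B(3)[OF True] by simp
      also have "\<dots> \<subseteq> span (B' \<inter> V i)" using B'(1) by (intro span_mono) auto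
      finally show ?thesis .
    next
      case False
      then have "i = Suc j" using that by simp
      then show ?thesis using B'(2,4) by (simp add: Int_absorb2)
    qed
  qed
  then show ?case using B' by blast
qed

lemma h_sum_upper:
  assumes "finite S"
  shows "\<exists>C\<ge>0. \<forall>y. h (\<Sum>b\<in>S. y b *\<^sub>R b) \<le> C * (1 + (\<Sum>b\<in>S. \<bar>y b\<bar> ^ deg_along b))"
  using assms
proof (induction S rule: finite_induct)
  case empty then show ?case using h_0 by (intro exI[of _ 0]) auto
next
  case (insert b S)
  then obtain C where C: "C \<ge> 0" "\<And>y. h (\<Sum>b\<in>S. y b *\<^sub>R b) \<le> C * (1 + (\<Sum>b\<in>S. \<bar>y b\<bar> ^ deg_along b))" by blast
  have "b \<in> V (deg_along b)" by (simp add: V_iff_deg)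
  then obtain C' where C': "C' \<ge> 0" "\<And>t. h (t *\<^sub>R b) \<le> C' * (1 + \<bar>t\<bar> ^ deg_along b)" using V_bound by blast
  have "h (\<Sum>b\<in>insert b S. y b *\<^sub>R b) \<le> (dbl * (C + C')) * (1 + (\<Sum>b\<in>insert b S. \<bar>y b\<bar> ^ deg_along b))" for y
  proof -
    let ?s = "\<Sum>b\<in>S. \<bar>y b\<bar> ^ deg_along b" and ?r = "\<bar>y b\<bar> ^ deg_along b"
    have s: "?s \<ge> 0" "?r \<ge> 0" by (auto intro: sum_nonneg)
    have "h (\<Sum>b\<in>insert b S. y b *\<^sub>R b) \<le> dbl * (h (y b *\<^sub>R b) + h (\<Sum>b\<in>S. y b *\<^sub>R b))"
      using insert.hyps h_add by simp
    also have "\<dots> \<le> dbl * (C' * (1 + ?r) + C * (1 + ?s))"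
      using dbl(1) by (intro mult_left_mono add_mono C C') auto
    also have "\<dots> \<le> dbl * ((C + C') * (1 + (?r + ?s)))"
      using dbl(1) C(1) C'(1) s by (intro mult_left_mono) (auto simp: algebra_simps)
    finally show ?thesis using insert.hyps by (simp add: mult.assoc)
  qed
  moreover have "dbl * (C + C') \<ge> 0" using C(1) C'(1) dbl(1) by simp
  ultimately show ?case by blast
qed

text \<open>Induction along the flag. Split x = v + u with \<open>v\<close> spanned by the basis
  vectors of degree exactly j + 1 and \<open>u\<close> in \<open>V j\<close>. The component of
  degree j + 1 is positive definite at \<open>v\<close>, and \<open>hcomp_lead_add\<close> with
  \<open>hcomp_bound\<close> bounds it by a multiple of h x. This controls \<open>v\<close>; then u
  = x - v is controlled through \<open>h_add\<close>, and the induction hypothesis applies to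
  \<open>u\<close>.\<close>

lemma h_sum_lower:
  assumes B: "independent B" "\<And>i. span (B \<inter> V i) = V i"
  shows "\<exists>C\<ge>0. \<forall>y. (\<Sum>b\<in>B \<inter> V j. \<bar>y b\<bar> ^ deg_along b) \<le> C * (1 + h (\<Sum>b\<in>B \<inter> V j. y b *\<^sub>R b))"
proof (induction j)
  case 0
  have V0: "V 0 = {0}" using V_mono[of 0 1] V_1 subspace_0[OF V_subspace] by auto
  have "B \<inter> V 0 = {}" using B(1) dependent_zero by (auto simp: V0)
  then show ?case using h_0 by (intro exI[of _ 0]) simp
next
  case (Suc j)
  have fin: "finite B" using B(1) independent_bound by blast
  obtain C where C: "C \<ge> 0" "\<And>y. (\<Sum>b\<in>B \<inter> V j. \<bar>y b\<bar> ^ deg_along b) \<le> C * (1 + h (\<Sum>b\<in>B \<inter> V j. y b *\<^sub>R b))"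
    using Suc by blast
  obtain Cc where Cc: "Cc \<ge> 0" "\<And>x k. \<bar>hcomp k x\<bar> \<le> Cc * h x" using hcomp_bound by blast
  define W where "W = {b\<in>B. deg_along b = Suc j}"
  have W: "finite W" "W \<inter> (B \<inter> V j) = {}" "B \<inter> V (Suc j) = W \<union> (B \<inter> V j)" "W \<subseteq> V (Suc j)" "W \<subseteq> B"
    using fin by (auto simp: W_def V_iff_deg)
  have spanW: "span W \<subseteq> V (Suc j)" using W(4) span_minimal[OF _ V_subspace] by blast
  \<comment> \<open>Since \<open>B \<inter> V j\<close> already spans \<open>V j\<close>,
    independence prevents a non-zero combination of \<open>W\<close> from falling into
    \<open>V j\<close>. Hence the leading component is positive on all of \<open>span W\<close>, not
    only at its basis vectors.\<close>
  have disj: "span W \<inter> V j \<subseteq> {0}"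
  proof
    fix v assume v: "v \<in> span W \<inter> V j"
    then have "v \<in> span (B \<inter> V j)" using B(2) by auto
    moreover have "v \<in> span W" using v by blast
    ultimately obtain a d where a: "v = (\<Sum>b\<in>W. a b *\<^sub>R b)" and d: "v = (\<Sum>b\<in>B \<inter> V j. d b *\<^sub>R b)"
      unfolding span_finite[OF W(1)] span_finite[OF finite_Int[OF disjI1[OF fin]]] by auto
    define e where "e b = (if b \<in> W then a b else - d b)" for b
    have "(\<Sum>b\<in>W \<union> (B \<inter> V j). e b *\<^sub>R b) = (\<Sum>b\<in>W. e b *\<^sub>R b) + (\<Sum>b\<in>B \<inter> V j. e b *\<^sub>R b)"
      using W(1,2) fin by (intro sum.union_disjoint) auto
    also have "(\<Sum>b\<in>W. e b *\<^sub>R b) = v" unfolding a by (rule sum.cong) (auto simp: e_def)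
    also have "(\<Sum>b\<in>B \<inter> V j. e b *\<^sub>R b) = - v"
      unfolding d sum_negf[symmetric] using W(2) by (intro sum.cong) (auto simp: e_def)
    finally have z: "(\<Sum>b\<in>W \<union> (B \<inter> V j). e b *\<^sub>R b) = 0" by simp
    have "independent (W \<union> (B \<inter> V j))" using B(1) W(5) by (meson Int_lower1 Un_least independent_mono)
    then have "e b = 0" if "b \<in> W" for b
      using that z W(1) fin independentD[of "W \<union> (B \<inter> V j)" "W \<union> (B \<inter> V j)" e b] by auto
    then have "v = 0" unfolding a by (intro sum.neutral) (auto simp: e_def)
    then show "v \<in> {0}" by simp
  qed
  obtain \<delta> where \<delta>: "\<delta> > 0" "\<And>v. v \<in> span W \<Longrightarrow> \<delta> * norm v ^ Suc j \<le> hcomp (Suc j) v"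
  proof -
    let ?S = "{v\<in>span W. norm v = 1}"
    have "\<exists>\<delta>>0. \<forall>v\<in>?S. \<delta> \<le> hcomp (Suc j) v"
    proof (cases "?S = {}")
      case False
      have "compact (span W \<inter> sphere 0 1)" by (intro closed_Int_compact closed_span compact_sphere)
      moreover have "span W \<inter> sphere 0 1 = ?S" by auto
      ultimately have "compact ?S" by simp
      moreover have "continuous_on ?S (hcomp (Suc j))"
        using hcomp_rpf continuous_on_polymonial_function real_polynomial_function_eq by blast
      ultimately obtain v where v: "v \<in> ?S" "\<And>w. w \<in> ?S \<Longrightarrow> hcomp (Suc j) v \<le> hcomp (Suc j) w"
        using continuous_attains_inf[OF _ False, of "hcomp (Suc j)"] by auto
      have "v \<notin> V j" using disj v(1) by auto
      then have "hcomp (Suc j) v > 0" using hcomp_lead_pos spanW v(1) by blast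
      then show ?thesis using v(2) by blast
    qed (auto intro: exI[of _ 1])
    then obtain \<delta> where \<delta>: "\<delta> > 0" "\<And>v. v \<in> ?S \<Longrightarrow> \<delta> \<le> hcomp (Suc j) v" by blast
    show ?thesis
    proof (rule that[OF \<delta>(1)])
      fix v assume v: "v \<in> span W"
      show "\<delta> * norm v ^ Suc j \<le> hcomp (Suc j) v"
      proof (cases "v = 0")
        case True then show ?thesis using hcomp_scale[of "Suc j" 0 0] by simp
      next
        case False
        have "(1 / norm v) *\<^sub>R v \<in> ?S" using v False by (simp add: span_scale)
        then have "\<delta> \<le> (1 / norm v) ^ Suc j * hcomp (Suc j) v" using \<delta>(2)[of "(1 / norm v) *\<^sub>R v"] unfolding hcomp_scale by blast
        then show ?thesis using False by (simp add: power_divide field_simps)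
      qed
    qed
  qed
  obtain K where K: "K \<ge> 0" "\<And>y b. b \<in> W \<Longrightarrow> \<bar>y b\<bar> \<le> K * norm (\<Sum>b\<in>W. y b *\<^sub>R b)"
  proof -
    have iW: "independent W" using B(1) W(5) by (rule independent_mono)
    have "\<exists>K\<ge>0. \<forall>y. \<bar>y b\<bar> \<le> K * norm (\<Sum>b\<in>W. y b *\<^sub>R b)" if "b \<in> W" for b
    proof -
      obtain g :: "'a \<Rightarrow> real" where g: "linear g" "\<And>x. x \<in> W \<Longrightarrow> g x = (if x = b then 1 else 0)"
        using linear_independent_extend[OF iW, of "\<lambda>x. if x = b then 1 else 0"] by blast
      obtain K where K: "K > 0" "\<And>x. norm (g x) \<le> K * norm x" using linear_bounded_pos[OF g(1)] by blast
      have "g (\<Sum>b\<in>W. y b *\<^sub>R b) = y b" for y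
      proof -
        have "g (\<Sum>b\<in>W. y b *\<^sub>R b) = (\<Sum>x\<in>W. y x * g x)"
          by (simp add: linear_sum[OF g(1)] linear_cmul[OF g(1)])
        also have "\<dots> = (\<Sum>x\<in>W. if x = b then y x else 0)" by (rule sum.cong) (auto simp: g(2))
        finally show ?thesis using that W(1) by simp
      qed
      then have "\<bar>y b\<bar> \<le> K * norm (\<Sum>b\<in>W. y b *\<^sub>R b)" for y
        using K(2)[of "\<Sum>b\<in>W. y b *\<^sub>R b"] by simp
      then show ?thesis using K(1) by (intro exI[of _ K]) auto
    qed
    then obtain Kb where Kb: "\<And>b. b \<in> W \<Longrightarrow> Kb b \<ge> 0"
      "\<And>b y. b \<in> W \<Longrightarrow> \<bar>y b\<bar> \<le> Kb b * norm (\<Sum>b\<in>W. y b *\<^sub>R b)" by metis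
    show ?thesis
    proof (rule that[of "\<Sum>b\<in>W. Kb b"])
      show "0 \<le> (\<Sum>b\<in>W. Kb b)" using Kb(1) by (rule sum_nonneg)
      fix y b assume b: "b \<in> W"
      have "\<bar>y b\<bar> \<le> Kb b * norm (\<Sum>b\<in>W. y b *\<^sub>R b)" by (rule Kb(2)[OF b])
      also have "\<dots> \<le> (\<Sum>b\<in>W. Kb b) * norm (\<Sum>b\<in>W. y b *\<^sub>R b)"
        using Kb(1) b W(1) by (intro mult_right_mono member_le_sum) auto
      finally show "\<bar>y b\<bar> \<le> (\<Sum>b\<in>W. Kb b) * norm (\<Sum>b\<in>W. y b *\<^sub>R b)" .
    qed
  qed
  obtain U where U: "U \<ge> 0" "\<And>y. h (\<Sum>b\<in>W. y b *\<^sub>R b) \<le> U * (1 + (\<Sum>b\<in>W. \<bar>y b\<bar> ^ deg_along b))"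
    using h_sum_upper[OF W(1)] by blast
  \<comment> \<open>\<open>A1\<close> will bound the coordinates in \<open>W\<close> by multiples of
    h x, and \<open>A2\<close> will bound h u by multiples of 1 + h x; the factors are those of the
    chain of estimates that follows.\<close>
  define A1 where "A1 = card W * (K ^ Suc j * (2 ^ j * Cc / \<delta>))"
  have A1: "A1 \<ge> 0" using K(1) Cc(1) \<delta>(1) by (simp add: A1_def)
  define A2 where "A2 = dbl * (1 + dbl * (U * (1 + A1)))"
  have A2: "A2 \<ge> 0" using A1 U(1) dbl(1) by (simp add: A2_def)
  have "(\<Sum>b\<in>B \<inter> V (Suc j). \<bar>y b\<bar> ^ deg_along b) \<le> (A1 + C * (1 + A2)) * (1 + h (\<Sum>b\<in>B \<inter> V (Suc j). y b *\<^sub>R b))" for y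
  proof -
    define v where "v = (\<Sum>b\<in>W. y b *\<^sub>R b)"
    define u where "u = (\<Sum>b\<in>B \<inter> V j. y b *\<^sub>R b)"
    have x: "(\<Sum>b\<in>B \<inter> V (Suc j). y b *\<^sub>R b) = v + u"
      unfolding W(3) v_def u_def by (rule sum.union_disjoint) (use W fin in auto)
    have hx: "h (v + u) \<ge> 0" by (rule h_nonneg)
    have vW: "v \<in> span W" unfolding v_def by (intro span_sum span_scale span_base)
    have "u \<in> span (B \<inter> V j)" unfolding u_def by (intro span_sum span_scale span_base)
    then have uV: "u \<in> V j" unfolding B(2) .
    have "\<delta> * norm v ^ Suc j \<le> hcomp (Suc j) v" by (rule \<delta>(2)[OF vW])
    also have "\<dots> \<le> 2 ^ j * hcomp (Suc j) (v + u)" using hcomp_lead_add[OF _ uV, of v] vW spanW by auto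
    also have "\<dots> \<le> 2 ^ j * (Cc * h (v + u))"
      using Cc(2)[of "Suc j" "v + u"] by (intro mult_left_mono) auto
    finally have nv: "norm v ^ Suc j \<le> 2 ^ j * Cc / \<delta> * h (v + u)"
      using \<delta>(1) by (simp add: field_simps)
    have sW: "(\<Sum>b\<in>W. \<bar>y b\<bar> ^ deg_along b) \<le> A1 * h (v + u)"
    proof -
      have "(\<Sum>b\<in>W. \<bar>y b\<bar> ^ deg_along b) \<le> (\<Sum>b\<in>W. K ^ Suc j * (2 ^ j * Cc / \<delta> * h (v + u)))"
      proof (rule sum_mono)
        fix b assume b: "b \<in> W"
        then have "\<bar>y b\<bar> ^ deg_along b \<le> (K * norm v) ^ Suc j"
          using K(2)[OF b, of y] by (simp add: W_def v_def[unfolded W_def] power_mono del: power_Suc)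
        also have "\<dots> \<le> K ^ Suc j * (2 ^ j * Cc / \<delta> * h (v + u))"
          unfolding power_mult_distrib using nv K(1) by (intro mult_left_mono) auto
        finally show "\<bar>y b\<bar> ^ deg_along b \<le> K ^ Suc j * (2 ^ j * Cc / \<delta> * h (v + u))" .
      qed
      then show ?thesis by (simp add: A1_def mult_ac)
    qed
    have "h v \<le> U * (1 + (\<Sum>b\<in>W. \<bar>y b\<bar> ^ deg_along b))" unfolding v_def by (rule U(2))
    also have "\<dots> \<le> U * (1 + A1 * h (v + u))" using sW U(1) by (intro mult_left_mono add_mono) auto
    also have "\<dots> \<le> U * ((1 + A1) * (1 + h (v + u)))"
      using U(1) A1 hx by (intro mult_left_mono) (auto simp: algebra_simps)
    finally have hv: "h v \<le> U * (1 + A1) * (1 + h (v + u))" by (simp add: mult.assoc)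
    have "h u \<le> dbl * (h (v + u) + h (- v))" using h_add[of "v + u" "- v"] by simp
    also have "\<dots> \<le> dbl * (1 * (1 + h (v + u)) + dbl * (U * (1 + A1) * (1 + h (v + u))))"
    proof (intro mult_left_mono add_mono)
      show "h (- v) \<le> dbl * (U * (1 + A1) * (1 + h (v + u)))"
        using dbl(3)[of v] mult_left_mono[OF hv, of dbl] dbl(1) by linarith
    qed (use dbl(1) in auto)
    finally have hu: "h u \<le> A2 * (1 + h (v + u))" by (simp add: A2_def algebra_simps)
    have "(\<Sum>b\<in>B \<inter> V j. \<bar>y b\<bar> ^ deg_along b) \<le> C * (1 + h u)" unfolding u_def by (rule C(2))
    also have "\<dots> \<le> C * ((1 + A2) * (1 + h (v + u)))"
      using hu hx C(1) by (intro mult_left_mono) (auto simp: algebra_simps)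
    finally have "(\<Sum>b\<in>W. \<bar>y b\<bar> ^ deg_along b) + (\<Sum>b\<in>B \<inter> V j. \<bar>y b\<bar> ^ deg_along b)
        \<le> A1 * (1 + h (v + u)) + C * (1 + A2) * (1 + h (v + u))"
      using sW A1 by (intro add_mono) (auto simp: algebra_simps)
    moreover have "(\<Sum>b\<in>B \<inter> V (Suc j). \<bar>y b\<bar> ^ deg_along b) =
        (\<Sum>b\<in>W. \<bar>y b\<bar> ^ deg_along b) + (\<Sum>b\<in>B \<inter> V j. \<bar>y b\<bar> ^ deg_along b)"
      unfolding W(3) by (rule sum.union_disjoint) (use W fin in auto)
    ultimately show ?thesis unfolding x by (simp add: algebra_simps)
  qed
  moreover have "A1 + C * (1 + A2) \<ge> 0" using A1 A2 C(1) by simp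
  ultimately show ?case by blast
qed

text \<open>Up to a constant factor and an additive 1, \<open>h\<close> behaves like a polynomial
  with separated variables. At \<open>hdeg\<close> the flag has reached the whole space, so the
  estimate for partial sums covers the full basis.\<close>

lemma weighted_growth:
  obtains B C where "finite B" "independent B" "span B = UNIV" "C > 0"
    "\<And>y. (\<Sum>b\<in>B. \<bar>y b\<bar> ^ deg_along b) \<le> C * (1 + h (\<Sum>b\<in>B. y b *\<^sub>R b))"
    "\<And>y. h (\<Sum>b\<in>B. y b *\<^sub>R b) \<le> C * (1 + (\<Sum>b\<in>B. \<bar>y b\<bar> ^ deg_along b))"
proof -
  obtain B where B: "independent B" "\<And>i. i \<le> hdeg \<Longrightarrow> span (B \<inter> V i) = V i"
    using adapted_basis by blast
  have V: "V i = UNIV" if "i \<ge> hdeg" for i using V_mono[OF that] V_hdeg by auto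
  have s: "span (B \<inter> V i) = V i" for i using B(2)[of i] B(2)[of hdeg] V[of i] V_hdeg by (cases "i \<le> hdeg") auto
  have fin: "finite B" using B(1) independent_bound by blast
  obtain C where C: "C \<ge> 0" "\<And>y. (\<Sum>b\<in>B. \<bar>y b\<bar> ^ deg_along b) \<le> C * (1 + h (\<Sum>b\<in>B. y b *\<^sub>R b))"
    using h_sum_lower[OF B(1) s, of hdeg] by (auto simp: V_hdeg)
  obtain U where U: "U \<ge> 0" "\<And>y. h (\<Sum>b\<in>B. y b *\<^sub>R b) \<le> U * (1 + (\<Sum>b\<in>B. \<bar>y b\<bar> ^ deg_along b))"
    using h_sum_upper[OF fin] by blast
  show ?thesis
  proof (rule that[OF fin B(1)])
    show "span B = UNIV" using s[of hdeg] V_hdeg by simp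
    show "1 + C + U > 0" using C(1) U(1) by simp
    fix y
    show "(\<Sum>b\<in>B. \<bar>y b\<bar> ^ deg_along b) \<le> (1 + C + U) * (1 + h (\<Sum>b\<in>B. y b *\<^sub>R b))"
      using order_trans[OF C(2)[of y] mult_right_mono[of C "1 + C + U"]] U(1) h_nonneg by simp
    have "(\<Sum>b\<in>B. \<bar>y b\<bar> ^ deg_along b) \<ge> 0" by (intro sum_nonneg) auto
    then show "h (\<Sum>b\<in>B. y b *\<^sub>R b) \<le> (1 + C + U) * (1 + (\<Sum>b\<in>B. \<bar>y b\<bar> ^ deg_along b))"
      using order_trans[OF U(2)[of y] mult_right_mono[of U "1 + C + U"]] C(1) by simp
  qed
qed

text \<open>
  \<open>d b\<close> is the degree of \<open>h\<close> along \<open>b\<close>, and \<open>e b = K / d b\<close> is the weight given to that coordinate.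
  A monomial of weight above \<open>K\<close> would outgrow the bound that convexity gives in terms of the axes.
\<close>

lemma weighted_normal_form:
  obtains B and K I :: nat and r \<alpha> and d :: "'a \<Rightarrow> nat" and e :: "'a \<Rightarrow> nat" and \<gamma> :: real
  where "finite B" "independent B" "span B = UNIV" "\<gamma> > 0" "K > 0"
    "\<And>b. b \<in> B \<Longrightarrow> even (d b) \<and> 2 \<le> d b \<and> d b * e b = K"
    "\<And>y. h (\<Sum>b\<in>B. y b *\<^sub>R b) = (\<Sum>k<I. r k * (\<Prod>b\<in>B. y b ^ \<alpha> k b))"
    "\<And>k. k < I \<Longrightarrow> (\<Sum>b\<in>B. e b * \<alpha> k b) \<le> K"
    "\<And>y. \<gamma> * (\<Sum>b\<in>B. \<bar>y b\<bar> ^ d b) \<le>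
       (\<Sum>k<I. if (\<Sum>b\<in>B. e b * \<alpha> k b) = K then r k * (\<Prod>b\<in>B. y b ^ \<alpha> k b) else 0)"
proof -
  obtain B C where B: "finite B" "independent B" "span B = UNIV" "C > 0"
    "\<And>y. (\<Sum>b\<in>B. \<bar>y b\<bar> ^ deg_along b) \<le> C * (1 + h (\<Sum>b\<in>B. y b *\<^sub>R b))"
    "\<And>y. h (\<Sum>b\<in>B. y b *\<^sub>R b) \<le> C * (1 + (\<Sum>b\<in>B. \<bar>y b\<bar> ^ deg_along b))"
    using weighted_growth by blast
  obtain I and r :: "nat \<Rightarrow> real" and \<alpha> where mon: "\<And>y. h (\<Sum>b\<in>B. y b *\<^sub>R b) = (\<Sum>k<I. r k * (\<Prod>b\<in>B. y b ^ \<alpha> k b))"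
    using rpf_monomials[OF rpf B(1)] by blast
  have nz: "b \<noteq> 0" if "b \<in> B" for b using that B(2) dependent_zero by blast
  have d2: "2 \<le> deg_along b" if "b \<in> B" for b using deg_along_ge_2[OF nz[OF that]] .
  \<comment> \<open>A common multiple of all the degrees, so that the weights K / d_b are natural
    numbers.\<close>
  define K where "K = (\<Prod>b\<in>B. deg_along b)"
  define e where "e b = K div deg_along b" for b
  have de: "deg_along b * e b = K" if "b \<in> B" for b
    using that B(1) by (simp add: e_def K_def dvd_prodI)
  have K: "K > 0" unfolding K_def using d2 by (intro prod_pos) fastforce
  define w where "w k = (\<Sum>b\<in>B. e b * \<alpha> k b)" for k
  define M where "M = Max (insert K (w ` {..<I}))"
  have M: "K \<le> M" "\<And>k. k < I \<Longrightarrow> w k \<le> M" by (auto simp: M_def intro!: Max_ge)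
  define t where "t y k = r k * (\<Prod>b\<in>B. y b ^ \<alpha> k b)" for y k
  define q where "q y j = (\<Sum>k\<in>{k\<in>{..<I}. w k = j}. t y k)" for y j
  \<comment> \<open>Replacing y_b by s^(e b) y_b grades the monomials by weight: \<open>h\<close>
    becomes a polynomial in \<open>s\<close> whose coefficient \<open>q y j\<close> collects the
    terms of weight \<open>j\<close>.\<close>
  have ex: "h (\<Sum>b\<in>B. (s ^ e b * y b) *\<^sub>R b) = (\<Sum>j\<le>M. q y j * s ^ j)" for s y
  proof -
    have "h (\<Sum>b\<in>B. (s ^ e b * y b) *\<^sub>R b) = (\<Sum>k<I. t y k * s ^ w k)"
      unfolding mon by (rule sum.cong) (simp_all add: t_def w_def power_mult_distrib prod.distrib power_sum power_mult mult_ac)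
    also have "\<dots> = (\<Sum>j\<le>M. \<Sum>k\<in>{k\<in>{..<I}. w k = j}. t y k * s ^ w k)"
      by (rule sum.group[symmetric]) (use M in auto)
    finally show ?thesis by (simp add: q_def sum_distrib_right)
  qed
  define S where "S y = (\<Sum>b\<in>B. \<bar>y b\<bar> ^ deg_along b)" for y :: "'a \<Rightarrow> real"
  have S0: "S y \<ge> 0" for y unfolding S_def by (intro sum_nonneg) auto
  have Ss: "(\<Sum>b\<in>B. \<bar>s ^ e b * y b\<bar> ^ deg_along b) = s ^ K * S y" if "s \<ge> 0" for s y
    unfolding S_def sum_distrib_left
  proof (rule sum.cong)
    fix b assume "b \<in> B"
    then show "\<bar>s ^ e b * y b\<bar> ^ deg_along b = s ^ K * \<bar>y b\<bar> ^ deg_along b"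
      using de[of b] that by (simp add: abs_mult power_mult_distrib mult.commute flip: power_mult)
  qed simp
  have q0: "q y j = 0" if "K < j" "j \<le> M" for y j
  proof (rule coeff_eq_0_of_growth[OF _ that])
    fix s :: real assume s: "s \<ge> 0"
    have "h (\<Sum>b\<in>B. (s ^ e b * y b) *\<^sub>R b) \<le> C * (1 + s ^ K * S y)"
      using B(6)[of "\<lambda>b. s ^ e b * y b"] Ss[OF s] by simp
    also have "\<dots> \<le> C * ((1 + S y) * (1 + s ^ K))"
      using B(4) s S0[of y] by (intro mult_left_mono) (auto simp: algebra_simps)
    finally show "\<bar>\<Sum>j\<le>M. q y j * s ^ j\<bar> \<le> (C * (1 + S y)) * (1 + s ^ K)"
      using h_nonneg[of "\<Sum>b\<in>B. (s ^ e b * y b) *\<^sub>R b"] unfolding ex by (simp add: mult.assoc)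
  qed
  have qK: "(\<Sum>j\<le>M. q y j * s ^ j) = (\<Sum>j\<le>K. q y j * s ^ j)" for y s
    by (rule sum.mono_neutral_right) (use M(1) q0 in auto)
  have low: "S y \<le> C * q y K" for y
  proof -
    \<comment> \<open>The coefficients of C (1 + h) - S s^K as a polynomial in \<open>s\<close>,
      which is non-negative by the lower growth bound. As K > 0, the constant C does not disturb the
      coefficient at \<open>K\<close>.\<close>
    define a where "a j = C * q y j + (if j = 0 then C else 0) - (if j = K then S y else 0)" for j
    have "0 \<le> a K"
    proof (rule lead_coeff_nonneg)
      fix s :: real assume s: "s \<ge> 0"
      have "(\<Sum>j\<le>K. a j * s ^ j) = (\<Sum>j\<le>K. C * (q y j * s ^ j)) + (\<Sum>j\<le>K. if j = 0 then C else 0) - (\<Sum>j\<le>K. if j = K then S y * s ^ K else 0)"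
        unfolding sum.distrib[symmetric] sum_subtractf[symmetric]
        by (rule sum.cong) (auto simp: a_def algebra_simps)
      also have "\<dots> = C * (1 + h (\<Sum>b\<in>B. (s ^ e b * y b) *\<^sub>R b)) - S y * s ^ K"
        unfolding ex qK by (simp add: sum_distrib_left algebra_simps)
      finally show "(\<Sum>j\<le>K. a j * s ^ j) \<ge> 0"
        using B(5)[of "\<lambda>b. s ^ e b * y b"] Ss[OF s] by (simp add: mult.commute)
    qed
    then show ?thesis using K by (simp add: a_def)
  qed
  \<comment> \<open>Terms of weight above \<open>K\<close> need not vanish individually, because
    exponents may repeat; only their sum does. They are replaced by zero terms with zero exponent,
    so that the weight bound holds for every index.\<close>
  define r' where "r' k = (if w k \<le> K then r k else 0)" for k
  define \<alpha>' where "\<alpha>' k = (if w k \<le> K then \<alpha> k else (\<lambda>_. 0))" for k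
  have w': "(\<Sum>b\<in>B. e b * \<alpha>' k b) = (if w k \<le> K then w k else 0)" for k
    by (simp add: \<alpha>'_def w_def)
  show ?thesis
  proof (rule that[OF B(1-3) _ K])
    show "1 / C > 0" using B(4) by simp
    show "even (deg_along b) \<and> 2 \<le> deg_along b \<and> deg_along b * e b = K" if "b \<in> B" for b
      using d2[OF that] de[OF that] deg_along_even[OF nz[OF that]] by simp
    show "(\<Sum>b\<in>B. e b * \<alpha>' k b) \<le> K" for k unfolding w' by simp
    fix y :: "'a \<Rightarrow> real"
    have t': "r' k * (\<Prod>b\<in>B. y b ^ \<alpha>' k b) = (if w k \<le> K then t y k else 0)" for k
      by (simp add: r'_def \<alpha>'_def t_def)
    have "h (\<Sum>b\<in>B. y b *\<^sub>R b) = (\<Sum>j\<le>K. q y j)" using ex[of 1 y] qK[of y 1] by simp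
    also have "\<dots> = (\<Sum>j\<le>K. \<Sum>k\<in>{k\<in>{k\<in>{..<I}. w k \<le> K}. w k = j}. t y k)"
      unfolding q_def by (intro sum.cong) auto
    also have "\<dots> = (\<Sum>k\<in>{k\<in>{..<I}. w k \<le> K}. t y k)" by (rule sum.group) auto
    also have "\<dots> = (\<Sum>k<I. r' k * (\<Prod>b\<in>B. y b ^ \<alpha>' k b))"
      unfolding t' by (subst sum.inter_filter) auto
    finally show "h (\<Sum>b\<in>B. y b *\<^sub>R b) = (\<Sum>k<I. r' k * (\<Prod>b\<in>B. y b ^ \<alpha>' k b))" .
    have "q y K = (\<Sum>k<I. if w k = K then t y k else 0)"
      unfolding q_def by (rule sum.inter_filter) simp
    also have "\<dots> = (\<Sum>k<I. if (\<Sum>b\<in>B. e b * \<alpha>' k b) = K then r' k * (\<Prod>b\<in>B. y b ^ \<alpha>' k b) else 0)"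
      unfolding t' w' using K by (intro sum.cong) auto
    finally show "1 / C * (\<Sum>b\<in>B. \<bar>y b\<bar> ^ deg_along b) \<le> \<dots>"
      using low[of y] B(4) unfolding S_def by (simp add: field_simps)
  qed
qed

end

section \<open>The Archimedean property\<close>

definition coord :: "'n::finite \<Rightarrow> 'n rpoly" where
  "coord i = lin_poly (axis i 1)"

lemma eval_coord [simp]: "eval_poly (coord i) x = x $ i"
  by (simp add: coord_def inner_axis')

lemma single_eq_coords:
  "Poly_Mapping.single e a = const_poly a * (\<Prod>i\<in>UNIV. coord i ^ Poly_Mapping.lookup e i)"
  by (rule eval_poly_ext) (simp add: monomial_value_def)

locale rpoly_preordering = preordering const_poly T for T :: "'n::finite rpoly set"
begin

lemma bounded_elem_all:
  assumes "\<And>i. bounded_elem (coord i)" shows "bounded_elem p"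
proof (induction p rule: rpoly_induct)
  case zero then show ?case using bounded_elem_const[of 0] by simp
next
  case (add e a p)
  then show ?case unfolding single_eq_coords
    by (intro bounded_elem_add bounded_elem_mult bounded_elem_const bounded_elem_prod bounded_elem_power assms)
qed

lemma bounded_elem_of_ball:
  assumes "const_poly N - (\<Sum>i\<in>UNIV. coord i * coord i) \<in> T" shows "bounded_elem p"
proof (rule bounded_elem_all)
  show "bounded_elem (coord i)" for i
    unfolding bounded_elem_def
    using coordinates_bounded[OF finite UNIV_I assms, of i] by blast
qed

end

locale rpoly_total_preordering = rpoly_preordering T + total_preordering const_poly T
  for T :: "'n::finite rpoly set"
begin

text \<open>Take the largest of the quantities \<open>\<zeta> b ^ d b\<close> as the unit
  \<open>E\<close>. Relative to \<open>E\<close>, monomials of weight below \<open>K\<close> are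
  infinitesimal, and those of weight \<open>K\<close> have as standard part their value at the real
  point of standard parts. So \<open>p\<close> relative to \<open>E\<close> has standard part Q, a
  value of the leading form at a non-zero real point, hence positive, and \<open>p\<close> is at
  least the infinite quantity (Q/2) E.\<close>

lemma convex_unbounded_at_infinite_points:
  assumes "convex_polynomial (eval_poly p)"
    and inf: "\<And>N. (\<Sum>i\<in>UNIV. coord i * coord i) - const_poly N \<in> T"
  shows "const_poly \<rho> - p \<notin> T"
proof
  assume \<rho>: "const_poly \<rho> - p \<in> T"
  interpret convex_polynomial "eval_poly p" by fact
  obtain B and K I :: nat and r \<alpha> and d :: "real ^ 'n \<Rightarrow> nat" and e and \<gamma> :: real
    where B: "finite B" "independent B" "span B = UNIV" "\<gamma> > 0" "K > 0"
      and de: "\<And>b. b \<in> B \<Longrightarrow> even (d b) \<and> 2 \<le> d b \<and> d b * e b = K"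
      and mon: "\<And>y. eval_poly p (\<Sum>b\<in>B. y b *\<^sub>R b) = (\<Sum>k<I. r k * (\<Prod>b\<in>B. y b ^ \<alpha> k b))"
      and wt: "\<And>k. k < I \<Longrightarrow> (\<Sum>b\<in>B. e b * \<alpha> k b) \<le> K"
      and lead: "\<And>y. \<gamma> * (\<Sum>b\<in>B. \<bar>y b\<bar> ^ d b) \<le>
       (\<Sum>k<I. if (\<Sum>b\<in>B. e b * \<alpha> k b) = K then r k * (\<Prod>b\<in>B. y b ^ \<alpha> k b) else 0)"
    by (rule weighted_normal_form) (rule that; assumption)
  have "\<exists>g::real ^ 'n \<Rightarrow> real. linear g \<and> (\<forall>x\<in>B. g x = (if x = b then 1 else 0))" for b
    using linear_independent_extend[OF B(2), of "\<lambda>x. if x = b then 1 else 0"] .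
  then obtain g :: "real ^ 'n \<Rightarrow> real ^ 'n \<Rightarrow> real"
    where g: "\<And>b. linear (g b)" "\<And>b x. x \<in> B \<Longrightarrow> g b x = (if x = b then 1 else 0)" by metis
  have expand: "(\<Sum>b\<in>B. g b x *\<^sub>R b) = x" for x
  proof (rule linear_eq_on[where f = "\<lambda>x. \<Sum>b\<in>B. g b x *\<^sub>R b" and g = "\<lambda>x. x" and B = B])
    show "linear (\<lambda>x. \<Sum>b\<in>B. g b x *\<^sub>R b)"
      by (intro linear_compose_sum ballI) (use g(1) in \<open>auto intro!: linearI simp: linear_add linear_cmul scaleR_add_left\<close>)
    show "x \<in> span B" using B(3) by simp
    fix b assume b: "b \<in> B"
    have "(\<Sum>b'\<in>B. g b' b *\<^sub>R b') = (\<Sum>b'\<in>B. if b = b' then b' else 0)"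
      by (rule sum.cong) (auto simp: g(2)[OF b])
    then show "(\<Sum>b'\<in>B. g b' b *\<^sub>R b') = b" using b B(1) by simp
  qed (rule linear_ident)
  define \<Xi> where "\<Xi> b = lin_poly (adjoint (g b) 1)" for b
  have ev: "eval_poly (\<Xi> b) x = g b x" for b x
    using adjoint_clauses(1)[OF g(1)[of b], of x 1] by (simp add: \<Xi>_def inner_commute)
  \<comment> \<open>Signs that make all coordinates non-negative in the preordering, as the
    extraction of roots requires; they are put back when the leading form is evaluated.\<close>
  define \<sigma> :: "real ^ 'n \<Rightarrow> real" where "\<sigma> b = (if \<Xi> b \<in> T then 1 else - 1)" for b
  have \<sigma>: "\<sigma> b * \<sigma> b = 1" for b by (simp add: \<sigma>_def)
  define \<zeta> where "\<zeta> b = const_poly (\<sigma> b) * \<Xi> b" for b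
  have \<zeta>T: "\<zeta> b \<in> T" for b
    using total[of "\<Xi> b"] by (auto simp: \<zeta>_def \<sigma>_def \<kappa>_uminus \<kappa>_1)
  have \<Xi>\<zeta>: "\<Xi> b = const_poly (\<sigma> b) * \<zeta> b" for b
    using \<sigma>[of b] by (intro eval_poly_ext) (simp add: \<zeta>_def mult.assoc[symmetric])
  define r' where "r' k = r k * (\<Prod>b\<in>B. \<sigma> b ^ \<alpha> k b)" for k
  define mk where "mk k = (\<Prod>b\<in>B. \<zeta> b ^ \<alpha> k b)" for k
  have p: "p = (\<Sum>k<I. const_poly (r' k) * mk k)"
  proof (rule eval_poly_ext)
    fix x
    have "eval_poly p x = (\<Sum>k<I. r k * (\<Prod>b\<in>B. g b x ^ \<alpha> k b))"
      using mon[of "\<lambda>b. g b x"] by (simp add: expand)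
    also have "\<dots> = (\<Sum>k<I. r' k * (\<Prod>b\<in>B. (\<sigma> b * g b x) ^ \<alpha> k b))"
    proof (rule sum.cong)
      fix k
      have "(\<Prod>b\<in>B. \<sigma> b ^ \<alpha> k b) * (\<Prod>b\<in>B. (\<sigma> b * g b x) ^ \<alpha> k b) = (\<Prod>b\<in>B. (\<sigma> b * \<sigma> b * g b x) ^ \<alpha> k b)"
        by (simp add: prod.distrib[symmetric] power_mult_distrib[symmetric] mult.assoc)
      then show "r k * (\<Prod>b\<in>B. g b x ^ \<alpha> k b) = r' k * (\<Prod>b\<in>B. (\<sigma> b * g b x) ^ \<alpha> k b)"
        by (simp add: r'_def \<sigma>)
    qed simp
    also have "\<dots> = eval_poly (\<Sum>k<I. const_poly (r' k) * mk k) x"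
      by (simp add: mk_def \<zeta>_def ev)
    finally show "eval_poly p x = eval_poly (\<Sum>k<I. const_poly (r' k) * mk k) x" .
  qed
  have "B \<noteq> {}"
  proof
    assume "B = {}"
    then have "axis i 1 = (0 :: real ^ 'n)" for i using B(3) by auto
    then show False by (simp add: axis_eq_0_iff)
  qed
  then obtain b0 where b0: "b0 \<in> B" "\<And>b. b \<in> B \<Longrightarrow> \<zeta> b0 ^ d b0 - \<zeta> b ^ d b \<in> T"
    using exists_max[OF B(1), of "\<lambda>b. \<zeta> b ^ d b"] by blast
  define E where "E = \<zeta> b0 ^ d b0"
  have E: "E \<in> T" unfolding E_def by (intro T_power \<zeta>T)
  \<comment> \<open>If \<open>E\<close> were bounded, maximality would bound every
    \<open>\<zeta> b ^ d b\<close>, then every coordinate, and then |x|^2, which is infinitely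
    large.\<close>
  have Einf: "E - const_poly N \<in> T" for N
  proof (rule ccontr)
    assume "E - const_poly N \<notin> T"
    then have NE: "const_poly N - E \<in> T" using total_diff by blast
    have "bounded_elem (\<zeta> b)" if b: "b \<in> B" for b
    proof -
      have bN: "const_poly N - \<zeta> b ^ d b \<in> T" using T_trans[OF b0(2)[OF b] NE[unfolded E_def]] .
      \<comment> \<open>At least 1 and greater than \<open>N\<close>, so that its
        \<open>d b\<close>-th power still exceeds \<open>N\<close>.\<close>
      define N' where "N' = 1 + \<bar>N\<bar>"
      have "N' ^ 1 \<le> N' ^ d b" using de[OF b] by (intro power_increasing) (auto simp: N'_def)
      then have lt: "N - N' ^ d b < 0" by (simp add: N'_def)
      have "const_poly N' - \<zeta> b \<in> T"
      proof (rule ccontr)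
        assume "const_poly N' - \<zeta> b \<notin> T"
        then have "\<zeta> b - const_poly N' \<in> T" using total_diff by blast
        then have "\<zeta> b ^ d b - const_poly N' ^ d b \<in> T"
          by (intro T_power_mono T_const) (auto simp: N'_def)
        from T_trans[OF this bN] have "const_poly (N - N' ^ d b) \<in> T" by (simp add: \<kappa>_simps)
        then show False using const_neg_notin[OF lt] by simp
      qed
      moreover have "const_poly N' + \<zeta> b \<in> T" by (intro T_add T_const \<zeta>T) (simp add: N'_def)
      ultimately show ?thesis unfolding bounded_elem_def by blast
    qed
    then have \<Xi>b: "bounded_elem (\<Xi> b)" if "b \<in> B" for b
      unfolding \<Xi>\<zeta> using that by (intro bounded_elem_mult bounded_elem_const)
    have "coord i = (\<Sum>b\<in>B. const_poly (b $ i) * \<Xi> b)" for i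
    proof (rule eval_poly_ext)
      fix x
      have "x $ i = (\<Sum>b\<in>B. g b x *\<^sub>R b) $ i" by (simp add: expand)
      then show "eval_poly (coord i) x = eval_poly (\<Sum>b\<in>B. const_poly (b $ i) * \<Xi> b) x"
        by (simp add: ev sum_component mult.commute)
    qed
    then have "bounded_elem (coord i)" for i
      using \<Xi>b by (auto intro!: bounded_elem_sum bounded_elem_mult bounded_elem_const)
    then have "bounded_elem (\<Sum>i\<in>UNIV. coord i * coord i)" by (rule bounded_elem_all)
    then obtain M where "const_poly M - (\<Sum>i\<in>UNIV. coord i * coord i) \<in> T"
      unfolding bounded_elem_def by blast
    from T_trans[OF inf[of "M + 1"] this] have "const_poly (M - (M + 1)) \<in> T" by (simp only: \<kappa>_simps)
    then show False using const_neg_notin[of "- 1"] by simp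
  qed
  have E1: "E - 1 \<in> T" using Einf[of 1] by (simp add: \<kappa>_1)
  \<comment> \<open>For the maximal coordinate the value 1 is prescribed: it keeps the point of
    standard parts away from the origin.\<close>
  have "\<exists>s\<ge>0. approx E (\<zeta> b ^ d b) s \<and> (b = b0 \<longrightarrow> s = 1)" if "b \<in> B" for b
  proof (cases "b = b0")
    case True
    have "approx E E 1" by (auto simp: approx_def near_def \<kappa>_1 intro: T_scale E)
    then show ?thesis using True by (intro exI[of _ 1]) (simp add: E_def)
  next
    case False
    have "\<exists>s\<ge>0. approx E (\<zeta> b ^ d b) s"
      by (rule standard_part) (use \<zeta>T T_power b0(2)[OF that] E1 in \<open>auto simp: E_def\<close>)
    then show ?thesis using False by blast
  qed
  then obtain s where s: "\<And>b. b \<in> B \<Longrightarrow> s b \<ge> 0" "\<And>b. b \<in> B \<Longrightarrow> approx E (\<zeta> b ^ d b) (s b)" "s b0 = 1"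
    using b0(1) by metis
  define a where "a b = root (d b) (s b)" for b
  have a: "a b \<ge> 0" "a b ^ d b = s b" if "b \<in> B" for b
    using s(1)[OF that] de[OF that] by (auto simp: a_def)
  define w where "w k = (\<Sum>b\<in>B. e b * \<alpha> k b)" for k
  have mkT: "mk k \<in> T" for k unfolding mk_def by (intro T_prod T_power \<zeta>T)
  \<comment> \<open>In the \<open>K\<close>-th power each factor becomes
    (\<open>\<zeta> b ^ d b\<close>) raised to \<open>e b * \<alpha> k b\<close>, since K = d_b e_b,
    and so is comparable with an integral power of \<open>E\<close>.\<close>
  have mkK: "approx (E ^ w k) (mk k ^ K) ((\<Prod>b\<in>B. a b ^ \<alpha> k b) ^ K)" for k
  proof -
    have "approx (\<Prod>b\<in>B. E ^ (e b * \<alpha> k b)) (\<Prod>b\<in>B. (\<zeta> b ^ d b) ^ (e b * \<alpha> k b)) (\<Prod>b\<in>B. s b ^ (e b * \<alpha> k b))"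
      by (intro approx_prod approx_power s(2) T_power E)
    moreover have "(\<Prod>b\<in>B. E ^ (e b * \<alpha> k b)) = E ^ w k" by (simp add: w_def power_sum)
    moreover have "(\<Prod>b\<in>B. (\<zeta> b ^ d b) ^ (e b * \<alpha> k b)) = mk k ^ K"
      unfolding mk_def prod_power_distrib
    proof (rule prod.cong)
      fix b assume "b \<in> B"
      then have "K = d b * e b" using de by metis
      then show "(\<zeta> b ^ d b) ^ (e b * \<alpha> k b) = (\<zeta> b ^ \<alpha> k b) ^ K" by (simp add: mult_ac flip: power_mult)
    qed simp
    moreover have "(\<Prod>b\<in>B. s b ^ (e b * \<alpha> k b)) = (\<Prod>b\<in>B. a b ^ \<alpha> k b) ^ K"
      unfolding prod_power_distrib
    proof (rule prod.cong)
      fix b assume b: "b \<in> B"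
      then have "K = d b * e b" using de by metis
      then show "s b ^ (e b * \<alpha> k b) = (a b ^ \<alpha> k b) ^ K"
        by (simp add: a(2)[OF b, symmetric] mult_ac flip: power_mult)
    qed simp
    ultimately show ?thesis by metis
  qed
  have mka: "approx E (mk k) (if w k = K then \<Prod>b\<in>B. a b ^ \<alpha> k b else 0)" if k: "k < I" for k
  proof (cases "w k = K")
    case True
    have "approx E (mk k) (\<Prod>b\<in>B. a b ^ \<alpha> k b)"
      by (rule approx_root[OF _ B(5) mkT _ E1]) (use mkK[of k] a(1) True in \<open>auto intro: prod_nonneg\<close>)
    then show ?thesis using True by simp
  next
    case False
    then have "w k < K" using wt[OF k] by (simp add: w_def)
    from approx_lower[OF mkK this Einf] have "approx (E ^ K) (mk k ^ K) (0 ^ K)" using B(5) by (simp add: zero_power)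
    from approx_root[OF this B(5) mkT _ E1] show ?thesis using False by simp
  qed
  define Q where "Q = (\<Sum>k<I. r' k * (if w k = K then \<Prod>b\<in>B. a b ^ \<alpha> k b else 0))"
  have pQ: "approx E p Q"
    unfolding p Q_def by (intro approx_sum approx_scale mka E) auto
  \<comment> \<open>Here the positivity of the leading form is used, at the real point with
    coordinates \<open>\<sigma> b * a b\<close>.\<close>
  have "\<gamma> * 1 \<le> \<gamma> * (\<Sum>b\<in>B. s b)"
    using member_le_sum[OF b0(1), of s] s(1,3) B(1,4) by (intro mult_left_mono) auto
  also have "(\<Sum>b\<in>B. s b) = (\<Sum>b\<in>B. \<bar>\<sigma> b * a b\<bar> ^ d b)"
    using a by (intro sum.cong) (auto simp: abs_mult \<sigma>_def)
  also have "\<gamma> * \<dots> \<le> (\<Sum>k<I. if (\<Sum>b\<in>B. e b * \<alpha> k b) = K then r k * (\<Prod>b\<in>B. (\<sigma> b * a b) ^ \<alpha> k b) else 0)"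
    by (rule lead)
  also have "\<dots> = Q"
    unfolding Q_def by (rule sum.cong) (auto simp: r'_def w_def power_mult_distrib prod.distrib)
  finally have Q: "Q > 0" using B(4) by simp
  have "const_poly (Q/2) * E + (p - const_poly Q * E) \<in> T"
    using pQ Q by (simp add: approx_def near_def)
  moreover have "const_poly (Q/2) * E + (p - const_poly Q * E) = p - const_poly (Q/2) * E"
    by (rule eval_poly_ext) (simp add: field_simps)
  ultimately have 1: "p - const_poly (Q/2) * E \<in> T" by simp
  \<comment> \<open>The constant is chosen so that (Q/2) E \<ge> \<rho> + 1, which contradicts p
    \<le> \<rho>.\<close>
  have "const_poly (Q/2) * (E - const_poly (2 * (\<rho> + 1) / Q)) \<in> T"
    using Q Einf by (intro T_scale) auto
  moreover have "const_poly (Q/2) * (E - const_poly (2 * (\<rho> + 1) / Q)) = const_poly (Q/2) * E - const_poly (\<rho> + 1)"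
    by (rule eval_poly_ext) (use Q in \<open>simp add: field_simps\<close>)
  ultimately have "const_poly (Q/2) * E - const_poly (\<rho> + 1) \<in> T" by simp
  from T_trans[OF T_trans[OF this 1] \<rho>] have "const_poly (\<rho> - (\<rho> + 1)) \<in> T" by (simp only: \<kappa>_simps)
  then show False using const_neg_notin[of "- 1"] by simp
qed

end

text \<open>Write s for |x|^2. If adjoining some s - N produces -1, Woermann's trick bounds s.
  Otherwise all these extensions are proper. They increase with N, since s - N is s - N' plus the
  constant N' - N, so their union is a proper preordering; a total extension of it makes s infinite,
  where \<open>p\<close> cannot stay below \<rho>.\<close>

theorem archimedean_of_convex:
  fixes p :: "'n::finite rpoly"
  assumes "convex_polynomial (eval_poly p)" "preordering const_poly T" "const_poly \<rho> - p \<in> T"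
  shows "\<exists>N. const_poly N - (\<Sum>i\<in>UNIV. coord i * coord i) \<in> T"
proof -
  interpret preordering const_poly T by fact
  define s :: "'n rpoly" where "s = (\<Sum>i\<in>UNIV. coord i * coord i)"
  show ?thesis
  proof (cases "\<exists>N\<ge>0. - 1 \<in> adjoin (s - const_poly N)")
    case True
    then obtain N where "N \<ge> 0" "- 1 \<in> adjoin ((\<Sum>i\<in>UNIV. coord i * coord i) - const_poly N)" by (auto simp: s_def)
    from bounded_of_negative_one[OF _ this(2,1)] show ?thesis
      by (metis rpoly_preordering.bounded_elem_of_ball rpoly_preordering.intro)
  next
    case False
    define U where "U = (\<Union>N\<in>{0..}. adjoin (s - const_poly N))"
    have mono: "adjoin (s - const_poly N) \<subseteq> adjoin (s - const_poly N')" if "N \<le> N'" for N N'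
    proof
      fix x assume "x \<in> adjoin (s - const_poly N)"
      then obtain a b where ab: "a \<in> T" "b \<in> T" "x = a + (s - const_poly N) * b" unfolding adjoin_def by blast
      have "x = (a + const_poly (N' - N) * b) + (s - const_poly N') * b"
        by (simp add: ab(3) \<kappa>_simps algebra_simps)
      moreover have "a + const_poly (N' - N) * b \<in> T" using ab that by (intro T_add T_scale) auto
      ultimately show "x \<in> adjoin (s - const_poly N')" using ab(2) unfolding adjoin_def by blast
    qed
    have dir: "\<exists>N\<ge>0. x \<in> adjoin (s - const_poly N) \<and> y \<in> adjoin (s - const_poly N)" if "x \<in> U" "y \<in> U" for x y
    proof -
      obtain N N' where "N \<ge> 0" "N' \<ge> 0" "x \<in> adjoin (s - const_poly N)" "y \<in> adjoin (s - const_poly N')"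
        using \<open>x \<in> U\<close> \<open>y \<in> U\<close> unfolding U_def by auto
      then show ?thesis using mono[of N "max N N'"] mono[of N' "max N N'"] by (intro exI[of _ "max N N'"]) auto
    qed
    interpret U: preordering const_poly U
    proof
      fix x y assume "x \<in> U" "y \<in> U"
      then obtain N where N: "N \<ge> 0" "x \<in> adjoin (s - const_poly N)" "y \<in> adjoin (s - const_poly N)"
        using dir by blast
      interpret A: preordering const_poly "adjoin (s - const_poly N)" by (rule preordering_adjoin)
      show "x + y \<in> U" "x * y \<in> U"
        unfolding U_def using A.T_add[OF N(2,3)] A.T_mult[OF N(2,3)] N(1) by auto
    next
      show "x * x \<in> U" for x using T_square subset_adjoin[of "s - const_poly 0"] unfolding U_def by fastforce
    qed (rule const_poly_add const_poly_mult const_poly_1)+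
    have "- 1 \<notin> U" using False by (auto simp: U_def)
    then obtain P where P: "U \<subseteq> P" "preordering const_poly P" "- 1 \<notin> P" "\<And>x. x \<in> P \<or> - x \<in> P"
      using U.maximal_proper by blast
    interpret P: rpoly_total_preordering P
      using P by (simp add: rpoly_total_preordering_def rpoly_preordering_def total_preordering_def total_preordering_axioms_def)
    have "s - const_poly N \<in> P" for N
    proof -
      have "s - const_poly (max 0 N) \<in> U"
        unfolding U_def by (rule UN_I[of "max 0 N"]) (auto intro: self_in_adjoin)
      then have "s - const_poly (max 0 N) \<in> P" using P(1) by blast
      then have "s - const_poly (max 0 N) + const_poly (max 0 N - N) \<in> P"
        by (intro P.T_add P.T_const) auto
      then show ?thesis by (simp add: \<kappa>_simps)
    qed
    then have "const_poly \<rho> - p \<notin> P"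
      using P.convex_unbounded_at_infinite_points[OF assms(1)] unfolding s_def by blast
    moreover have "const_poly \<rho> - p \<in> U"
      unfolding U_def by (rule UN_I[of 0]) (use assms(3) subset_adjoin in auto)
    ultimately show ?thesis using P(1) by blast
  qed
qed

section \<open>Positive definite polynomial matrices\<close>

lemma linear_vec_expand:
  fixes f :: "real ^ 'n::finite \<Rightarrow> real"
  assumes "linear f" shows "f v = (\<Sum>i\<in>UNIV. v $ i * f (axis i 1))"
proof -
  have "f v = f (\<Sum>i\<in>UNIV. v $ i *\<^sub>R axis i 1)" by (simp add: basis_expansion flip: scalar_mult_eq_scaleR)
  then show ?thesis using assms by (simp add: linear_sum linear_cmul)
qed

lemma rpf_derivative:
  fixes q :: "real ^ 'n::finite \<Rightarrow> real"
  assumes "real_polynomial_function q"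
  shows "\<exists>D. (\<forall>i. real_polynomial_function (D i)) \<and>
    (\<forall>x. (q has_derivative (\<lambda>v. \<Sum>i\<in>UNIV. v $ i * D i x)) (at x))"
  using assms
proof (induction rule: real_polynomial_function.induct)
  case (linear f)
  have "(f has_derivative f) (at x)" for x by (rule bounded_linear_imp_has_derivative[OF linear])
  moreover have "f = (\<lambda>v. \<Sum>i\<in>UNIV. v $ i * f (axis i 1))"
    using linear_vec_expand[OF bounded_linear.linear[OF linear]] by blast
  ultimately have "(f has_derivative (\<lambda>v. \<Sum>i\<in>UNIV. v $ i * f (axis i 1))) (at x)" for x by simp
  then show ?case by (intro exI[of _ "\<lambda>i _. f (axis i 1)"]) (auto intro: real_polynomial_function.intros(2))
next
  case (const c)
  show ?case by (intro exI[of _ "\<lambda>i _. 0"]) (auto intro: real_polynomial_function.intros(2))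
next
  case (add f g)
  obtain D where D: "\<forall>i. real_polynomial_function (D i)"
    "\<forall>x. (f has_derivative (\<lambda>v. \<Sum>i\<in>UNIV. v $ i * D i x)) (at x)" using add.IH(1) by blast
  obtain E where E: "\<forall>i. real_polynomial_function (E i)"
    "\<forall>x. (g has_derivative (\<lambda>v. \<Sum>i\<in>UNIV. v $ i * E i x)) (at x)" using add.IH(2) by blast
  have "((\<lambda>x. f x + g x) has_derivative (\<lambda>v. \<Sum>i\<in>UNIV. v $ i * (D i x + E i x))) (at x)" for x
    using has_derivative_add[OF D(2)[rule_format] E(2)[rule_format], of x]
    by (simp add: distrib_left sum.distrib)
  then show ?case using D(1) E(1)
    by (intro exI[of _ "\<lambda>i x. D i x + E i x"]) (auto intro: real_polynomial_function.intros(3))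
next
  case (mult f g)
  obtain D where D: "\<forall>i. real_polynomial_function (D i)"
    "\<forall>x. (f has_derivative (\<lambda>v. \<Sum>i\<in>UNIV. v $ i * D i x)) (at x)" using mult.IH(1) by blast
  obtain E where E: "\<forall>i. real_polynomial_function (E i)"
    "\<forall>x. (g has_derivative (\<lambda>v. \<Sum>i\<in>UNIV. v $ i * E i x)) (at x)" using mult.IH(2) by blast
  have "((\<lambda>x. f x * g x) has_derivative (\<lambda>v. \<Sum>i\<in>UNIV. v $ i * (f x * E i x + D i x * g x))) (at x)" for x
    using has_derivative_mult[OF D(2)[rule_format] E(2)[rule_format], of x]
    by (simp add: distrib_left sum.distrib sum_distrib_left sum_distrib_right mult_ac)
  then show ?case using D(1) E(1) mult.hyps
    by (intro exI[of _ "\<lambda>i x. f x * E i x + D i x * g x"]) (auto intro!: real_polynomial_function.intros(3,4))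
qed

lemma DERIV_along_line:
  fixes q :: "real ^ 'n::finite \<Rightarrow> real"
  assumes "\<And>x. (q has_derivative (\<lambda>v. \<Sum>i\<in>UNIV. v $ i * D i x)) (at x)"
  shows "((\<lambda>t. q (x + t *\<^sub>R v)) has_real_derivative (\<Sum>i\<in>UNIV. v $ i * D i (x + t *\<^sub>R v))) (at t)"
proof -
  have "((\<lambda>t. x + t *\<^sub>R v) has_derivative (\<lambda>s. s *\<^sub>R v)) (at t)"
    by (auto intro!: derivative_eq_intros)
  from has_derivative_compose[OF this assms]
  have "((\<lambda>t. q (x + t *\<^sub>R v)) has_derivative (\<lambda>s. \<Sum>i\<in>UNIV. (s *\<^sub>R v) $ i * D i (x + t *\<^sub>R v))) (at t)" .
  also have "(\<lambda>s. \<Sum>i\<in>UNIV. (s *\<^sub>R v) $ i * D i (x + t *\<^sub>R v)) = (*) (\<Sum>i\<in>UNIV. v $ i * D i (x + t *\<^sub>R v))"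
    by (rule ext) (simp add: sum_distrib_left sum_distrib_right mult_ac)
  finally show ?thesis by (simp add: has_field_derivative_def)
qed

lemma partial_deriv_eq:
  assumes "\<And>x. (q has_derivative (\<lambda>v. \<Sum>i\<in>UNIV. v $ i * D i x)) (at x)"
  shows "partial_deriv i q x = D i x"
proof -
  have "((\<lambda>t. q (x + t *\<^sub>R axis i 1)) has_real_derivative
      (\<Sum>j\<in>UNIV. axis i 1 $ j * D j (x + 0 *\<^sub>R axis i 1))) (at 0)"
    by (rule DERIV_along_line[OF assms])
  also have "(\<Sum>j\<in>UNIV. axis i 1 $ j * D j (x + 0 *\<^sub>R axis i 1)) = (\<Sum>j\<in>UNIV. if j = i then D j x else 0)"
    by (rule sum.cong) (auto simp: axis_def)
  finally show ?thesis unfolding partial_deriv_def by (simp add: DERIV_imp_deriv)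
qed

text \<open>Adding the tangent inequalities at two points shows that the first derivative is
  increasing.\<close>

lemma convex_second_derivative_nonneg:
  fixes \<phi> :: "real \<Rightarrow> real"
  assumes "convex_on UNIV \<phi>" "\<And>t. (\<phi> has_real_derivative \<phi>' t) (at t)" "(\<phi>' has_real_derivative d) (at t)"
  shows "d \<ge> 0"
proof -
  have tangent: "\<phi> y - \<phi> x \<ge> \<phi>' x * (y - x)" for x y
    by (rule convex_on_imp_above_tangent[OF assms(1)]) (use assms(2) in auto)
  have "mono_on UNIV \<phi>'"
  proof (rule mono_onI)
    fix x y :: real assume "x \<le> y"
    have "0 \<le> (\<phi>' y - \<phi>' x) * (y - x)" using tangent[of x y] tangent[of y x] by (simp add: algebra_simps)
    then show "\<phi>' x \<le> \<phi>' y" using \<open>x \<le> y\<close> by (cases "x = y") (auto simp: zero_le_mult_iff)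
  qed
  from mono_on_imp_deriv_nonneg[OF this assms(3)] show ?thesis by simp
qed

lemma DERIV_sum_power:
  fixes a :: "nat \<Rightarrow> real"
  shows "((\<lambda>s. \<Sum>k\<le>M. a k * s ^ (k + 2) / ((real k + 1) * (real k + 2)))
    has_real_derivative (\<Sum>k\<le>M. a k * s ^ (k + 1) / (real k + 1))) (at s)"
    and "((\<lambda>s. \<Sum>k\<le>M. a k * s ^ (k + 1) / (real k + 1)) has_real_derivative (\<Sum>k\<le>M. a k * s ^ k)) (at s)"
proof -
  have "((\<lambda>s. a k * s ^ (k + 2) / ((real k + 1) * (real k + 2))) has_real_derivative a k * s ^ (k + 1) / (real k + 1)) (at s)"
    "((\<lambda>s. a k * s ^ (k + 1) / (real k + 1)) has_real_derivative a k * s ^ k) (at s)" for k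
  proof -
    have n: "real k + 1 \<noteq> 0" "real k + 2 \<noteq> 0" by auto
    have "((\<lambda>s. a k * s ^ (k + 2) / ((real k + 1) * (real k + 2))) has_real_derivative
        a k * (real (k + 2) * s ^ (k + 1)) / ((real k + 1) * (real k + 2))) (at s)"
      using DERIV_cdivide[OF DERIV_cmult[OF DERIV_pow[of "k + 2" s UNIV], of "a k"], of "(real k + 1) * (real k + 2)"]
      by simp
    also have "a k * (real (k + 2) * s ^ (k + 1)) / ((real k + 1) * (real k + 2)) = (a k * s ^ (k + 1)) * (real k + 2) / ((real k + 1) * (real k + 2))"
      by (simp only: of_nat_add of_nat_numeral mult_ac)
    also have "\<dots> = a k * s ^ (k + 1) / (real k + 1)" by (rule nonzero_mult_divide_mult_cancel_right[OF n(2)])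
    finally show "((\<lambda>s. a k * s ^ (k + 2) / ((real k + 1) * (real k + 2))) has_real_derivative a k * s ^ (k + 1) / (real k + 1)) (at s)" .
    have "((\<lambda>s. a k * s ^ (k + 1) / (real k + 1)) has_real_derivative a k * (real (k + 1) * s ^ k) / (real k + 1)) (at s)"
      using DERIV_cdivide[OF DERIV_cmult[OF DERIV_pow[of "k + 1" s UNIV], of "a k"], of "real k + 1"] by simp
    also have "a k * (real (k + 1) * s ^ k) / (real k + 1) = a k * s ^ k" using n by (simp add: field_simps)
    finally show "((\<lambda>s. a k * s ^ (k + 1) / (real k + 1)) has_real_derivative a k * s ^ k) (at s)" .
  qed
  then show "((\<lambda>s. \<Sum>k\<le>M. a k * s ^ (k + 2) / ((real k + 1) * (real k + 2)))
    has_real_derivative (\<Sum>k\<le>M. a k * s ^ (k + 1) / (real k + 1))) (at s)"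
    "((\<lambda>s. \<Sum>k\<le>M. a k * s ^ (k + 1) / (real k + 1)) has_real_derivative (\<Sum>k\<le>M. a k * s ^ k)) (at s)"
    by (intro DERIV_sum; blast)+
qed

text \<open>The sum is the integral of (1 - s) P(s) over [0,1] for P(s) = \<Sum> a_k s^k, because
  1/(k+1) - 1/(k+2) is the integral of (1 - s) s^k. It is evaluated by explicit antiderivatives: the
  first is positive on (0,1), as P is positive near 0 and never negative, and so the second
  increases.\<close>

lemma double_integral_pos:
  fixes a :: "nat \<Rightarrow> real"
  assumes "\<And>s. 0 \<le> s \<Longrightarrow> s \<le> 1 \<Longrightarrow> (\<Sum>k\<le>M. a k * s ^ k) \<ge> 0" "a 0 > 0"
  shows "(\<Sum>k\<le>M. a k / ((real k + 1) * (real k + 2))) > 0"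
proof -
  let ?P = "\<lambda>s. \<Sum>k\<le>M. a k * s ^ k"
  let ?P1 = "\<lambda>s. \<Sum>k\<le>M. a k * s ^ (k + 1) / (real k + 1)"
  let ?P2 = "\<lambda>s. \<Sum>k\<le>M. a k * s ^ (k + 2) / ((real k + 1) * (real k + 2))"
  have "?P 0 = (\<Sum>k\<le>M. if k = 0 then a 0 else 0)" by (rule sum.cong) auto
  then have "?P 0 > 0" using assms(2) by simp
  from DERIV_pos_inc_right[OF DERIV_sum_power(2) this]
  obtain d where d: "d > 0" "\<And>s. 0 < s \<Longrightarrow> s < d \<Longrightarrow> ?P1 0 < ?P1 s" by auto
  have P1: "?P1 s > 0" if s: "0 < s" "s < 1" for s
  proof -
    define e where "e = min s (d / 2)"
    have e: "0 < e" "e < d" "e \<le> s" using s d(1) by (auto simp: e_def)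
    have "?P1 e \<le> ?P1 s"
    proof (rule DERIV_nonneg_imp_nondecreasing[OF e(3), where f = ?P1])
      fix x assume "e \<le> x" "x \<le> s"
      then have "?P x \<ge> 0" using e(1) s by (intro assms(1)) auto
      then show "\<exists>y. (?P1 has_real_derivative y) (at x) \<and> 0 \<le> y" using DERIV_sum_power(2)[of a M x] by blast
    qed
    then show ?thesis using d(2)[OF e(1,2)] by simp
  qed
  have "?P2 0 < ?P2 1"
  proof (rule DERIV_pos_imp_increasing_open[where f = ?P2])
    show "\<exists>y. (?P2 has_real_derivative y) (at x) \<and> 0 < y" if "0 < x" "x < 1" for x
      using DERIV_sum_power(1) P1[OF that] by blast
    show "continuous_on {0..1} ?P2" by (intro continuous_intros) auto
  qed simp
  then show ?thesis by simp
qed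

lemma double_integral_eq:
  fixes a :: "nat \<Rightarrow> real"
  assumes "\<And>s. (\<phi> has_real_derivative \<phi>' s) (at s)" "\<And>s. (\<phi>' has_real_derivative (\<Sum>k\<le>M. a k * s ^ k)) (at s)"
    "\<phi> 0 = 0" "\<phi>' 0 = 0"
  shows "\<phi> 1 = (\<Sum>k\<le>M. a k / ((real k + 1) * (real k + 2)))"
proof -
  let ?P1 = "\<lambda>s. \<Sum>k\<le>M. a k * s ^ (k + 1) / (real k + 1)"
  let ?P2 = "\<lambda>s. \<Sum>k\<le>M. a k * s ^ (k + 2) / ((real k + 1) * (real k + 2))"
  have "((\<lambda>s. \<phi>' s - ?P1 s) has_real_derivative 0) (at s)" for s
    using DERIV_diff[OF assms(2) DERIV_sum_power(2)[of a M s]] by simp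
  from DERIV_isconst_all[OF allI[OF this], of _ 0] assms(4) have "\<phi>' s = ?P1 s" for s by simp
  then have "((\<lambda>s. \<phi> s - ?P2 s) has_real_derivative 0) (at s)" for s
    using DERIV_diff[OF assms(1) DERIV_sum_power(1)[of a M s]] by simp
  from DERIV_isconst_all[OF allI[OF this], of 1 0] assms(3) show ?thesis by simp
qed

text \<open>Lagrange's reduction: complete the square in the variable \<open>p\<close> and continue
  with the Schur complement \<open>a'\<close>. The complement is positive because its value at
  \<open>y\<close> is that of the full form when y_p is set to the minimizing value
  -\<open>\<beta> y / A\<close>. Symmetry is not assumed, hence the average in
  \<open>b\<close>.\<close>

lemma pd_form_sum_of_squares:
  fixes a :: "'i \<Rightarrow> 'i \<Rightarrow> real"
  assumes "finite S" "\<And>y. \<exists>i\<in>S. y i \<noteq> 0 \<Longrightarrow> (\<Sum>i\<in>S. \<Sum>j\<in>S. a i j * y i * y j) > 0"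
  shows "\<exists>n::nat. \<exists>l::nat \<Rightarrow> 'i \<Rightarrow> real. \<forall>y. (\<Sum>i\<in>S. \<Sum>j\<in>S. a i j * y i * y j) = (\<Sum>k<n. (\<Sum>i\<in>S. l k i * y i)\<^sup>2)"
  using assms
proof (induction S arbitrary: a rule: finite_induct)
  case empty
  show ?case by (intro exI[of _ 0]) auto
next
  case (insert p S)
  define A where "A = a p p"
  define b where "b j = (a p j + a j p) / 2" for j
  define a' where "a' i j = a i j - b i * b j / A" for i j
  define \<beta> where "\<beta> y = (\<Sum>j\<in>S. b j * y j)" for y :: "'i \<Rightarrow> real"
  have q: "(\<Sum>i\<in>insert p S. \<Sum>j\<in>insert p S. a i j * y i * y j) =
      A * (y p)\<^sup>2 + 2 * y p * \<beta> y + (\<Sum>i\<in>S. \<Sum>j\<in>S. a i j * y i * y j)" for y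
  proof -
    have "2 * y p * \<beta> y = (\<Sum>j\<in>S. a p j * y p * y j) + (\<Sum>i\<in>S. a i p * y i * y p)"
      unfolding \<beta>_def sum_distrib_left sum.distrib[symmetric]
      by (rule sum.cong) (auto simp: b_def field_simps)
    then show ?thesis using insert.hyps by (simp add: A_def sum.distrib power2_eq_square algebra_simps)
  qed
  have "(\<Sum>i\<in>insert p S. \<Sum>j\<in>insert p S. a i j * (if i = p then 1 else 0) * (if j = p then 1 else 0)) > 0"
    by (rule insert.prems[of "\<lambda>i. if i = p then 1 else 0"]) auto
  also have "(\<Sum>i\<in>insert p S. \<Sum>j\<in>insert p S. a i j * (if i = p then 1 else 0) * (if j = p then 1 else 0)) = A"
  proof -
    have "\<beta> (\<lambda>i. if i = p then 1 else 0) = 0"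
      unfolding \<beta>_def by (rule sum.neutral) (use insert.hyps in auto)
    moreover have "(\<Sum>i\<in>S. \<Sum>j\<in>S. a i j * (if i = p then 1 else 0) * (if j = p then 1 else 0)) = 0"
      by (intro sum.neutral ballI) (use insert.hyps in auto)
    ultimately show ?thesis unfolding q[of "\<lambda>i. if i = p then 1 else 0"] by simp
  qed
  finally have A: "A > 0" .
  have \<beta>2: "(\<Sum>i\<in>S. \<Sum>j\<in>S. b i * b j / A * y i * y j) = (\<beta> y)\<^sup>2 / A" for y
  proof -
    have *: "(\<beta> y)\<^sup>2 = (\<Sum>i\<in>S. \<Sum>j\<in>S. (b i * y i) * (b j * y j))"
      by (simp only: \<beta>_def power2_eq_square sum_product)
    show ?thesis unfolding * sum_divide_distrib by (intro sum.cong) (auto simp: mult_ac)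
  qed
  have q': "(\<Sum>i\<in>S. \<Sum>j\<in>S. a' i j * y i * y j) = (\<Sum>i\<in>S. \<Sum>j\<in>S. a i j * y i * y j) - (\<beta> y)\<^sup>2 / A" for y
    unfolding a'_def left_diff_distrib sum_subtractf \<beta>2 ..
  have sq: "A * (t + \<beta> y / A)\<^sup>2 = A * t\<^sup>2 + 2 * t * \<beta> y + (\<beta> y)\<^sup>2 / A" for t y
    using A by (simp add: power2_eq_square field_simps)
  have "\<exists>n::nat. \<exists>l::nat \<Rightarrow> 'i \<Rightarrow> real. \<forall>y. (\<Sum>i\<in>S. \<Sum>j\<in>S. a' i j * y i * y j) = (\<Sum>k<n. (\<Sum>i\<in>S. l k i * y i)\<^sup>2)"
  proof (rule insert.IH)
    fix y :: "'i \<Rightarrow> real" assume y: "\<exists>i\<in>S. y i \<noteq> 0"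
    define z where "z = y(p := - \<beta> y / A)"
    have zS: "z i = y i" if "i \<in> S" for i using that insert.hyps by (auto simp: z_def)
    have \<beta>z: "\<beta> z = \<beta> y" unfolding \<beta>_def by (rule sum.cong) (auto simp: zS)
    have qz: "(\<Sum>i\<in>S. \<Sum>j\<in>S. a i j * z i * z j) = (\<Sum>i\<in>S. \<Sum>j\<in>S. a i j * y i * y j)"
      by (intro sum.cong) (auto simp: zS)
    have "\<exists>i\<in>insert p S. z i \<noteq> 0" using y zS by force
    from insert.prems[OF this] have "0 < A * (z p)\<^sup>2 + 2 * z p * \<beta> y + (\<Sum>i\<in>S. \<Sum>j\<in>S. a i j * y i * y j)"
      unfolding q \<beta>z qz .
    moreover have "A * (z p)\<^sup>2 + 2 * z p * \<beta> y = - ((\<beta> y)\<^sup>2 / A)"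
      using sq[of "z p" y] A by (simp add: z_def)
    ultimately show "(\<Sum>i\<in>S. \<Sum>j\<in>S. a' i j * y i * y j) > 0" unfolding q' by simp
  qed
  then obtain n :: nat and l :: "nat \<Rightarrow> 'i \<Rightarrow> real" where l: "\<And>y. (\<Sum>i\<in>S. \<Sum>j\<in>S. a' i j * y i * y j) = (\<Sum>k<n. (\<Sum>i\<in>S. l k i * y i)\<^sup>2)" by blast
  define l' where "l' k i = (if k < n then (if i = p then 0 else l k i) else sqrt A * (if i = p then 1 else b i / A))" for k i
  have "(\<Sum>i\<in>insert p S. \<Sum>j\<in>insert p S. a i j * y i * y j) = (\<Sum>k<Suc n. (\<Sum>i\<in>insert p S. l' k i * y i)\<^sup>2)" for y
  proof -
    have 1: "(\<Sum>i\<in>insert p S. l' k i * y i) = (\<Sum>i\<in>S. l k i * y i)" if "k < n" for k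
      using insert.hyps that by (auto simp: l'_def intro!: sum.cong)
    have "(\<Sum>i\<in>insert p S. l' n i * y i) = sqrt A * y p + (\<Sum>i\<in>S. sqrt A * (b i / A) * y i)"
      using insert.hyps by (auto simp: l'_def intro!: sum.cong)
    also have "\<dots> = sqrt A * (y p + \<beta> y / A)"
      by (simp add: \<beta>_def sum_distrib_left sum_divide_distrib distrib_left mult_ac)
    finally have "(\<Sum>i\<in>insert p S. l' n i * y i)\<^sup>2 = A * (y p + \<beta> y / A)\<^sup>2"
      using A by (simp add: power_mult_distrib)
    then have "(\<Sum>k<Suc n. (\<Sum>i\<in>insert p S. l' k i * y i)\<^sup>2) = (\<Sum>k<n. (\<Sum>i\<in>S. l k i * y i)\<^sup>2) + A * (y p + \<beta> y / A)\<^sup>2"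
      using 1 by simp
    then show ?thesis unfolding q l[symmetric] q' sq by simp
  qed
  then show ?case by blast
qed

section \<open>Bernstein coefficients of a monomial\<close>

definition falling_ratio :: "nat \<Rightarrow> nat \<Rightarrow> nat \<Rightarrow> real" where
  "falling_ratio b a d = real (a choose b) / real (d choose b)"

text \<open>Expand y^b (y + (1 - y))^(d - b) by the binomial theorem. The ratio comes from C(d,a)
  C(a,b) = C(d,b) C(d-b,a-b); it is the quotient of falling factorials a(a-1)...(a-b+1) /
  (d(d-1)...(d-b+1)).\<close>

lemma bernstein_monomial:
  assumes "b \<le> d"
  shows "y ^ b = (\<Sum>a\<le>d. falling_ratio b a d * (real (d choose a) * y ^ a * (1 - y) ^ (d - a)))"
proof -
  have "(\<Sum>a\<le>d. falling_ratio b a d * (real (d choose a) * y ^ a * (1 - y) ^ (d - a)))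
      = (\<Sum>a\<in>{b..d}. real ((d - b) choose (a - b)) * y ^ a * (1 - y) ^ (d - a))"
  proof (rule sum.mono_neutral_cong_right)
    fix a assume a: "a \<in> {b..d}"
    have "real (d choose a) * real (a choose b) = real (d choose b) * real ((d - b) choose (a - b))"
      using choose_mult[of b a d] a by (simp flip: of_nat_mult)
    then have "falling_ratio b a d * real (d choose a) = real ((d - b) choose (a - b))"
      using assms by (simp add: falling_ratio_def field_simps)
    then show "falling_ratio b a d * (real (d choose a) * y ^ a * (1 - y) ^ (d - a)) =
        real ((d - b) choose (a - b)) * y ^ a * (1 - y) ^ (d - a)" by (simp add: mult.assoc[symmetric])
  qed (auto simp: falling_ratio_def)
  also have "\<dots> = (\<Sum>a\<le>d - b. real ((d - b) choose a) * y ^ (a + b) * (1 - y) ^ (d - b - a))"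
    using assms by (intro sum.reindex_bij_witness[of _ "\<lambda>a. a + b" "\<lambda>a. a - b"]) auto
  also have "\<dots> = y ^ b * (\<Sum>a\<le>d - b. real ((d - b) choose a) * y ^ a * (1 - y) ^ (d - b - a))"
    by (simp add: sum_distrib_left power_add mult_ac)
  also have "\<dots> = y ^ b" using binomial_ring[of y "1 - y" "d - b"] by simp
  finally show ?thesis by simp
qed

lemma falling_ratio_le_1: "a \<le> d \<Longrightarrow> \<bar>falling_ratio b a d\<bar> \<le> 1"
  unfolding falling_ratio_def using binomial_right_mono[of a d b] 
  by (cases "d choose b = 0") (auto simp: field_simps binomial_eq_0)

text \<open>Passing from b to b + 1 multiplies the ratio by (a - b)/(d - b), which differs from a/d
  by at most b/(d - b), uniformly in a. All factors involved in the error estimate are bounded by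
  1.\<close>

lemma falling_ratio_converges:
  assumes "\<epsilon> > 0"
  shows "\<forall>\<^sub>F d in sequentially. \<forall>a\<le>d. \<bar>falling_ratio b a d - (real a / real d) ^ b\<bar> \<le> \<epsilon>"
  using assms
proof (induction b arbitrary: \<epsilon>)
  case 0
  then show ?case by (simp add: falling_ratio_def)
next
  case (Suc b)
  have "\<forall>\<^sub>F d in sequentially. \<forall>a\<le>d. \<bar>falling_ratio b a d - (real a / real d) ^ b\<bar> \<le> \<epsilon> / 2"
    by (rule Suc.IH) (use Suc.prems in simp)
  \<comment> \<open>This threshold is what makes b/(d - b) at most \<epsilon>/2.\<close>
  moreover have "\<forall>\<^sub>F d in sequentially. real d > real b + 2 * real b / \<epsilon>"
    using filterlim_real_sequentially by (auto simp: filterlim_at_top_dense)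
  moreover have "\<forall>\<^sub>F d in sequentially. d > b" by (rule eventually_gt_at_top)
  ultimately show ?case
  proof eventually_elim
    case (elim d)
    have pos: "real d - real b > 0" using elim(3) by simp
    show ?case
    proof (intro allI impI)
      fix a assume a: "a \<le> d"
      let ?x = "real a / real d" and ?u = "(real a - real b) / (real d - real b)" and ?r = "falling_ratio b a d"
      have c: "real (Suc b) * real (k choose Suc b) = (real k - real b) * real (k choose b)" for k
        using gbinomial_mult_1[of "real k" b] by (simp add: binomial_gbinomial algebra_simps)
      have "falling_ratio (Suc b) a d = (real (Suc b) * real (a choose Suc b)) / (real (Suc b) * real (d choose Suc b))"
        unfolding falling_ratio_def by (subst mult_divide_mult_cancel_left) auto
      also have "\<dots> = ?r * ?u" unfolding c falling_ratio_def by (simp add: mult.commute)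
      finally have r: "falling_ratio (Suc b) a d = ?r * ?u" .
      have d: "real d > 0" using elim(3) by simp
      have "\<bar>?u - ?x\<bar> \<le> \<epsilon> / 2"
      proof -
        have "?x - ?u = real b / (real d - real b) * ((real d - real a) / real d)"
          using pos d by (simp add: field_simps)
        moreover have "0 \<le> (real d - real a) / real d" "(real d - real a) / real d \<le> 1" using a d by auto
        moreover have "0 \<le> real b / (real d - real b)" using pos by simp
        ultimately have "\<bar>?x - ?u\<bar> \<le> real b / (real d - real b)"
          by (simp only: abs_mult abs_of_nonneg mult_left_le)
        then have "\<bar>?u - ?x\<bar> \<le> real b / (real d - real b)" by (simp only: abs_minus_commute)
        also have "\<dots> \<le> \<epsilon> / 2" using elim(2) pos Suc.prems by (simp add: field_simps)
        finally show ?thesis .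
      qed
      moreover have "\<bar>?r\<bar> \<le> 1" by (rule falling_ratio_le_1[OF a])
      moreover have "\<bar>?x\<bar> \<le> 1" using a d by simp
      moreover have "\<bar>?r - ?x ^ b\<bar> \<le> \<epsilon> / 2" using elim(1) a by simp
      ultimately have "\<bar>?r\<bar> * \<bar>?u - ?x\<bar> \<le> 1 * (\<epsilon> / 2)" "\<bar>?x\<bar> * \<bar>?r - ?x ^ b\<bar> \<le> 1 * (\<epsilon> / 2)"
        by (intro mult_mono; simp)+
      moreover have "falling_ratio (Suc b) a d - ?x ^ Suc b = ?r * (?u - ?x) + ?x * (?r - ?x ^ b)"
        unfolding r by (simp add: algebra_simps)
      ultimately show "\<bar>falling_ratio (Suc b) a d - ?x ^ Suc b\<bar> \<le> \<epsilon>"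
        using abs_triangle_ineq[of "?r * (?u - ?x)" "?x * (?r - ?x ^ b)"] by (simp only: abs_mult)
    qed
  qed
qed

text \<open>
  Taylor's formula with integral remainder: \<open>F\<close> is the average of the Hessian along the segment
  from the minimizer \<open>0\<close>, so it is positive definite everywhere although the Hessian is only known
  to be so at \<open>0\<close>.
\<close>

lemma convex_quadratic_representation:
  fixes h :: "real ^ 'n::finite \<Rightarrow> real"
  assumes rpf: "real_polynomial_function h" and conv: "convex_on UNIV h"
    and h0: "h 0 = 0" and nonneg: "\<And>x. h x \<ge> 0"
    and pd: "pos_definite (hessian h 0)"
  obtains F where "\<And>i j. real_polynomial_function (F i j)"
    "\<And>x. h x = (\<Sum>i\<in>UNIV. \<Sum>j\<in>UNIV. F i j x * x $ i * x $ j)"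
    "\<And>x v. v \<noteq> 0 \<Longrightarrow> 0 < (\<Sum>i\<in>UNIV. \<Sum>j\<in>UNIV. F i j x * v $ i * v $ j)"
proof -
  obtain D where D: "\<forall>i. real_polynomial_function (D i)"
    "\<forall>x. (h has_derivative (\<lambda>v. \<Sum>i\<in>UNIV. v $ i * D i x)) (at x)"
    using rpf_derivative[OF rpf] by blast
  have "\<forall>j. \<exists>H. (\<forall>i. real_polynomial_function (H i)) \<and>
    (\<forall>x. (D j has_derivative (\<lambda>v. \<Sum>i\<in>UNIV. v $ i * H i x)) (at x))"
    using rpf_derivative D(1) by blast
  from choice[OF this] obtain H where H: "\<And>j i. real_polynomial_function (H j i)"
    "\<And>j x. (D j has_derivative (\<lambda>v. \<Sum>i\<in>UNIV. v $ i * H j i x)) (at x)" by blast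
  have hess: "hessian h x $ i $ j = H j i x" for x i j
  proof -
    have "partial_deriv j h = D j" using partial_deriv_eq[of h D] D(2) by blast
    then show ?thesis using partial_deriv_eq[of "D j" "H j"] H(2) by (simp add: hessian_def)
  qed
  have d1: "((\<lambda>t. h (x + t *\<^sub>R v)) has_real_derivative (\<Sum>j\<in>UNIV. v $ j * D j (x + t *\<^sub>R v))) (at t)" for x v t
    by (rule DERIV_along_line) (use D(2) in blast)
  have d2: "((\<lambda>t. \<Sum>j\<in>UNIV. v $ j * D j (x + t *\<^sub>R v)) has_real_derivative
      (\<Sum>j\<in>UNIV. v $ j * (\<Sum>i\<in>UNIV. v $ i * H j i (x + t *\<^sub>R v)))) (at t)" for x v t
    by (intro DERIV_sum DERIV_cmult DERIV_along_line H(2))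
  have H_nonneg: "(\<Sum>j\<in>UNIV. v $ j * (\<Sum>i\<in>UNIV. v $ i * H j i x)) \<ge> 0" for x v
  proof -
    have "convex_on UNIV (\<lambda>t. h (x + t *\<^sub>R v))"
    proof (rule convex_onI)
      fix t a b :: real assume "0 < t" "t < 1"
      have "x + ((1 - t) *\<^sub>R a + t *\<^sub>R b) *\<^sub>R v = (1 - t) *\<^sub>R (x + a *\<^sub>R v) + t *\<^sub>R (x + b *\<^sub>R v)"
        by (simp add: algebra_simps)
      then show "h (x + ((1 - t) *\<^sub>R a + t *\<^sub>R b) *\<^sub>R v) \<le> (1 - t) * h (x + a *\<^sub>R v) + t * h (x + b *\<^sub>R v)"
        using convex_onD[OF conv, of t "x + a *\<^sub>R v" "x + b *\<^sub>R v"] \<open>0 < t\<close> \<open>t < 1\<close> by simp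
    qed simp
    from convex_second_derivative_nonneg[OF this d1 d2, of 0] show ?thesis by simp
  qed
  have H_pos: "(\<Sum>j\<in>UNIV. v $ j * (\<Sum>i\<in>UNIV. v $ i * H j i 0)) > 0" if "v \<noteq> 0" for v
  proof -
    have "0 < v \<bullet> (hessian h 0 *v v)" using pd that by (simp add: pos_definite_def)
    also have "\<dots> = (\<Sum>i\<in>UNIV. \<Sum>j\<in>UNIV. v $ i * (H j i 0 * v $ j))"
      by (simp add: inner_vec_def matrix_vector_mult_def hess sum_distrib_left)
    also have "\<dots> = (\<Sum>j\<in>UNIV. \<Sum>i\<in>UNIV. v $ i * (H j i 0 * v $ j))" by (rule sum.swap)
    finally show ?thesis by (simp add: sum_distrib_left mult_ac)
  qed
  have "\<forall>p. \<exists>mc. (\<forall>k. real_polynomial_function (snd mc k)) \<and> (\<forall>k>fst mc. \<forall>x. snd mc k x = 0) \<and>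
    (\<forall>t x. H (fst p) (snd p) (t *\<^sub>R x) = (\<Sum>k\<le>fst mc. snd mc k x * t ^ k))"
  proof
    fix p
    obtain n d where "(\<forall>k. real_polynomial_function (d k)) \<and> (\<forall>k>n. \<forall>x. d k x = 0) \<and>
      (\<forall>t x. H (fst p) (snd p) (t *\<^sub>R x) = (\<Sum>k\<le>n. d k x * t ^ k))"
      using rpf_homogeneous_components[OF H(1)[of "fst p" "snd p"]] by blast
    then show "\<exists>mc. (\<forall>k. real_polynomial_function (snd mc k)) \<and> (\<forall>k>fst mc. \<forall>x. snd mc k x = 0) \<and>
      (\<forall>t x. H (fst p) (snd p) (t *\<^sub>R x) = (\<Sum>k\<le>fst mc. snd mc k x * t ^ k))"
      by (intro exI[of _ "(n, d)"]) auto
  qed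
  from choice[OF this] obtain mc where mc: "\<And>p k. real_polynomial_function (snd (mc p) k)"
    "\<And>p k x. k > fst (mc p) \<Longrightarrow> snd (mc p) k x = 0"
    "\<And>p t x. H (fst p) (snd p) (t *\<^sub>R x) = (\<Sum>k\<le>fst (mc p). snd (mc p) k x * t ^ k)" by blast
  define M where "M = Max (range (\<lambda>p::'n \<times> 'n. fst (mc p)))"
  define C where "C j i = snd (mc (j, i))" for j i
  have C: "real_polynomial_function (C j i k)" for j i k by (simp add: C_def mc(1))
  have HC: "H j i (t *\<^sub>R x) = (\<Sum>k\<le>M. C j i k x * t ^ k)" for j i t x
  proof -
    have "fst (mc (j, i)) \<le> M" unfolding M_def by (rule Max_ge) auto
    then have "(\<Sum>k\<le>fst (mc (j, i)). C j i k x * t ^ k) = (\<Sum>k\<le>M. C j i k x * t ^ k)"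
      by (intro sum.mono_neutral_left) (auto simp: C_def mc(2))
    then show ?thesis using mc(3)[of "(j, i)"] by (simp add: C_def)
  qed
  define a where "a v x k = (\<Sum>j\<in>UNIV. v $ j * (\<Sum>i\<in>UNIV. v $ i * C j i k x))" for v x k
  have a: "(\<Sum>j\<in>UNIV. v $ j * (\<Sum>i\<in>UNIV. v $ i * H j i (t *\<^sub>R x))) = (\<Sum>k\<le>M. a v x k * t ^ k)" for v x t
  proof -
    have "(\<Sum>j\<in>UNIV. v $ j * (\<Sum>i\<in>UNIV. v $ i * H j i (t *\<^sub>R x)))
      = (\<Sum>j\<in>UNIV. \<Sum>i\<in>UNIV. \<Sum>k\<le>M. v $ j * (v $ i * (C j i k x * t ^ k)))"
      by (simp add: HC sum_distrib_left)
    also have "\<dots> = (\<Sum>j\<in>UNIV. \<Sum>k\<le>M. \<Sum>i\<in>UNIV. v $ j * (v $ i * (C j i k x * t ^ k)))"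
      by (intro sum.cong sum.swap refl)
    also have "\<dots> = (\<Sum>k\<le>M. \<Sum>j\<in>UNIV. \<Sum>i\<in>UNIV. v $ j * (v $ i * (C j i k x * t ^ k)))"
      by (rule sum.swap)
    also have "\<dots> = (\<Sum>k\<le>M. a v x k * t ^ k)"
      by (simp add: a_def sum_distrib_left sum_distrib_right mult_ac)
    finally show ?thesis .
  qed
  \<comment> \<open>The integral of (1 - t) \<open>H j i (t *\<^sub>R x)\<close> over t in [0,1],
    computed term by term so that it is visibly a polynomial in \<open>x\<close>.\<close>
  define F where "F i j x = (\<Sum>k\<le>M. C j i k x / ((real k + 1) * (real k + 2)))" for i j x
  have Fa: "(\<Sum>i\<in>UNIV. \<Sum>j\<in>UNIV. F i j x * v $ i * v $ j) = (\<Sum>k\<le>M. a v x k / ((real k + 1) * (real k + 2)))" for x v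
  proof -
    have "(\<Sum>i\<in>UNIV. \<Sum>j\<in>UNIV. F i j x * v $ i * v $ j) = (\<Sum>j\<in>UNIV. \<Sum>i\<in>UNIV. F i j x * v $ i * v $ j)"
      by (rule sum.swap)
    also have "\<dots> = (\<Sum>j\<in>UNIV. \<Sum>i\<in>UNIV. \<Sum>k\<le>M. v $ j * (v $ i * C j i k x) / ((real k + 1) * (real k + 2)))"
      by (simp add: F_def sum_distrib_right sum_distrib_left mult_ac)
    also have "\<dots> = (\<Sum>j\<in>UNIV. \<Sum>k\<le>M. \<Sum>i\<in>UNIV. v $ j * (v $ i * C j i k x) / ((real k + 1) * (real k + 2)))"
      by (intro sum.cong sum.swap refl)
    also have "\<dots> = (\<Sum>k\<le>M. \<Sum>j\<in>UNIV. \<Sum>i\<in>UNIV. v $ j * (v $ i * C j i k x) / ((real k + 1) * (real k + 2)))"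
      by (rule sum.swap)
    also have "\<dots> = (\<Sum>k\<le>M. a v x k / ((real k + 1) * (real k + 2)))"
      by (simp add: a_def sum_divide_distrib sum_distrib_left)
    finally show ?thesis .
  qed
  show ?thesis
  proof (rule that)
    show "real_polynomial_function (F i j)" for i j
      unfolding F_def by (intro real_polynomial_function_sum real_polynomial_function_divide C) auto
    show "h x = (\<Sum>i\<in>UNIV. \<Sum>j\<in>UNIV. F i j x * x $ i * x $ j)" for x
    proof -
      have e1: "((\<lambda>t. h (t *\<^sub>R x)) has_real_derivative (\<Sum>j\<in>UNIV. x $ j * D j (t *\<^sub>R x))) (at t)" for t
        using d1[of 0 x t] by simp
      have e2: "((\<lambda>t. \<Sum>j\<in>UNIV. x $ j * D j (t *\<^sub>R x)) has_real_derivative (\<Sum>k\<le>M. a x x k * t ^ k)) (at t)" for t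
        using d2[of x 0 t] unfolding a[symmetric] by simp
      \<comment> \<open>The origin is a minimizer, so the first-order Taylor term vanishes.\<close>
      have "(\<Sum>j\<in>UNIV. x $ j * D j (0 *\<^sub>R x)) = 0"
        by (rule DERIV_local_min[OF e1[of 0], of 1]) (use h0 nonneg in auto)
      from double_integral_eq[OF e1 e2 _ this] h0 show ?thesis unfolding Fa by simp
    qed
    show "0 < (\<Sum>i\<in>UNIV. \<Sum>j\<in>UNIV. F i j x * v $ i * v $ j)" if "v \<noteq> 0" for x v
      unfolding Fa
    proof (rule double_integral_pos)
      show "0 \<le> (\<Sum>k\<le>M. a v x k * s ^ k)" for s unfolding a[symmetric] by (rule H_nonneg)
      have "(\<Sum>k\<le>M. a v x k * 0 ^ k) = (\<Sum>k\<le>M. if k = 0 then a v x 0 else 0)" by (rule sum.cong) auto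
      then show "0 < a v x 0" using H_pos[OF that] a[of v 0 x] by simp
    qed
  qed
qed

section \<open>Bernstein expansion on a box\<close>

definition bernstein_coeff :: "'n::finite rpoly \<Rightarrow> nat \<Rightarrow> ('n \<Rightarrow> nat) \<Rightarrow> real" where
  "bernstein_coeff q d \<alpha> = (\<Sum>e\<in>Poly_Mapping.keys q. Poly_Mapping.lookup q e *
     (\<Prod>l\<in>UNIV. falling_ratio (Poly_Mapping.lookup e l) (\<alpha> l) d))"

definition bernstein_basis :: "nat \<Rightarrow> ('n::finite \<Rightarrow> nat) \<Rightarrow> real ^ 'n \<Rightarrow> real" where
  "bernstein_basis d \<alpha> y = (\<Prod>l\<in>UNIV. real (d choose \<alpha> l) * (y $ l) ^ \<alpha> l * (1 - y $ l) ^ (d - \<alpha> l))"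

lemma bernstein_expansion:
  fixes q :: "'n::finite rpoly"
  assumes "\<And>e l. e \<in> Poly_Mapping.keys q \<Longrightarrow> Poly_Mapping.lookup e l \<le> d"
  shows "eval_poly q y = (\<Sum>\<alpha>\<in>Pi\<^sub>E UNIV (\<lambda>_. {..d}). bernstein_coeff q d \<alpha> * bernstein_basis d \<alpha> y)"
proof -
  have "eval_poly q y = (\<Sum>e\<in>Poly_Mapping.keys q. Poly_Mapping.lookup q e *
      (\<Prod>l\<in>UNIV. \<Sum>a\<le>d. falling_ratio (Poly_Mapping.lookup e l) a d * (real (d choose a) * (y $ l) ^ a * (1 - y $ l) ^ (d - a))))"
    unfolding eval_poly_def
  proof (rule sum.cong)
    fix e assume "e \<in> Poly_Mapping.keys q"
    then have "(\<Prod>l\<in>UNIV. y $ l ^ Poly_Mapping.lookup e l) = (\<Prod>l\<in>UNIV. \<Sum>a\<le>d.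
        falling_ratio (Poly_Mapping.lookup e l) a d * (real (d choose a) * (y $ l) ^ a * (1 - y $ l) ^ (d - a)))"
      using assms by (intro prod.cong bernstein_monomial) auto
    then show "Poly_Mapping.lookup q e * (\<Prod>l\<in>UNIV. y $ l ^ Poly_Mapping.lookup e l) = Poly_Mapping.lookup q e *
      (\<Prod>l\<in>UNIV. \<Sum>a\<le>d. falling_ratio (Poly_Mapping.lookup e l) a d * (real (d choose a) * (y $ l) ^ a * (1 - y $ l) ^ (d - a)))"
      by simp
  qed simp
  also have "\<dots> = (\<Sum>e\<in>Poly_Mapping.keys q. \<Sum>\<alpha>\<in>Pi\<^sub>E UNIV (\<lambda>_. {..d}). Poly_Mapping.lookup q e *
      (\<Prod>l\<in>UNIV. falling_ratio (Poly_Mapping.lookup e l) (\<alpha> l) d) * bernstein_basis d \<alpha> y)"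
    by (subst prod_sum_PiE) (auto simp: bernstein_basis_def prod.distrib sum_distrib_left mult.assoc)
  also have "\<dots> = (\<Sum>\<alpha>\<in>Pi\<^sub>E UNIV (\<lambda>_. {..d}). bernstein_coeff q d \<alpha> * bernstein_basis d \<alpha> y)"
    by (subst sum.swap) (simp add: bernstein_coeff_def sum_distrib_right)
  finally show ?thesis .
qed

text \<open>The coefficient and the value at the grid point \<alpha>/d are the same expression with
  ratios in place of powers. All factors are bounded by 1, so two products differ by at most the sum
  of the differences of their factors.\<close>

lemma bernstein_coeff_converges:
  fixes q :: "'n::finite rpoly"
  assumes "\<epsilon> > 0"
  shows "\<forall>\<^sub>F d in sequentially. \<forall>\<alpha>. (\<forall>l. \<alpha> l \<le> d) \<longrightarrow>
    \<bar>bernstein_coeff q d \<alpha> - eval_poly q (\<chi> l. real (\<alpha> l) / real d)\<bar> \<le> \<epsilon>"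
proof -
  define S where "S = (\<Sum>e\<in>Poly_Mapping.keys q. \<bar>Poly_Mapping.lookup q e\<bar>)"
  have S: "S \<ge> 0" by (simp add: S_def sum_nonneg)
  define N where "N = real CARD('n)"
  have N: "N > 0" by (simp add: N_def)
  \<comment> \<open>Each of the \<open>N\<close> factors contributes \<delta>, weighted by the total
    coefficient size \<open>S\<close>; S + 1 keeps the denominator positive for the zero
    polynomial.\<close>
  define \<delta> where "\<delta> = \<epsilon> / (N * (S + 1))"
  have \<delta>: "\<delta> > 0" using assms S N by (simp add: \<delta>_def)
  have "\<forall>\<^sub>F d in sequentially. \<forall>b\<in>(\<Union>e\<in>Poly_Mapping.keys q. range (Poly_Mapping.lookup e)).
      \<forall>a\<le>d. \<bar>falling_ratio b a d - (real a / real d) ^ b\<bar> \<le> \<delta>"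
    by (rule eventually_ball_finite) (use falling_ratio_converges[OF \<delta>] in auto)
  then show ?thesis
  proof eventually_elim
    case (elim d)
    show ?case
    proof (intro allI impI)
      fix \<alpha> :: "'n \<Rightarrow> nat" assume \<alpha>: "\<forall>l. \<alpha> l \<le> d"
      have "\<bar>bernstein_coeff q d \<alpha> - eval_poly q (\<chi> l. real (\<alpha> l) / real d)\<bar> =
        \<bar>\<Sum>e\<in>Poly_Mapping.keys q. Poly_Mapping.lookup q e * ((\<Prod>l\<in>UNIV. falling_ratio (Poly_Mapping.lookup e l) (\<alpha> l) d)
          - (\<Prod>l\<in>UNIV. (real (\<alpha> l) / real d) ^ Poly_Mapping.lookup e l))\<bar>"
        by (simp add: bernstein_coeff_def eval_poly_def sum_subtractf right_diff_distrib)
      also have "\<dots> \<le> (\<Sum>e\<in>Poly_Mapping.keys q. \<bar>Poly_Mapping.lookup q e\<bar> * (N * \<delta>))"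
      proof (rule order_trans[OF sum_abs], rule sum_mono)
        fix e assume e: "e \<in> Poly_Mapping.keys q"
        have "norm ((\<Prod>l\<in>UNIV. falling_ratio (Poly_Mapping.lookup e l) (\<alpha> l) d)
          - (\<Prod>l\<in>UNIV. (real (\<alpha> l) / real d) ^ Poly_Mapping.lookup e l)) \<le>
          (\<Sum>l\<in>UNIV. norm (falling_ratio (Poly_Mapping.lookup e l) (\<alpha> l) d - (real (\<alpha> l) / real d) ^ Poly_Mapping.lookup e l))"
        proof (rule norm_prod_diff)
          fix l :: 'n
          show "norm (falling_ratio (Poly_Mapping.lookup e l) (\<alpha> l) d) \<le> 1"
            using falling_ratio_le_1 \<alpha> by simp
          have "real (\<alpha> l) / real d \<le> 1" using \<alpha>[rule_format, of l] by (cases "d = 0") auto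
          then show "norm ((real (\<alpha> l) / real d) ^ Poly_Mapping.lookup e l) \<le> 1"
            by (simp add: norm_power power_le_one del: norm_divide)
        qed
        also have "\<dots> \<le> (\<Sum>l::'n\<in>UNIV. \<delta>)"
          using elim e \<alpha> by (intro sum_mono) auto
        finally show "\<bar>Poly_Mapping.lookup q e * ((\<Prod>l\<in>UNIV. falling_ratio (Poly_Mapping.lookup e l) (\<alpha> l) d)
          - (\<Prod>l\<in>UNIV. (real (\<alpha> l) / real d) ^ Poly_Mapping.lookup e l))\<bar> \<le> \<bar>Poly_Mapping.lookup q e\<bar> * (N * \<delta>)"
          unfolding abs_mult by (intro mult_left_mono) (auto simp: N_def)
      qed
      also have "\<dots> = S * (N * \<delta>)" by (simp add: S_def sum_distrib_right)
      also have "\<dots> \<le> (S + 1) * (N * \<delta>)" using S N \<delta> by (intro mult_right_mono) auto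
      also have "\<dots> = \<epsilon>" using S N by (simp add: \<delta>_def)
      finally show "\<bar>bernstein_coeff q d \<alpha> - eval_poly q (\<chi> l. real (\<alpha> l) / real d)\<bar> \<le> \<epsilon>" .
    qed
  qed
qed

lemma continuous_on_eval_poly [continuous_intros]:
  assumes "continuous_on S f" shows "continuous_on S (\<lambda>x. eval_poly p (f x))"
proof -
  have "continuous_on UNIV (eval_poly p)"
    using rpf_eval_poly continuous_on_polymonial_function real_polynomial_function_eq by blast
  then show ?thesis using continuous_on_compose2[OF _ assms] by blast
qed

lemma uniformly_pos_definite:
  fixes q :: "'n::finite \<Rightarrow> 'n \<Rightarrow> 'n rpoly"
  assumes "\<And>y v. v \<noteq> 0 \<Longrightarrow> 0 < (\<Sum>i\<in>UNIV. \<Sum>j\<in>UNIV. eval_poly (q i j) y * v $ i * v $ j)" and "compact S"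
  obtains \<delta> where "\<delta> > 0"
    "\<And>y v. y \<in> S \<Longrightarrow> \<delta> * (norm v)\<^sup>2 \<le> (\<Sum>i\<in>UNIV. \<Sum>j\<in>UNIV. eval_poly (q i j) y * v $ i * v $ j)"
proof (cases "S = {}")
  case True then show ?thesis using that[of 1] by simp
next
  case False
  let ?Q = "\<lambda>y v. \<Sum>i\<in>UNIV. \<Sum>j\<in>UNIV. eval_poly (q i j) y * v $ i * v $ j"
  have "axis undefined 1 \<in> sphere (0 :: real ^ 'n) 1" by simp
  then have ne: "S \<times> sphere (0 :: real ^ 'n) 1 \<noteq> {}" using False by blast
  have "compact (S \<times> sphere (0 :: real ^ 'n) 1)" by (intro compact_Times assms(2) compact_sphere)
  moreover have "continuous_on (S \<times> sphere 0 1) (\<lambda>z. ?Q (fst z) (snd z))"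
    by (intro continuous_intros)
  ultimately obtain z where z: "z \<in> S \<times> sphere 0 1"
    "\<And>w. w \<in> S \<times> sphere 0 1 \<Longrightarrow> ?Q (fst z) (snd z) \<le> ?Q (fst w) (snd w)"
    using continuous_attains_inf[OF _ ne, of "\<lambda>z. ?Q (fst z) (snd z)"] by blast
  show ?thesis
  proof (rule that)
    show "?Q (fst z) (snd z) > 0" using z(1) by (intro assms(1)) auto
    fix y v assume y: "y \<in> S"
    show "?Q (fst z) (snd z) * (norm v)\<^sup>2 \<le> ?Q y v"
    proof (cases "v = 0")
      case False
      define w where "w = (1 / norm v) *\<^sub>R v"
      have v: "v = norm v *\<^sub>R w" using False by (simp add: w_def)
      have "?Q (fst z) (snd z) \<le> ?Q y w" using z(2)[of "(y, w)"] y False by (simp add: w_def)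
      then have "?Q (fst z) (snd z) * (norm v)\<^sup>2 \<le> ?Q y w * (norm v)\<^sup>2" by (intro mult_right_mono) auto
      also have "\<dots> = ?Q y (norm v *\<^sub>R w)"
        by (simp add: sum_distrib_left sum_distrib_right power2_eq_square mult_ac)
      finally show ?thesis using v by simp
    qed simp
  qed
qed

context rpoly_preordering
begin

lemma pd_form_mem:
  assumes "\<And>v :: real ^ 'n. v \<noteq> 0 \<Longrightarrow> 0 < (\<Sum>i\<in>UNIV. \<Sum>j\<in>UNIV. G i j * v $ i * v $ j)"
  shows "(\<Sum>i\<in>UNIV. \<Sum>j\<in>UNIV. const_poly (G i j) * coord i * coord j) \<in> T"
proof -
  have "0 < (\<Sum>i\<in>UNIV. \<Sum>j\<in>UNIV. G i j * y i * y j)" if "\<exists>i\<in>UNIV. y i \<noteq> 0" for y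
  proof -
    have "(\<chi> i. y i) \<noteq> (0 :: real ^ 'n)" using that by (auto simp: vec_eq_iff)
    from assms[OF this] show ?thesis by simp
  qed
  from pd_form_sum_of_squares[OF finite this]
  obtain n :: nat and l where l: "\<And>y. (\<Sum>i\<in>UNIV. \<Sum>j\<in>UNIV. G i j * y i * y j) = (\<Sum>k<n. (\<Sum>i\<in>UNIV. l k i * y i)\<^sup>2)" by blast
  have "(\<Sum>i\<in>UNIV. \<Sum>j\<in>UNIV. const_poly (G i j) * coord i * coord j) =
      (\<Sum>k<n. (\<Sum>i\<in>UNIV. const_poly (l k i) * coord i) * (\<Sum>i\<in>UNIV. const_poly (l k i) * coord i))"
    by (rule eval_poly_ext) (simp add: l power2_eq_square)
  then show ?thesis by (auto intro: T_sum T_square)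
qed

text \<open>The matrix is expanded and not \<open>p\<close>: the Bernstein basis is positive inside
  the box, so a non-zero polynomial with an interior zero always has a negative coefficient. The
  matrix is uniformly positive definite on the box, and its coefficient matrices approach its values
  at grid points, so in high degree all of them are positive definite.\<close>

lemma pd_representation_mem:
  assumes N: "const_poly N - (\<Sum>i\<in>UNIV. coord i * coord i) \<in> T"
    and F: "\<And>i j. real_polynomial_function (F i j)"
    and rep: "\<And>x. eval_poly p x = (\<Sum>i\<in>UNIV. \<Sum>j\<in>UNIV. F i j x * x $ i * x $ j)"
    and pd: "\<And>x v. v \<noteq> 0 \<Longrightarrow> 0 < (\<Sum>i\<in>UNIV. \<Sum>j\<in>UNIV. F i j x * v $ i * v $ j)"
  shows "p \<in> T"
proof -
  \<comment> \<open>The bound on each coordinate given by \<open>coordinates_bounded\<close>; the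
    maximum with 1 makes it positive, so that the box can be rescaled to the unit cube.\<close>
  define R where "R = (max N 1 + 1) / 2"
  have R: "R > 0" by (simp add: R_def)
  have "const_poly (max N 1) - (\<Sum>i\<in>UNIV. coord i * coord i) \<in> T" by (rule T_raise[OF N]) simp
  from coordinates_bounded[OF finite UNIV_I this]
  have Rc: "const_poly R - coord l \<in> T" "const_poly R + coord l \<in> T" for l by (simp_all add: R_def)
  define A :: "real ^ 'n \<Rightarrow> real ^ 'n" where "A y = (2 * R) *\<^sub>R y - (\<chi> l. R)" for y
  have A: "polynomial_function A"
    unfolding A_def[abs_def] by (intro polynomial_function_diff polynomial_function_cmul polynomial_function_const polynomial_function_id)
  have "\<exists>q. eval_poly q = F i j \<circ> A" for i j
    by (intro rpf_imp_eval_poly real_polynomial_function_compose A F)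
  then obtain q where q: "\<And>i j. eval_poly (q i j) = F i j \<circ> A" by metis
  have qpd: "0 < (\<Sum>i\<in>UNIV. \<Sum>j\<in>UNIV. eval_poly (q i j) y * v $ i * v $ j)" if "v \<noteq> 0" for y v
    using pd[OF that] by (simp add: q)
  obtain \<delta> where \<delta>: "\<delta> > 0" "\<And>y v. y \<in> cbox 0 1 \<Longrightarrow>
      \<delta> * (norm v)\<^sup>2 \<le> (\<Sum>i\<in>UNIV. \<Sum>j\<in>UNIV. eval_poly (q i j) y * v $ i * v $ j)"
    by (rule uniformly_pos_definite[of q "cbox 0 1"]) (use qpd in auto)
  define n where "n = real CARD('n)"
  have n: "n > 0" by (simp add: n_def)
  \<comment> \<open>There are n^2 entries, each with error at most \<epsilon> |v|^2, so half of the
    lower bound \<delta> |v|^2 remains.\<close>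
  define \<epsilon> where "\<epsilon> = \<delta> / (2 * n\<^sup>2)"
  have \<epsilon>: "\<epsilon> > 0" using \<delta>(1) n by (simp add: \<epsilon>_def)
  have "\<forall>\<^sub>F d in sequentially. \<forall>z\<in>(UNIV :: ('n \<times> 'n) set). \<forall>\<alpha>. (\<forall>l. \<alpha> l \<le> d) \<longrightarrow>
    \<bar>bernstein_coeff (q (fst z) (snd z)) d \<alpha> - eval_poly (q (fst z) (snd z)) (\<chi> l. real (\<alpha> l) / real d)\<bar> \<le> \<epsilon>"
    by (rule eventually_ball_finite) (use bernstein_coeff_converges[OF \<epsilon>] in auto)
  moreover have "\<forall>\<^sub>F d in sequentially. \<forall>b\<in>(\<Union>i. \<Union>j. \<Union>e\<in>Poly_Mapping.keys (q i j). range (Poly_Mapping.lookup e)). b \<le> d"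
    by (rule eventually_ball_finite) (auto intro: eventually_ge_at_top)
  ultimately have "\<forall>\<^sub>F d in sequentially. (\<forall>z\<in>(UNIV :: ('n \<times> 'n) set). \<forall>\<alpha>. (\<forall>l. \<alpha> l \<le> d) \<longrightarrow>
    \<bar>bernstein_coeff (q (fst z) (snd z)) d \<alpha> - eval_poly (q (fst z) (snd z)) (\<chi> l. real (\<alpha> l) / real d)\<bar> \<le> \<epsilon>) \<and>
    (\<forall>b\<in>(\<Union>i. \<Union>j. \<Union>e\<in>Poly_Mapping.keys (q i j). range (Poly_Mapping.lookup e)). b \<le> d)"
    by (rule eventually_conj)
  then obtain d where d0: "(\<forall>z\<in>(UNIV :: ('n \<times> 'n) set). \<forall>\<alpha>. (\<forall>l. \<alpha> l \<le> d) \<longrightarrow>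
    \<bar>bernstein_coeff (q (fst z) (snd z)) d \<alpha> - eval_poly (q (fst z) (snd z)) (\<chi> l. real (\<alpha> l) / real d)\<bar> \<le> \<epsilon>) \<and>
    (\<forall>b\<in>(\<Union>i. \<Union>j. \<Union>e\<in>Poly_Mapping.keys (q i j). range (Poly_Mapping.lookup e)). b \<le> d)"
    using eventually_happens'[OF sequentially_bot] by blast
  have d1: "\<bar>bernstein_coeff (q i j) d \<alpha> - eval_poly (q i j) (\<chi> l. real (\<alpha> l) / real d)\<bar> \<le> \<epsilon>"
    if "\<And>l. \<alpha> l \<le> d" for i j \<alpha>
    using conjunct1[OF d0, rule_format, of "(i, j)" \<alpha>] that by simp
  have d2: "Poly_Mapping.lookup e l \<le> d" if "e \<in> Poly_Mapping.keys (q i j)" for i j e l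
    using conjunct2[OF d0] that by blast
  let ?I = "Pi\<^sub>E (UNIV :: 'n set) (\<lambda>_. {..d})"
  have Gpd: "0 < (\<Sum>i\<in>UNIV. \<Sum>j\<in>UNIV. bernstein_coeff (q i j) d \<alpha> * v $ i * v $ j)"
    if \<alpha>: "\<alpha> \<in> ?I" and v: "v \<noteq> 0" for \<alpha> and v :: "real ^ 'n"
  proof -
    have \<alpha>d: "\<alpha> l \<le> d" for l using \<alpha> by auto
    define y :: "real ^ 'n" where "y = (\<chi> l. real (\<alpha> l) / real d)"
    have "real (\<alpha> l) / real d \<le> 1" for l using \<alpha>d[of l] by (cases "d = 0") auto
    then have y: "y \<in> cbox 0 1" by (simp add: y_def mem_box_cart)
    have "(\<Sum>i\<in>UNIV. \<Sum>j\<in>UNIV. eval_poly (q i j) y * v $ i * v $ j)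
        - (\<Sum>i\<in>UNIV. \<Sum>j\<in>UNIV. bernstein_coeff (q i j) d \<alpha> * v $ i * v $ j)
      = (\<Sum>i\<in>UNIV. \<Sum>j\<in>UNIV. (eval_poly (q i j) y - bernstein_coeff (q i j) d \<alpha>) * v $ i * v $ j)"
      by (simp add: sum_subtractf left_diff_distrib)
    also have "\<dots> \<le> (\<Sum>i::'n\<in>UNIV. \<Sum>j::'n\<in>UNIV. \<epsilon> * (norm v)\<^sup>2)"
    proof (intro sum_mono)
      fix i j
      have "(eval_poly (q i j) y - bernstein_coeff (q i j) d \<alpha>) * v $ i * v $ j
          \<le> \<bar>eval_poly (q i j) y - bernstein_coeff (q i j) d \<alpha>\<bar> * (\<bar>v $ i\<bar> * \<bar>v $ j\<bar>)"
        by (rule order_trans[OF abs_ge_self]) (simp add: abs_mult mult.assoc)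
      also have "\<dots> \<le> \<epsilon> * (norm v * norm v)"
        using d1[OF \<alpha>d, of i j] \<epsilon>
        by (intro mult_mono component_le_norm_cart) (auto simp: y_def abs_minus_commute)
      finally show "(eval_poly (q i j) y - bernstein_coeff (q i j) d \<alpha>) * v $ i * v $ j \<le> \<epsilon> * (norm v)\<^sup>2"
        by (simp add: power2_eq_square)
    qed
    also have "\<dots> = (\<delta> / 2) * (norm v)\<^sup>2" using n by (simp add: \<epsilon>_def n_def power2_eq_square)
    finally have "\<delta> * (norm v)\<^sup>2 - (\<delta> / 2) * (norm v)\<^sup>2 \<le> (\<Sum>i\<in>UNIV. \<Sum>j\<in>UNIV. bernstein_coeff (q i j) d \<alpha> * v $ i * v $ j)"
      using \<delta>(2)[OF y, of v] by linarith
    moreover have "\<delta> * (norm v)\<^sup>2 - (\<delta> / 2) * (norm v)\<^sup>2 > 0" using \<delta>(1) v by simp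
    ultimately show ?thesis by linarith
  qed
  \<comment> \<open>The rescaled coordinate y_l and its complement 1 - y_l, as elements of
    \<open>T\<close>; every Bernstein basis polynomial is a product of these.\<close>
  define u where "u l = const_poly (1 / (2 * R)) * (const_poly R + coord l)" for l :: 'n
  define u' where "u' l = const_poly (1 / (2 * R)) * (const_poly R - coord l)" for l :: 'n
  have uT: "u l \<in> T" "u' l \<in> T" for l using R Rc by (auto simp: u_def u'_def intro!: T_scale)
  define b where "b \<alpha> = (\<Prod>l\<in>UNIV. const_poly (real (d choose \<alpha> l)) * u l ^ \<alpha> l * u' l ^ (d - \<alpha> l))" for \<alpha> :: "'n \<Rightarrow> nat"
  have bT: "b \<alpha> \<in> T" for \<alpha> unfolding b_def by (intro T_prod T_mult T_power T_const uT) auto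
  have "p = (\<Sum>\<alpha>\<in>?I. b \<alpha> * (\<Sum>i\<in>UNIV. \<Sum>j\<in>UNIV. const_poly (bernstein_coeff (q i j) d \<alpha>) * coord i * coord j))"
  proof (rule eval_poly_ext)
    fix x :: "real ^ 'n"
    define y :: "real ^ 'n" where "y = (\<chi> l. (R + x $ l) / (2 * R))"
    have Ay: "A y = x" using R by (simp add: A_def y_def vec_eq_iff)
    have b: "eval_poly (b \<alpha>) x = bernstein_basis d \<alpha> y" for \<alpha>
    proof -
      have "1 - y $ l = (R - x $ l) / (2 * R)" for l using R by (simp add: y_def field_simps)
      then show ?thesis by (simp add: b_def bernstein_basis_def u_def u'_def y_def)
    qed
    have "eval_poly p x = (\<Sum>i\<in>UNIV. \<Sum>j\<in>UNIV. eval_poly (q i j) y * x $ i * x $ j)"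
      by (simp add: rep q Ay)
    also have "\<dots> = (\<Sum>i\<in>UNIV. \<Sum>j\<in>UNIV. \<Sum>\<alpha>\<in>?I. bernstein_coeff (q i j) d \<alpha> * bernstein_basis d \<alpha> y * x $ i * x $ j)"
      by (simp only: bernstein_expansion[of "q _ _", OF d2] sum_distrib_right)
    also have "\<dots> = (\<Sum>i\<in>UNIV. \<Sum>\<alpha>\<in>?I. \<Sum>j\<in>UNIV. bernstein_coeff (q i j) d \<alpha> * bernstein_basis d \<alpha> y * x $ i * x $ j)"
      by (intro sum.cong sum.swap refl)
    also have "\<dots> = (\<Sum>\<alpha>\<in>?I. \<Sum>i\<in>UNIV. \<Sum>j\<in>UNIV. bernstein_coeff (q i j) d \<alpha> * bernstein_basis d \<alpha> y * x $ i * x $ j)"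
      by (rule sum.swap)
    also have "\<dots> = eval_poly (\<Sum>\<alpha>\<in>?I. b \<alpha> * (\<Sum>i\<in>UNIV. \<Sum>j\<in>UNIV. const_poly (bernstein_coeff (q i j) d \<alpha>) * coord i * coord j)) x"
      by (simp add: b sum_distrib_left mult_ac)
    finally show "eval_poly p x = \<dots>" .
  qed
  moreover have "(\<Sum>\<alpha>\<in>?I. b \<alpha> * (\<Sum>i\<in>UNIV. \<Sum>j\<in>UNIV. const_poly (bernstein_coeff (q i j) d \<alpha>) * coord i * coord j)) \<in> T"
    by (intro T_sum T_mult bT pd_form_mem Gpd) auto
  ultimately show ?thesis by simp
qed

end

section \<open>Sums of squares\<close>

lemma sos_add: "p \<in> sos_polys \<Longrightarrow> q \<in> sos_polys \<Longrightarrow> p + q \<in> sos_polys"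
proof -
  assume "p \<in> sos_polys" "q \<in> sos_polys"
  then obtain ps qs where "p = (\<Sum>q\<leftarrow>ps. q ^ 2)" "q = (\<Sum>q\<leftarrow>qs. q ^ 2)" unfolding sos_polys_def by blast
  then have "p + q = (\<Sum>q\<leftarrow>ps @ qs. q ^ 2)" by simp
  then show ?thesis unfolding sos_polys_def by blast
qed

lemma sos_square: "p * p \<in> sos_polys"
  unfolding sos_polys_def by (auto intro!: exI[of _ "[p]"] simp: power2_eq_square)

lemma sos_0: "0 \<in> sos_polys"
  using sos_square[of 0] by simp

lemma sos_const: "0 \<le> a \<Longrightarrow> const_poly a \<in> sos_polys"
  using sos_square[of "const_poly (sqrt a)"] by (simp flip: const_poly_mult)

lemma sos_mult: "p \<in> sos_polys \<Longrightarrow> q \<in> sos_polys \<Longrightarrow> p * q \<in> sos_polys"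
proof -
  have 1: "r ^ 2 * (\<Sum>q\<leftarrow>qs. q ^ 2) \<in> sos_polys" for r :: "'a rpoly" and qs
  proof (induction qs)
    case (Cons a qs)
    have "r ^ 2 * (\<Sum>q\<leftarrow>a # qs. q ^ 2) = (r * a) * (r * a) + r ^ 2 * (\<Sum>q\<leftarrow>qs. q ^ 2)"
      by (simp add: power2_eq_square algebra_simps)
    then show ?case using Cons sos_add sos_square by metis
  qed (simp add: sos_0)
  have "(\<Sum>p\<leftarrow>ps. p ^ 2) * (\<Sum>q\<leftarrow>qs. q ^ 2) \<in> sos_polys" for ps qs :: "'a rpoly list"
    by (induction ps) (auto simp: sos_0 distrib_right intro: sos_add 1)
  then show "p \<in> sos_polys \<Longrightarrow> q \<in> sos_polys \<Longrightarrow> p * q \<in> sos_polys" unfolding sos_polys_def by blast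
qed

lemma eval_sos_nonneg:
  assumes "p \<in> sos_polys" shows "eval_poly p x \<ge> 0"
proof -
  have "eval_poly (\<Sum>q\<leftarrow>qs. q ^ 2) x \<ge> 0" for qs :: "'a rpoly list"
    by (induction qs) auto
  then show ?thesis using assms unfolding sos_polys_def by blast
qed

lemma preordering_single_generator:
  "rpoly_preordering {a + b * w | a b. a \<in> sos_polys \<and> b \<in> sos_polys}"
proof -
  have sos: "preordering const_poly sos_polys"
    by unfold_locales (auto simp: const_poly_add const_poly_mult const_poly_1 sos_add sos_mult sos_square)
  have "{a + b * w | a b. a \<in> sos_polys \<and> b \<in> sos_polys} = preordering.adjoin sos_polys w"
    unfolding preordering.adjoin_def[OF sos] by (simp add: mult.commute)
  then show ?thesis
    using preordering.preordering_adjoin[OF sos, of w] by (simp add: rpoly_preordering_def)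
qed

theorem sos_representation_at_minimizer_0:
  fixes p :: "'n::finite rpoly"
  assumes "convex_on UNIV (eval_poly p)" "eval_poly p 0 = 0" "\<And>x. eval_poly p x \<ge> 0"
    and "pos_definite (hessian (eval_poly p) 0)"
  shows "\<exists>a\<in>sos_polys. \<exists>b\<in>sos_polys. p = a + b * (const_poly r - p)"
proof -
  obtain F where F: "\<And>i j. real_polynomial_function (F i j)"
    "\<And>x. eval_poly p x = (\<Sum>i\<in>UNIV. \<Sum>j\<in>UNIV. F i j x * x $ i * x $ j)"
    "\<And>x v. v \<noteq> 0 \<Longrightarrow> 0 < (\<Sum>i\<in>UNIV. \<Sum>j\<in>UNIV. F i j x * v $ i * v $ j)"
    using convex_quadratic_representation[OF rpf_eval_poly assms] by blast
  interpret rpoly_preordering "{a + b * (const_poly r - p) | a b. a \<in> sos_polys \<and> b \<in> sos_polys}"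
    by (rule preordering_single_generator)
  \<comment> \<open>That the minimum is strict is read off the representation by the positive
    definite matrix \<open>F\<close>.\<close>
  have "convex_polynomial (eval_poly p)"
    by unfold_locales (use assms(1,2) rpf_eval_poly F(2,3) in auto)
  moreover have "const_poly r - p \<in> {a + b * (const_poly r - p) | a b. a \<in> sos_polys \<and> b \<in> sos_polys}"
  proof -
    have "const_poly r - p = 0 + 1 * (const_poly r - p)" by simp
    moreover have "1 \<in> sos_polys" using sos_square[of 1] by simp
    ultimately show ?thesis using sos_0 by blast
  qed
  ultimately obtain N where "const_poly N - (\<Sum>i\<in>UNIV. coord i * coord i) \<in> {a + b * (const_poly r - p) | a b. a \<in> sos_polys \<and> b \<in> sos_polys}"
    using archimedean_of_convex preordering_axioms by blast
  from pd_representation_mem[OF this F] show ?thesis by blast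
qed

section \<open>Translation to an arbitrary minimizer\<close>

definition shift_poly :: "real ^ 'n::finite \<Rightarrow> 'n rpoly \<Rightarrow> 'n rpoly" where
  "shift_poly z p = (SOME q. eval_poly q = (\<lambda>x. eval_poly p (x + z)))"

lemma eval_shift_poly [simp]: "eval_poly (shift_poly z p) x = eval_poly p (x + z)"
proof -
  have "polynomial_function (\<lambda>x. x + z)" by auto
  from real_polynomial_function_compose[OF this rpf_eval_poly]
  have "\<exists>q. eval_poly q = (\<lambda>x. eval_poly p (x + z))" by (intro rpf_imp_eval_poly) (simp add: comp_def)
  from someI_ex[OF this] show ?thesis by (simp add: shift_poly_def)
qed

lemma shift_poly_sos:
  assumes "p \<in> sos_polys" shows "shift_poly z p \<in> sos_polys"
proof -
  obtain qs where qs: "p = (\<Sum>q\<leftarrow>qs. q ^ 2)" using assms unfolding sos_polys_def by blast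
  have "eval_poly (\<Sum>q\<leftarrow>qs. q ^ 2) (x + z) = eval_poly (\<Sum>q\<leftarrow>map (shift_poly z) qs. q ^ 2) x" for x
    by (induction qs) auto
  then have "shift_poly z p = (\<Sum>q\<leftarrow>map (shift_poly z) qs. q ^ 2)"
    unfolding qs by (intro eval_poly_ext) simp
  then show ?thesis unfolding sos_polys_def by blast
qed

lemma partial_deriv_shift: "partial_deriv i (\<lambda>y. h (y + z)) x = partial_deriv i h (x + z)"
  by (simp add: partial_deriv_def algebra_simps)

theorem sos_representation_at_minimizer:
  fixes p :: "'n::finite rpoly"
  assumes conv: "convex_on UNIV (eval_poly p)" and z: "eval_poly p z = 0" "\<And>x. eval_poly p x \<ge> 0"
    and pd: "pos_definite (hessian (eval_poly p) z)"
  obtains a b where "a \<in> sos_polys" "b \<in> sos_polys" "p = a + b * (const_poly r - p)"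
proof -
  have ev: "eval_poly (shift_poly z p) = (\<lambda>x. eval_poly p (x + z))" by (rule ext) simp
  have hess: "hessian (eval_poly (shift_poly z p)) 0 = hessian (eval_poly p) z"
  proof -
    have "partial_deriv j (\<lambda>x. eval_poly p (x + z)) = (\<lambda>x. partial_deriv j (eval_poly p) (x + z))" for j
      by (rule ext) (rule partial_deriv_shift)
    then show ?thesis unfolding hessian_def ev by (simp add: partial_deriv_shift)
  qed
  have "convex_on UNIV (eval_poly (shift_poly z p))"
  proof (rule convex_onI)
    fix t :: real and x y assume t: "0 < t" "t < 1"
    have "(1 - t) *\<^sub>R x + t *\<^sub>R y + z = (1 - t) *\<^sub>R (x + z) + t *\<^sub>R (y + z)" by (simp add: algebra_simps)
    then show "eval_poly (shift_poly z p) ((1 - t) *\<^sub>R x + t *\<^sub>R y) \<le>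
        (1 - t) * eval_poly (shift_poly z p) x + t * eval_poly (shift_poly z p) y"
      using convex_onD[OF conv, of t "x + z" "y + z"] t by simp
  qed simp
  then have "\<exists>a\<in>sos_polys. \<exists>b\<in>sos_polys. shift_poly z p = a + b * (const_poly r - shift_poly z p)"
    by (rule sos_representation_at_minimizer_0) (use z pd hess in auto)
  then obtain a b where ab: "a \<in> sos_polys" "b \<in> sos_polys" "shift_poly z p = a + b * (const_poly r - shift_poly z p)" by blast
  have "eval_poly p x = eval_poly (shift_poly (- z) a + shift_poly (- z) b * (const_poly r - p)) x" for x
    using arg_cong[OF ab(3), of "\<lambda>q. eval_poly q (x - z)"] by simp
  then have "p = shift_poly (- z) a + shift_poly (- z) b * (const_poly r - p)" by (rule eval_poly_ext)
  then show ?thesis using that shift_poly_sos ab(1,2) by blast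
qed

section \<open>From the Lagrangian to the truncated quadratic module\<close>

lemma convex_on_finite_sum:
  "convex S \<Longrightarrow> (\<And>i. i \<in> I \<Longrightarrow> convex_on S (F i)) \<Longrightarrow> convex_on S (\<lambda>x. \<Sum>i\<in>I. F i x)"
  by (induction I rule: infinite_finite_induct) (auto intro: convex_on_add simp: convex_on_const)

lemma deg_le_bound: "\<exists>d\<ge>0. deg_le q d"
proof -
  let ?D = "Max (insert 0 ((\<lambda>e. int (\<Sum>i\<in>UNIV. Poly_Mapping.lookup e i)) ` Poly_Mapping.keys q))"
  have "deg_le q ?D" unfolding deg_le_def by (intro ballI Max_ge) auto
  moreover have "?D \<ge> 0" by (intro Max_ge) auto
  ultimately show ?thesis by blast
qed

lemma deg_le_mono: "deg_le q d \<Longrightarrow> d \<le> d' \<Longrightarrow> deg_le q d'"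
  unfolding deg_le_def by fastforce

lemma hessian_diff_const: "hessian (eval_poly (p - const_poly a)) = hessian (eval_poly p)"
proof -
  obtain D where D: "\<forall>x. (eval_poly p has_derivative (\<lambda>v. \<Sum>i\<in>UNIV. v $ i * D i x)) (at x)"
    using rpf_derivative[OF rpf_eval_poly] by blast
  have "(eval_poly (p - const_poly a) has_derivative (\<lambda>v. \<Sum>i\<in>UNIV. v $ i * D i x)) (at x)" for x
  proof -
    have "eval_poly (p - const_poly a) = (\<lambda>x. eval_poly p x - a)" by (rule ext) simp
    then show ?thesis using has_derivative_diff[OF D[rule_format, of x] has_derivative_const[of a]] by simp
  qed
  then have "partial_deriv i (eval_poly (p - const_poly a)) = partial_deriv i (eval_poly p)" for i
    using partial_deriv_eq[of "eval_poly (p - const_poly a)" D] partial_deriv_eq[of "eval_poly p" D] D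
    by (intro ext) metis
  then show ?thesis by (simp add: hessian_def[abs_def])
qed

text \<open>Weak duality: applied to f - \<mu> at the optimal point it shows that no feasible \<mu>
  exceeds the optimal value.\<close>

lemma trunc_qmodule_nonneg:
  assumes "q \<in> trunc_qmodule f g c k" "x \<in> feasible_set g" "eval_poly f x \<le> c"
  shows "eval_poly q x \<ge> 0"
proof -
  obtain \<sigma> \<sigma>0 \<sigma>s where q: "q = \<sigma>0 - (\<Sum>i\<in>UNIV. \<sigma>s i * g i) + \<sigma> * (const_poly c - f)"
    and sos: "\<sigma> \<in> sos_polys" "\<sigma>0 \<in> sos_polys" "\<And>i. \<sigma>s i \<in> sos_polys"
    using assms(1) unfolding trunc_qmodule_def by blast
  have "(\<Sum>i\<in>UNIV. eval_poly (\<sigma>s i) x * eval_poly (g i) x) \<le> 0"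
    using assms(2) eval_sos_nonneg[OF sos(3)]
    by (intro sum_nonpos) (auto simp: feasible_set_def mult_nonneg_nonpos)
  moreover have "eval_poly \<sigma> x * (c - eval_poly f x) \<ge> 0"
    using assms(3) eval_sos_nonneg[OF sos(1)] by simp
  ultimately show ?thesis using eval_sos_nonneg[OF sos(2), of x] by (simp add: q)
qed

theorem theorem3p3:
  fixes f :: "'n::finite rpoly"
    and g :: "'m::finite \<Rightarrow> 'n rpoly"
    and xs :: "real ^ 'n" and ls :: "real ^ 'm"
    and c :: real
  assumes "convex_on UNIV (eval_poly f)"
    and "\<And>i. convex_on UNIV (eval_poly (g i))"
    and "feasible_set g \<noteq> {}"
    and "xs \<in> feasible_set g"
    and "saddle_point (lagrangian f g) xs ls"
    and "pos_definite (hessian (\<lambda>x. lagrangian f g x ls) xs)"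
    and "\<exists>x0\<in>feasible_set g. c > eval_poly f x0"
  shows "\<exists>k :: int. relax_value f g c k = opt_value f g \<and>
           (\<exists>\<mu>\<in>relax_feasible f g c k. ereal \<mu> = relax_value f g c k)"
proof -
  define fs where "fs = eval_poly f xs"
  define L where "L = f + (\<Sum>i\<in>UNIV. const_poly (ls $ i) * g i)"
  have L: "eval_poly L = (\<lambda>x. lagrangian f g x ls)"
    by (rule ext) (simp add: L_def lagrangian_def)
  have ls: "ls $ i \<ge> 0" for i
    using assms(5) by (simp add: saddle_point_def nonneg_orthant_def)
  have slack: "(\<Sum>i\<in>UNIV. ls $ i * eval_poly (g i) x) \<le> 0" if "x \<in> feasible_set g" for x
    using that ls by (intro sum_nonpos) (auto simp: feasible_set_def mult_nonneg_nonpos)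
  \<comment> \<open>Comparison with the zero multiplier gives one inequality between the saddle
    value and \<open>fs\<close>, feasibility of \<open>xs\<close> the other; together they are
    complementary slackness.\<close>
  have "0 \<in> (nonneg_orthant :: (real ^ 'm) set)" by (simp add: nonneg_orthant_def)
  then have "lagrangian f g xs ls \<ge> lagrangian f g xs 0"
    using assms(5) unfolding saddle_point_def by blast
  then have Lxs: "lagrangian f g xs ls = fs"
    using slack[OF assms(4)] by (simp add: lagrangian_def fs_def)
  have Lmin: "lagrangian f g x ls \<ge> fs" for x
    using assms(5) Lxs unfolding saddle_point_def by metis
  have fmin: "fs \<le> eval_poly f x" if "x \<in> feasible_set g" for x
    using Lmin[of x] slack[OF that] by (simp add: lagrangian_def)
  have opt: "opt_value f g = ereal fs"
    unfolding opt_value_def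
  proof (rule antisym)
    show "(INF x\<in>feasible_set g. ereal (eval_poly f x)) \<le> ereal fs"
      unfolding fs_def by (rule INF_lower[OF assms(4)])
    show "ereal fs \<le> (INF x\<in>feasible_set g. ereal (eval_poly f x))"
      by (rule INF_greatest) (simp add: fmin)
  qed
  define p where "p = L - const_poly fs"
  have "convex_on UNIV (eval_poly p)"
  proof -
    have "convex_on UNIV (\<lambda>x. ls $ i * eval_poly (g i) x)" for i
      using assms(2) ls by (intro convex_on_cmul) auto
    then have "convex_on UNIV (\<lambda>x. eval_poly f x + (\<Sum>i\<in>UNIV. ls $ i * eval_poly (g i) x) + (- fs))"
      by (intro convex_on_add assms(1) convex_on_finite_sum convex_on_const[THEN iffD2]) auto
    then show ?thesis by (simp add: p_def L_def[symmetric] L lagrangian_def[abs_def] eval_poly_diff[abs_def])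
  qed
  moreover have "eval_poly p xs = 0" "\<And>x. eval_poly p x \<ge> 0"
    using Lxs Lmin by (simp_all add: p_def L)
  moreover have "pos_definite (hessian (eval_poly p) xs)"
    using assms(6) unfolding p_def hessian_diff_const L .
  ultimately obtain \<sigma>0 \<sigma> where sos: "\<sigma>0 \<in> sos_polys" "\<sigma> \<in> sos_polys" "p = \<sigma>0 + \<sigma> * (const_poly (c - fs) - p)"
    by (rule sos_representation_at_minimizer)
  \<comment> \<open>The 1 removes the Lagrange terms from \<open>p\<close> to leave f - fs; the
    factor \<open>\<sigma>\<close> comes from \<open>const_poly (c - fs) - p\<close>, which is c - f
    minus the same Lagrange terms.\<close>
  define \<sigma>s where "\<sigma>s i = const_poly (ls $ i) * (1 + \<sigma>)" for i
  have \<sigma>s: "\<sigma>s i \<in> sos_polys" for i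
    unfolding \<sigma>s_def using sos_square[of 1] by (intro sos_mult sos_add sos_const ls sos(2)) simp
  have rep: "f - const_poly fs = \<sigma>0 - (\<Sum>i\<in>UNIV. \<sigma>s i * g i) + \<sigma> * (const_poly c - f)"
  proof (rule eval_poly_ext)
    fix x
    have "(\<Sum>i\<in>UNIV. eval_poly (\<sigma>s i) x * eval_poly (g i) x) =
        (1 + eval_poly \<sigma> x) * (\<Sum>i\<in>UNIV. ls $ i * eval_poly (g i) x)"
      by (simp add: \<sigma>s_def sum_distrib_left mult_ac)
    then show "eval_poly (f - const_poly fs) x =
        eval_poly (\<sigma>0 - (\<Sum>i\<in>UNIV. \<sigma>s i * g i) + \<sigma> * (const_poly c - f)) x"
      using arg_cong[OF sos(3), of "\<lambda>q. eval_poly q x"]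
      by (simp add: p_def L_def algebra_simps)
  qed
  have "\<exists>d. \<forall>q. d q \<ge> 0 \<and> deg_le q (d q)" for q :: "'n rpoly"
    using deg_le_bound by metis
  then obtain d where d: "\<And>q :: 'n rpoly. d q \<ge> 0" "\<And>q :: 'n rpoly. deg_le q (d q)" by metis
  \<comment> \<open>A sum of non-negative degree bounds, so it dominates each of them, and 2k does
    as well.\<close>
  define k where "k = d \<sigma>0 + (\<Sum>i\<in>UNIV. d (\<sigma>s i * g i)) + d (\<sigma> * (const_poly c - f))"
  have S: "(\<Sum>i\<in>UNIV. d (\<sigma>s i * g i)) \<ge> 0" by (intro sum_nonneg d(1))
  have "d (\<sigma>s i * g i) \<le> (\<Sum>i\<in>UNIV. d (\<sigma>s i * g i))" for i
    by (rule member_le_sum) (auto intro: d(1))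
  then have "d (\<sigma>s i * g i) \<le> 2 * k" for i
    using d(1)[of \<sigma>0] d(1)[of "\<sigma> * (const_poly c - f)"] S by (smt (verit) k_def)
  moreover have "d \<sigma>0 \<le> 2 * k" "d (\<sigma> * (const_poly c - f)) \<le> 2 * k"
    using d(1)[of \<sigma>0] d(1)[of "\<sigma> * (const_poly c - f)"] S by (simp_all add: k_def)
  ultimately have "deg_le \<sigma>0 (2 * k)" "\<And>i. deg_le (\<sigma>s i * g i) (2 * k)"
    "deg_le (\<sigma> * (const_poly c - f)) (2 * k)"
    using deg_le_mono d(2) by blast+
  then have "f - const_poly fs \<in> trunc_qmodule f g c k"
    unfolding trunc_qmodule_def using rep sos(1,2) \<sigma>s by blast
  then have feas: "fs \<in> relax_feasible f g c k" by (simp add: relax_feasible_def)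
  have le: "\<mu> \<le> fs" if "\<mu> \<in> relax_feasible f g c k" for \<mu>
  proof -
    \<comment> \<open>The strictly better point x0 is feasible, so its value lies between
      \<open>fs\<close> and \<open>c\<close>; thus \<open>xs\<close> also satisfies the added
      constraint f \<le> c.\<close>
    have "fs \<le> c" using assms(7) fmin by fastforce
    then have "eval_poly (f - const_poly \<mu>) xs \<ge> 0"
      using that assms(4) by (intro trunc_qmodule_nonneg) (auto simp: relax_feasible_def fs_def)
    then show ?thesis by (simp add: fs_def)
  qed
  have "relax_value f g c k = ereal fs"
    unfolding relax_value_def
    by (rule antisym) (auto intro!: SUP_least SUP_upper2[OF feas] simp: le)
  then show ?thesis using feas opt by auto
qed

end
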